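(* Let $\mathbb K$ be a field, let $d$ be a nonnegative integer and let $A,A^*$ be matrices in $\mathrm{Mat}_{d+1}(\mathbb K)$. Assume $A$ is lower bidiagonal and $A^*$ is upper bidiagonal. Then the following (i), (ii) are equivalent. (i) The pair $A,A^*$ is a Leonard pair in $\mathrm{Mat}_{d+1}(\mathbb K)$. (ii) There exists a parameter array $(\theta_i,\theta^*_i,i=0..d;\varphi_j,\phi_j,j=1..d)$ over $\mathbb K$ such that $$A_{ii}=\theta_i,\qquad A^*_{ii}=\theta^*_i\qquad(0\le i\le d),$$ $$A_{i,i-1}A^*_{i-1,i}=\varphi_i\qquad(1\le i\le d).$$ Suppose (i), (ii) hold. Then the parameter array in (ii) is uniquely determined by $A,A^*$. This parameter array is the designated parameter array for $A,A^*$.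
   Context: $\mathrm{Mat}_{d+1}(\mathbb K)$ is the algebra of $(d+1)\times(d+1)$ matrices over $\mathbb K$, rows and columns indexed by $0,1,\dots,d$. A matrix is lower bidiagonal if every nonzero entry lies on the diagonal or the subdiagonal, and upper bidiagonal if its transpose is lower bidiagonal. Leonard pairs and systems. Let $\mathcal A$ be a $\mathbb K$-algebra isomorphic to $\mathrm{Mat}_{d+1}(\mathbb K)$. An element $A\in\mathcal A$ is multiplicity-free if it has $d+1$ distinct eigenvalues in $\mathbb K$; if these are $\theta_0,\dots,\theta_d$, the primitive idempotent of $A$ associated with $\theta_i$ is $E_i=\prod_{j\ne i}(A-\theta_jI)/(\theta_i-\theta_j)$. For multiplicity-free $A,A^*\in\mathcal A$ ($A^*$ is just a name, not an adjoint), an idempotent sequence for $A,A^*$ is an ordering $E_0,\dots,E_d$ of the primitive idempotents of $A$ such that $E_iA^*E_j=0$ if $|i-j|>1$ and $E_iA^*E_j\ne0$ if $|i-j|=1$ ($0\le i,j\le d$); a dual idempotent sequence for $A,A^*$ is an idempotent sequence for $A^*,A$. A Leonard pair in $\mathcal A$ is an ordered pair $A,A^*$ of multiplicity-free elements of $\mathcal A$ for which an idempotent sequence and a dual idempotent sequence exist. A Leonard system in $\mathcal A$ is a sequence $\Phi=(A,A^*;E_i,E^*_i,i=0..d)$ where $A,A^*\in\mathcal A$ are multiplicity-free, $E_0,\dots,E_d$ is an idempotent sequence for $A,A^*$ and $E^*_0,\dots,E^*_d$ is a dual idempotent sequence for $A,A^*$; then $A,A^*$ is a Leonard pair, said to be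 associated with $\Phi$. The eigenvalue sequence (resp. dual eigenvalue sequence) of $\Phi$ is $\theta_0,\dots,\theta_d$ (resp. $\theta^*_0,\dots,\theta^*_d$), where $\theta_i$ (resp. $\theta^*_i$) is the eigenvalue of $A$ (resp. $A^*$) associated with $E_i$ (resp. $E^*_i$). Split sequences. Let $V$ be an irreducible left $\mathcal A$-module (unique up to isomorphism, of dimension $d+1$) and set $U_i=(E^*_0V+\cdots+E^*_iV)\cap(E_iV+\cdots+E_dV)$. It is known that each $U_i$ has dimension 1, $V$ is the direct sum of $U_0,\dots,U_d$, $(A-\theta_iI)U_i=U_{i+1}$ ($0\le i\le d-1$), $(A-\theta_dI)U_d=0$, $(A^*-\theta^*_iI)U_i=U_{i-1}$ ($1\le i\le d$), $(A^*-\theta_0^*I)U_0=0$. For $1\le i\le d$, $\varphi_i$ is the (nonzero) eigenvalue of $(A-\theta_{i-1}I)(A^*-\theta^*_iI)$ on $U_i$. The sequence $\varphi_1,\dots,\varphi_d$ is the first split sequence of $\Phi$. The second split sequence $\phi_1,\dots,\phi_d$ of $\Phi$ is the first split sequence of $\Phi^\Downarrow=(A,A^*;E_{d-i},E^*_i,i=0..d)$. Parameter arrays. A parameter array over $\mathbb K$ of diameter $d$ is a sequence $(\theta_i,\theta^*_i,i=0..d;\varphi_j,\phi_j,j=1..d)$ of scalars in $\mathbb K$ such that: (1) $\varphi_i\ne0$, $\phi_i\ne0$ ($1\le i\le d$); (2) $\theta_i\ne\theta_j$, $\theta^*_i\ne\theta^*_j$ if $i\ne j$; (3) $\varphi_i=\phi_1\sum_{h=0}^{i-1}\frac{\theta_h-\theta_{d-h}}{\theta_0-\theta_d}+(\theta^*_i-\theta^*_0)(\theta_{i-1}-\theta_d)$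 ($1\le i\le d$); (4) $\phi_i=\varphi_1\sum_{h=0}^{i-1}\frac{\theta_h-\theta_{d-h}}{\theta_0-\theta_d}+(\theta^*_i-\theta^*_0)(\theta_{d-i+1}-\theta_0)$ ($1\le i\le d$); (5) the expressions $\frac{\theta_{i-2}-\theta_{i+1}}{\theta_{i-1}-\theta_i}$ and $\frac{\theta^*_{i-2}-\theta^*_{i+1}}{\theta^*_{i-1}-\theta^*_i}$ are equal and independent of $i$ for $2\le i\le d-1$. The parameter array of a Leonard system $\Phi$ consists of its eigenvalue sequence, dual eigenvalue sequence, first split sequence and second split sequence; it is known that this sequence is a parameter array over $\mathbb K$ of diameter $d$, and that $\Phi\mapsto$ (parameter array of $\Phi$) induces a bijection from isomorphism classes of Leonard systems over $\mathbb K$ to parameter arrays over $\mathbb K$. Designated parameter array. If $A,A^*$ is a Leonard pair in $\mathrm{Mat}_{d+1}(\mathbb K)$ with $A$ lower bidiagonal and $A^*$ upper bidiagonal, then there is a unique Leonard system associated with $A,A^*$ having eigenvalue sequence $A_{00},A_{11},\dots,A_{dd}$ and dual eigenvalue sequence $A^*_{00},A^*_{11},\dots,A^*_{dd}$; it is called the designated Leonard system for $A,A^*$, and its parameter array is the designated parameter array for $A,A^*$. *)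

theory Defs
  imports "Jordan_Normal_Form.Char_Poly"
begin

text \<open>
  Matrices of order \<open>d + 1\<close> are members of \<open>carrier_mat (d + 1) (d + 1)\<close>, whose rows and columns
  are indexed by \<open>0, \<dots>, d\<close>.  The suffix \<open>s\<close> (as in \<open>As\<close>, \<open>Es\<close>, \<open>\<theta>s\<close>) stands for the star of
  the dual objects.  Finite sequences are functions on \<open>nat\<close> of which only the values at the
  indices \<open>0, \<dots>, d\<close> (for \<open>\<theta>\<close>, \<open>\<theta>s\<close>, \<open>E\<close>, \<open>Es\<close>) or \<open>1, \<dots>, d\<close> (for the split sequences)
  matter.  Throughout, the algebra is the full matrix algebra of order \<open>d + 1\<close>, acting on its
  irreducible module of column vectors.
\<close>

definition lower_bidiagonal :: "'a::zero mat \<Rightarrow> bool" where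
  "lower_bidiagonal A \<longleftrightarrow>
     (\<forall>i < dim_row A. \<forall>j < dim_col A. A $$ (i, j) \<noteq> 0 \<longrightarrow> i = j \<or> i = j + 1)"

definition upper_bidiagonal :: "'a::zero mat \<Rightarrow> bool" where
  "upper_bidiagonal A \<longleftrightarrow> lower_bidiagonal (transpose_mat A)"


section \<open>Leonard pairs and Leonard systems\<close>

definition multiplicity_free :: "nat \<Rightarrow> 'a::field mat \<Rightarrow> bool" where
  "multiplicity_free d A \<longleftrightarrow>
     A \<in> carrier_mat (d + 1) (d + 1) \<and> card {x. eigenvalue A x} = d + 1"

text \<open>The factors commute, so that the order of multiplication chosen here is immaterial.\<close>

definition primitive_idempotent :: "nat \<Rightarrow> 'a::field mat \<Rightarrow> (nat \<Rightarrow> 'a) \<Rightarrow> nat \<Rightarrow> 'a mat" where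
  "primitive_idempotent d A \<theta> i =
     foldr (\<lambda>j M. (1 / (\<theta> i - \<theta> j)) \<cdot>\<^sub>m (A - \<theta> j \<cdot>\<^sub>m 1\<^sub>m (d + 1)) * M)
       (filter (\<lambda>j. j \<noteq> i) [0..<d + 1]) (1\<^sub>m (d + 1))"

text \<open>
  \<open>E 0, \<dots>, E d\<close> are the primitive idempotents of the multiplicity-free matrix \<open>A\<close>, and \<open>\<theta> i\<close> is
  the eigenvalue of \<open>A\<close> associated with \<open>E i\<close>.
\<close>

definition eigenvalue_sequence ::
    "nat \<Rightarrow> 'a::field mat \<Rightarrow> (nat \<Rightarrow> 'a mat) \<Rightarrow> (nat \<Rightarrow> 'a) \<Rightarrow> bool" where
  "eigenvalue_sequence d A E \<theta> \<longleftrightarrow>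
     bij_betw \<theta> {0..d} {x. eigenvalue A x} \<and>
     (\<forall>i\<le>d. E i = primitive_idempotent d A \<theta> i)"

definition idempotent_sequence ::
    "nat \<Rightarrow> 'a::field mat \<Rightarrow> 'a mat \<Rightarrow> (nat \<Rightarrow> 'a mat) \<Rightarrow> bool" where
  "idempotent_sequence d A As E \<longleftrightarrow>
     (\<exists>\<theta>. eigenvalue_sequence d A E \<theta>) \<and>
     (\<forall>i\<le>d. \<forall>j\<le>d.
        (\<bar>int i - int j\<bar> > 1 \<longrightarrow> E i * As * E j = 0\<^sub>m (d + 1) (d + 1)) \<and>
        (\<bar>int i - int j\<bar> = 1 \<longrightarrow> E i * As * E j \<noteq> 0\<^sub>m (d + 1) (d + 1)))"

definition Leonard_pair :: "nat \<Rightarrow> 'a::field mat \<Rightarrow> 'a mat \<Rightarrow> bool" where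
  "Leonard_pair d A As \<longleftrightarrow>
     multiplicity_free d A \<and> multiplicity_free d As \<and>
     (\<exists>E. idempotent_sequence d A As E) \<and> (\<exists>Es. idempotent_sequence d As A Es)"

definition Leonard_system ::
    "nat \<Rightarrow> 'a::field mat \<Rightarrow> 'a mat \<Rightarrow> (nat \<Rightarrow> 'a mat) \<Rightarrow> (nat \<Rightarrow> 'a mat) \<Rightarrow> bool" where
  "Leonard_system d A As E Es \<longleftrightarrow>
     multiplicity_free d A \<and> multiplicity_free d As \<and>
     idempotent_sequence d A As E \<and> idempotent_sequence d As A Es"


section \<open>Split sequences\<close>

text \<open>The sum of the subspaces \<open>E h V\<close>, \<open>h \<in> I\<close>, where \<open>V\<close> is the space of column vectors.\<close>

definition sum_of_images :: "nat \<Rightarrow> (nat \<Rightarrow> 'a::field mat) \<Rightarrow> nat set \<Rightarrow> 'a vec set" where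
  "sum_of_images d E I =
     {finsum_vec TYPE('a) (d + 1) (\<lambda>h. E h *\<^sub>v w h) I | w. \<forall>h\<in>I. w h \<in> carrier_vec (d + 1)}"

definition split_space ::
    "nat \<Rightarrow> (nat \<Rightarrow> 'a::field mat) \<Rightarrow> (nat \<Rightarrow> 'a mat) \<Rightarrow> nat \<Rightarrow> 'a vec set" where
  "split_space d E Es i = sum_of_images d Es {0..i} \<inter> sum_of_images d E {i..d}"

text \<open>
  For a Leonard system, \<open>split_space d E Es i\<close> is one-dimensional, so that the conditions below
  determine \<open>\<phi> i\<close>.  The nontriviality requirement makes \<open>\<phi> i\<close> an actual eigenvalue.
\<close>

definition first_split_sequence ::
    "nat \<Rightarrow> 'a::field mat \<Rightarrow> 'a mat \<Rightarrow> (nat \<Rightarrow> 'a mat) \<Rightarrow> (nat \<Rightarrow> 'a mat) \<Rightarrow> (nat \<Rightarrow> 'a) \<Rightarrow> bool"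
  where
  "first_split_sequence d A As E Es \<phi> \<longleftrightarrow>
     (\<exists>\<theta> \<theta>s. eigenvalue_sequence d A E \<theta> \<and> eigenvalue_sequence d As Es \<theta>s \<and>
        (\<forall>i\<in>{1..d}.
           (\<exists>u\<in>split_space d E Es i. u \<noteq> 0\<^sub>v (d + 1)) \<and>
           (\<forall>u\<in>split_space d E Es i.
              ((A - \<theta> (i - 1) \<cdot>\<^sub>m 1\<^sub>m (d + 1)) * (As - \<theta>s i \<cdot>\<^sub>m 1\<^sub>m (d + 1))) *\<^sub>v u = \<phi> i \<cdot>\<^sub>v u)))"

definition second_split_sequence ::
    "nat \<Rightarrow> 'a::field mat \<Rightarrow> 'a mat \<Rightarrow> (nat \<Rightarrow> 'a mat) \<Rightarrow> (nat \<Rightarrow> 'a mat) \<Rightarrow> (nat \<Rightarrow> 'a) \<Rightarrow> bool"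
  where
  "second_split_sequence d A As E Es \<psi> \<longleftrightarrow>
     first_split_sequence d A As (\<lambda>i. E (d - i)) Es \<psi>"


section \<open>Parameter arrays\<close>

text \<open>
  \<open>\<phi>\<close> and \<open>\<psi>\<close> play the roles of the first and the second split sequence, customarily
  written with the two variants of the letter phi.
\<close>

definition parameter_array ::
    "nat \<Rightarrow> (nat \<Rightarrow> 'a::field) \<Rightarrow> (nat \<Rightarrow> 'a) \<Rightarrow> (nat \<Rightarrow> 'a) \<Rightarrow> (nat \<Rightarrow> 'a) \<Rightarrow> bool" where
  "parameter_array d \<theta> \<theta>s \<phi> \<psi> \<longleftrightarrow>
     (\<forall>i\<in>{1..d}. \<phi> i \<noteq> 0 \<and> \<psi> i \<noteq> 0) \<and>
     (\<forall>i\<le>d. \<forall>j\<le>d. i \<noteq> j \<longrightarrow> \<theta> i \<noteq> \<theta> j \<and> \<theta>s i \<noteq> \<theta>s j) \<and>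
     (\<forall>i\<in>{1..d}. \<phi> i = \<psi> 1 * (\<Sum>h = 0..i - 1. (\<theta> h - \<theta> (d - h)) / (\<theta> 0 - \<theta> d))
                        + (\<theta>s i - \<theta>s 0) * (\<theta> (i - 1) - \<theta> d)) \<and>
     (\<forall>i\<in>{1..d}. \<psi> i = \<phi> 1 * (\<Sum>h = 0..i - 1. (\<theta> h - \<theta> (d - h)) / (\<theta> 0 - \<theta> d))
                        + (\<theta>s i - \<theta>s 0) * (\<theta> (d - i + 1) - \<theta> 0)) \<and>
     (\<exists>c. \<forall>i\<in>{2..d - 1}.
        (\<theta> (i - 2) - \<theta> (i + 1)) / (\<theta> (i - 1) - \<theta> i) = c \<and>
        (\<theta>s (i - 2) - \<theta>s (i + 1)) / (\<theta>s (i - 1) - \<theta>s i) = c)"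

definition parameter_array_of ::
    "nat \<Rightarrow> 'a::field mat \<Rightarrow> 'a mat \<Rightarrow> (nat \<Rightarrow> 'a mat) \<Rightarrow> (nat \<Rightarrow> 'a mat) \<Rightarrow>
     (nat \<Rightarrow> 'a) \<Rightarrow> (nat \<Rightarrow> 'a) \<Rightarrow> (nat \<Rightarrow> 'a) \<Rightarrow> (nat \<Rightarrow> 'a) \<Rightarrow> bool" where
  "parameter_array_of d A As E Es \<theta> \<theta>s \<phi> \<psi> \<longleftrightarrow>
     eigenvalue_sequence d A E \<theta> \<and> eigenvalue_sequence d As Es \<theta>s \<and>
     first_split_sequence d A As E Es \<phi> \<and> second_split_sequence d A As E Es \<psi>"

text \<open>
  The eigenvalue sequences determine \<open>E i\<close> and \<open>Es i\<close> for \<open>i \<le> d\<close>, so at most one Leonard system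
  is designated for a given pair.
\<close>

definition designated_Leonard_system ::
    "nat \<Rightarrow> 'a::field mat \<Rightarrow> 'a mat \<Rightarrow> (nat \<Rightarrow> 'a mat) \<Rightarrow> (nat \<Rightarrow> 'a mat) \<Rightarrow> bool" where
  "designated_Leonard_system d A As E Es \<longleftrightarrow>
     Leonard_system d A As E Es \<and>
     eigenvalue_sequence d A E (\<lambda>i. A $$ (i, i)) \<and>
     eigenvalue_sequence d As Es (\<lambda>i. As $$ (i, i))"

definition designated_parameter_array ::
    "nat \<Rightarrow> 'a::field mat \<Rightarrow> 'a mat \<Rightarrow>
     (nat \<Rightarrow> 'a) \<Rightarrow> (nat \<Rightarrow> 'a) \<Rightarrow> (nat \<Rightarrow> 'a) \<Rightarrow> (nat \<Rightarrow> 'a) \<Rightarrow> bool" where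
  "designated_parameter_array d A As \<theta> \<theta>s \<phi> \<psi> \<longleftrightarrow>
     (\<exists>E Es. designated_Leonard_system d A As E Es \<and>
             parameter_array_of d A As E Es \<theta> \<theta>s \<phi> \<psi>)"

definition matches_entries ::
    "nat \<Rightarrow> 'a::field mat \<Rightarrow> 'a mat \<Rightarrow> (nat \<Rightarrow> 'a) \<Rightarrow> (nat \<Rightarrow> 'a) \<Rightarrow> (nat \<Rightarrow> 'a) \<Rightarrow> bool" where
  "matches_entries d A As \<theta> \<theta>s \<phi> \<longleftrightarrow>
     (\<forall>i\<le>d. A $$ (i, i) = \<theta> i \<and> As $$ (i, i) = \<theta>s i) \<and>
     (\<forall>i\<in>{1..d}. A $$ (i, i - 1) * As $$ (i - 1, i) = \<phi> i)"

end

theory Submission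
  imports Defs
begin

text \<open>
  In an eigenbasis of \<open>A\<close>, vectors are functions on the points \<open>\<theta>\<^sub>0, \<dots>, \<theta>\<^sub>d\<close>, that is, polynomials of
  degree at most \<open>d\<close>; \<open>A\<close> is multiplication by the variable, the standard basis consists of multiples
  of the Newton polynomials \<open>\<tau>\<^sub>n = (x - \<theta>\<^sub>0) \<cdots> (x - \<theta>\<^sub>n\<^sub>-\<^sub>1)\<close>, and \<open>A\<^sup>*\<close> is an operator \<open>T\<close> with
  \<open>T \<tau>\<^sub>n = \<theta>\<^sup>*\<^sub>n \<tau>\<^sub>n + \<phi>\<^sub>n \<tau>\<^sub>n\<^sub>-\<^sub>1\<close>.  The pair is a Leonard pair iff \<open>T\<close> is irreducible tridiagonal on the
  points; the dual condition is then automatic, as \<open>T\<close> is self-adjoint for a diagonal bilinear form.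

  If \<open>T\<close> is tridiagonal, choose a polynomial \<open>f\<close> with
  \<open>f(\<theta>\<^sub>i) - f(\<theta>\<^sub>i\<^sub>+\<^sub>1) = \<theta>\<^sub>i \<theta>\<^sub>i\<^sub>+\<^sub>1 (\<theta>\<^sub>i\<^sub>+\<^sub>1 - \<theta>\<^sub>i)\<close>.  Then \<open>x T x\<^sup>2 - x\<^sup>2 T x = f T - T f\<close>; comparing degrees,
  \<open>f\<close> is at most cubic, and comparing leading coefficients gives the recurrence (5).  Given (5), the
  tridiagonal relation amounts to a four-term recurrence for \<open>\<phi>\<close>, which the right-hand side of (3)
  satisfies.  At \<open>i = 1\<close>, (3) relates \<open>\<psi>\<^sub>1\<close> to \<open>\<phi>\<^sub>1\<close>, and at \<open>i = 2\<close> it is equivalent to the vanishing of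
  the entry of \<open>T\<close> in position \<open>(d, 0)\<close>, the only one below the band that the tridiagonal relation does
  not control.  Hence (3) and (5) characterise tridiagonality, and (4) is (3) for the reversed points.
\<close>

section \<open>Operators on polynomial functions\<close>

text \<open>The polynomial \<open>f\<close> exists because passing from T to x T x^2 - x^2 T x
  multiplies the entry (i, j) by \<theta>_i \<theta>_j (\<theta>_j - \<theta>_i). This factor is
  antisymmetric, and on the edges of a path every antisymmetric function is a difference of values
  of a potential.

  Two obstacles shape the rest. A Leonard pair supplies its idempotents in some order, whereas a
  split basis presupposes the order of the diagonal entries. The bidiagonal shape makes the matrix
  of \<open>As\<close> in an eigenbasis of \<open>A\<close> Hessenberg for the diagonal order, which
  leaves only that order and its reverse. In the converse direction, the tridiagonal relation on the
  n-th Newton polynomial refers to \<theta> at n + 2 and \<theta>s at n + 3, hence to indices beyond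
  d. Both sequences are therefore prolonged by their own recurrence, and the boundary terms
  disappear because Newton polynomials of degree above d vanish at all points.\<close>

definition newton_poly :: "(nat \<Rightarrow> 'a::field) \<Rightarrow> nat \<Rightarrow> 'a poly" where
  "newton_poly \<theta> n = (\<Prod>h<n. [:- \<theta> h, 1:])"

lemma newton_poly_0 [simp]: "newton_poly \<theta> 0 = 1"
  by (simp add: newton_poly_def)

lemma newton_poly_Suc: "newton_poly \<theta> (Suc n) = newton_poly \<theta> n * [:- \<theta> n, 1:]"
  by (simp add: newton_poly_def)

lemma poly_newton_poly_Suc [simp]:
  "poly (newton_poly \<theta> (Suc n)) x = (x - \<theta> n) * poly (newton_poly \<theta> n) x"
  by (simp add: newton_poly_Suc algebra_simps)

lemma monic_newton_poly: "degree (newton_poly \<theta> n) = n \<and> coeff (newton_poly \<theta> n) n = 1"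
proof (induction n)
  case (Suc n)
  have nz: "newton_poly \<theta> n \<noteq> 0" using Suc by auto
  have "degree (newton_poly \<theta> (Suc n)) = Suc n"
    unfolding newton_poly_Suc using nz Suc by (subst degree_mult_eq) auto
  moreover have "lead_coeff (newton_poly \<theta> (Suc n)) = 1"
    unfolding newton_poly_Suc lead_coeff_mult using Suc by simp
  ultimately show ?case by simp
qed simp

lemma degree_newton_poly [simp]: "degree (newton_poly \<theta> n) = n"
  and coeff_newton_poly [simp]: "coeff (newton_poly \<theta> n) n = 1"
  using monic_newton_poly by blast+

lemma newton_poly_cong: "(\<And>h. h < n \<Longrightarrow> \<theta> h = \<theta>' h) \<Longrightarrow> newton_poly \<theta> n = newton_poly \<theta>' n"
  by (simp add: newton_poly_def)

lemma poly_newton_poly: "poly (newton_poly \<theta> n) x = (\<Prod>h<n. x - \<theta> h)"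
  by (simp add: newton_poly_def poly_prod)

lemma newton_poly_root [simp]: "i < n \<Longrightarrow> poly (newton_poly \<theta> n) (\<theta> i) = 0"
  by (auto simp: poly_newton_poly)

lemma newton_poly_nonroot:
  assumes "inj_on \<theta> {..d}" "n \<le> i" "i \<le> d"
  shows "poly (newton_poly \<theta> n) (\<theta> i) \<noteq> 0"
proof -
  have "\<theta> i \<noteq> \<theta> h" if "h < n" for h using assms that by (auto dest: inj_onD)
  then show ?thesis by (simp add: poly_newton_poly)
qed

lemma poly_eq_on_points:
  fixes p q :: "'a::field poly"
  assumes "inj_on \<theta> I" "finite I" "degree p < card I" "degree q < card I"
    and eq: "\<And>i. i \<in> I \<Longrightarrow> poly p (\<theta> i) = poly q (\<theta> i)"
  shows "p = q"
proof (rule ccontr)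
  assume "p \<noteq> q"
  then have nz: "p - q \<noteq> 0" by simp
  have "\<theta> ` I \<subseteq> {x. poly (p - q) x = 0}" using eq by auto
  then have "card (\<theta> ` I) \<le> card {x. poly (p - q) x = 0}"
    using poly_roots_finite[OF nz] card_mono by blast
  also have "\<dots> \<le> degree (p - q)" using nz by (rule card_poly_roots_bound)
  also have "\<dots> < card I" using assms(3,4) by (rule degree_diff_less)
  finally show False using assms(1) by (simp add: card_image)
qed

lemma newton_interpolation:
  fixes f :: "nat \<Rightarrow> 'a::field"
  assumes "inj_on \<theta> {..d}"
  shows "n \<le> d \<Longrightarrow> \<exists>p. degree p \<le> n \<and> (\<forall>i\<le>n. poly p (\<theta> i) = f i)"
proof (induction n)
  case 0
  show ?case by (rule exI[of _ "[:f 0:]"]) simp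
next
  case (Suc n)
  then obtain p where p: "degree p \<le> n" "\<forall>i\<le>n. poly p (\<theta> i) = f i" by auto
  define c where "c = (f (Suc n) - poly p (\<theta> (Suc n))) / poly (newton_poly \<theta> (Suc n)) (\<theta> (Suc n))"
  let ?q = "p + Polynomial.smult c (newton_poly \<theta> (Suc n))"
  have "poly (newton_poly \<theta> (Suc n)) (\<theta> (Suc n)) \<noteq> 0"
    using newton_poly_nonroot[OF assms] Suc.prems by blast
  then have "poly ?q (\<theta> (Suc n)) = f (Suc n)" by (simp add: c_def del: poly_newton_poly_Suc)
  moreover have "poly ?q (\<theta> i) = f i" if "i \<le> n" for i
    using that p(2) newton_poly_root[of i "Suc n" \<theta>] by (simp del: poly_newton_poly_Suc)
  moreover have "degree ?q \<le> Suc n"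
    using p(1) by (intro degree_add_le) (auto simp: degree_smult_le)
  ultimately show ?case by (intro exI[of _ ?q]) (auto simp: le_Suc_eq)
qed

lemma coeff_mult_top:
  fixes p q :: "'a::comm_semiring_1 poly"
  assumes "degree p \<le> m" "degree q \<le> n"
  shows "coeff (p * q) (m + n) = coeff p m * coeff q n"
proof -
  have "coeff p i * coeff q (m + n - i) = (if i = m then coeff p m * coeff q n else 0)"
    if "i \<le> m + n" for i
  proof (cases i m rule: linorder_cases)
    case less
    then have "coeff q (m + n - i) = 0" using assms(2) by (intro coeff_eq_0) auto
    with less show ?thesis by simp
  next
    case greater
    then have "coeff p i = 0" using assms(1) by (intro coeff_eq_0) auto
    with greater show ?thesis by simp
  qed simp
  then show ?thesis by (simp add: coeff_mult)
qed

definition act :: "nat \<Rightarrow> (nat \<Rightarrow> 'a::field) \<Rightarrow> (nat \<Rightarrow> nat \<Rightarrow> 'a) \<Rightarrow> 'a poly \<Rightarrow> nat \<Rightarrow> 'a" where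
  "act d \<theta> t p i = (\<Sum>j\<le>d. t i j * poly p (\<theta> j))"

lemma act_add: "act d \<theta> t (p + q) i = act d \<theta> t p i + act d \<theta> t q i"
  by (simp add: act_def algebra_simps sum.distrib)

lemma act_smult: "act d \<theta> t (Polynomial.smult c p) i = c * act d \<theta> t p i"
  by (simp add: act_def algebra_simps sum_distrib_left)

text \<open>
  In the basis of Newton polynomials, \<open>t\<close> has the shape of \<open>A\<^sup>*\<close> in a split basis; its rows and
  columns are indexed by the eigenvectors of \<open>A\<close>.
\<close>

definition split_action ::
    "nat \<Rightarrow> (nat \<Rightarrow> 'a::field) \<Rightarrow> (nat \<Rightarrow> 'a) \<Rightarrow> (nat \<Rightarrow> 'a) \<Rightarrow> (nat \<Rightarrow> nat \<Rightarrow> 'a) \<Rightarrow> bool" where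
  "split_action d \<theta> \<theta>s \<phi> t \<longleftrightarrow> \<phi> 0 = 0 \<and>
     (\<forall>n\<le>d. \<forall>i\<le>d. act d \<theta> t (newton_poly \<theta> n) i =
        \<theta>s n * poly (newton_poly \<theta> n) (\<theta> i) + \<phi> n * poly (newton_poly \<theta> (n - 1)) (\<theta> i))"

definition band :: "nat \<Rightarrow> (nat \<Rightarrow> nat \<Rightarrow> 'a::zero) \<Rightarrow> bool" where
  "band d t \<longleftrightarrow> (\<forall>i\<le>d. \<forall>j\<le>d. (i + 1 < j \<or> j + 1 < i) \<longrightarrow> t i j = 0)"

lemma degree_diff_top:
  fixes p :: "'a::field poly"
  assumes "degree p \<le> Suc n" "degree q = Suc n" "coeff q (Suc n) = 1"
  shows "degree (p - Polynomial.smult (coeff p (Suc n)) q) \<le> n"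
proof (rule degree_le, intro allI impI)
  fix i assume "n < i"
  show "coeff (p - Polynomial.smult (coeff p (Suc n)) q) i = 0"
  proof (cases "i = Suc n")
    case False
    with \<open>n < i\<close> have "coeff p i = 0" "coeff q i = 0" using assms by (auto intro!: coeff_eq_0)
    then show ?thesis by simp
  qed (simp add: assms)
qed

text \<open>Each Newton polynomial goes to a multiple of itself plus a multiple of its predecessor,
  so the filtration by degree is preserved and its n-th graded piece is scaled by
  \<open>\<theta>s n\<close>. Statements on entries of \<open>t\<close> thus become comparisons of
  degrees and leading coefficients.\<close>

lemma split_action_degree:
  assumes "split_action d \<theta> \<theta>s \<phi> t"
  shows "n \<le> d \<Longrightarrow> degree p \<le> n \<Longrightarrow>
    \<exists>q. degree q \<le> n \<and> coeff q n = \<theta>s n * coeff p n \<and> (\<forall>i\<le>d. act d \<theta> t p i = poly q (\<theta> i))"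
proof (induction n arbitrary: p)
  case 0
  then obtain c where c: "p = [:c:]" using degree_eq_zeroE by blast
  have p: "p = Polynomial.smult c (newton_poly \<theta> 0)" using c by simp
  show ?case
  proof (rule exI[of _ "[:\<theta>s 0 * c:]"], intro conjI allI impI)
    fix i assume "i \<le> d"
    then show "act d \<theta> t p i = poly [:\<theta>s 0 * c:] (\<theta> i)"
      unfolding p act_smult using assms unfolding split_action_def by fastforce
  qed (auto simp: c)
next
  case (Suc n)
  let ?c = "coeff p (Suc n)" and ?g = "newton_poly \<theta> (Suc n)"
  define p' where "p' = p - Polynomial.smult ?c ?g"
  have "degree p' \<le> n" unfolding p'_def using Suc.prems by (intro degree_diff_top) auto
  with Suc obtain q where q: "degree q \<le> n" "\<forall>i\<le>d. act d \<theta> t p' i = poly q (\<theta> i)"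
    using Suc_leD by blast
  let ?q = "Polynomial.smult ?c (Polynomial.smult (\<theta>s (Suc n)) ?g + Polynomial.smult (\<phi> (Suc n)) (newton_poly \<theta> n)) + q"
  have 1: "act d \<theta> t p i = poly ?q (\<theta> i)" if "i \<le> d" for i
  proof -
    have "act d \<theta> t p i = ?c * act d \<theta> t ?g i + act d \<theta> t p' i"
      unfolding act_smult[symmetric] act_add[symmetric] by (simp add: p'_def)
    moreover have "act d \<theta> t ?g i = \<theta>s (Suc n) * poly ?g (\<theta> i) + \<phi> (Suc n) * poly (newton_poly \<theta> n) (\<theta> i)"
      using assms Suc.prems(1) that unfolding split_action_def by force
    ultimately show ?thesis using q(2) that by simp
  qed
  have 2: "coeff ?q (Suc n) = \<theta>s (Suc n) * ?c"
    using q(1) by (simp add: coeff_eq_0)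
  have 3: "degree ?q \<le> Suc n"
    using q(1) by (intro degree_add_le order.trans[OF degree_smult_le]) auto
  from 1 2 3 show ?case by blast
qed

section \<open>Consequences of tridiagonality\<close>

text \<open>With c the coefficient of x^3 in \<open>f\<close>, the commutation identity applied to
  x^n gives the recurrence for \<open>\<theta>s\<close> from the coefficient of x^(n+3). The
  recurrence for \<open>\<theta>\<close> comes from \<open>f\<close> alone, through its second
  divided differences at consecutive points. Both carry the same constant -1/c.\<close>

lemma band_imp_recurrence:
  fixes \<theta> :: "nat \<Rightarrow> 'a::field"
  assumes inj: "inj_on \<theta> {..d}" and injs: "inj_on \<theta>s {..d}"
    and split: "split_action d \<theta> \<theta>s \<phi> t" and band: "band d t"
  shows "\<exists>k. \<forall>n. n + 3 \<le> d \<longrightarrow> \<theta> n - \<theta> (n + 3) = k * (\<theta> (n + 1) - \<theta> (n + 2)) \<and>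
                          \<theta>s n - \<theta>s (n + 3) = k * (\<theta>s (n + 1) - \<theta>s (n + 2))"
proof (cases "d \<ge> 3")
  case False
  then show ?thesis by auto
next
  case d: True
  \<comment> \<open>A potential along the path of indices: its increments are chosen so that
    \<theta>_i \<theta>_j^2 - \<theta>_i^2 \<theta>_j = F_i - F_j for adjacent i and j.\<close>
  define F where "F i = - (\<Sum>h<i. \<theta> h * \<theta> (Suc h) * (\<theta> (Suc h) - \<theta> h))" for i
  have F: "F i - F (Suc i) = \<theta> i * \<theta> (Suc i) * (\<theta> (Suc i) - \<theta> i)" for i by (simp add: F_def)
  obtain f where f: "degree f \<le> d" "\<And>i. i \<le> d \<Longrightarrow> poly f (\<theta> i) = F i"
    using newton_interpolation[OF inj order.refl] by blast
  let ?T = "act d \<theta> t"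
  have comm: "\<theta> i * ?T (monom 1 2 * p) i - \<theta> i ^ 2 * ?T (monom 1 1 * p) i = F i * ?T p i - ?T (f * p) i"
    if i: "i \<le> d" for i p
  proof -
    have "t i j * (\<theta> i * \<theta> j ^ 2 - \<theta> i ^ 2 * \<theta> j) = t i j * (F i - F j)" if j: "j \<le> d" for j
    proof (cases "i + 1 < j \<or> j + 1 < i")
      case True
      then show ?thesis using band i j unfolding band_def by auto
    next
      case False
      then consider "i = j" | "j = Suc i" | "i = Suc j" by linarith
      then have "\<theta> i * \<theta> j ^ 2 - \<theta> i ^ 2 * \<theta> j = F i - F j"
        using F[of i] F[of j] by cases (auto simp: power2_eq_square algebra_simps)
      then show ?thesis by simp
    qed
    then have "(\<Sum>j\<le>d. t i j * (\<theta> i * \<theta> j ^ 2 - \<theta> i ^ 2 * \<theta> j) * poly p (\<theta> j)) =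
        (\<Sum>j\<le>d. t i j * (F i - F j) * poly p (\<theta> j))"
      by (intro sum.cong) auto
    then show ?thesis
      by (simp add: act_def poly_monom f(2) algebra_simps sum_subtractf sum_distrib_left)
  qed
  \<comment> \<open>In the identity for p = 1 the left side has degree at most 3. With m the degree
    of \<open>f\<close>, the coefficient of x^m on the right is the leading coefficient of
    \<open>f\<close> times \<open>\<theta>s 0 - \<theta>s m\<close>, which is nonzero for m > 3 by
    distinctness.\<close>
  have deg3: "degree f \<le> 3"
  proof (rule ccontr)
    assume m: "\<not> degree f \<le> 3"
    let ?m = "degree f"
    obtain q2 where q2: "degree q2 \<le> 2" "\<forall>i\<le>d. ?T (monom 1 2) i = poly q2 (\<theta> i)"
      using split_action_degree[OF split, of 2 "monom 1 2"] d by (auto simp: degree_monom_le)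
    obtain q1 where q1: "degree q1 \<le> 1" "\<forall>i\<le>d. ?T (monom 1 1) i = poly q1 (\<theta> i)"
      using split_action_degree[OF split, of 1 "monom 1 1"] d by (auto simp: degree_monom_le)
    obtain q0 where q0: "degree q0 \<le> 0" "coeff q0 0 = \<theta>s 0" "\<forall>i\<le>d. ?T 1 i = poly q0 (\<theta> i)"
      using split_action_degree[OF split, of 0 1] by auto
    obtain qf where qf: "degree qf \<le> ?m" "coeff qf ?m = \<theta>s ?m * coeff f ?m"
        "\<forall>i\<le>d. ?T f i = poly qf (\<theta> i)"
      using split_action_degree[OF split f(1), of f] by auto
    let ?L = "monom 1 1 * q2 - monom 1 2 * q1" and ?R = "f * q0 - qf"
    have degL: "degree ?L \<le> 3"
      using q1(1) q2(1) degree_mult_le[of "monom (1::'a) 1" q2] degree_mult_le[of "monom (1::'a) 2" q1]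
        degree_monom_le[of "1::'a" 1] degree_monom_le[of "1::'a" 2]
      by (intro degree_diff_le) linarith+
    have degR: "degree ?R \<le> d"
      using q0(1) qf(1) f(1) degree_mult_le[of f q0] by (intro degree_diff_le) linarith+
    have "?L = ?R"
    proof (rule poly_eq_on_points[OF inj])
      fix i assume "i \<in> {..d}"
      then have i: "i \<le> d" by simp
      show "poly ?L (\<theta> i) = poly ?R (\<theta> i)"
        using comm[OF i, of 1] i q0(3) q1(2) q2(2) qf(3) f(2)[OF i] by (simp add: poly_monom)
    qed (use degL degR d in auto)
    moreover have "coeff ?L ?m = 0" using degL m by (intro coeff_eq_0) auto
    ultimately have "coeff (f * q0) ?m - coeff qf ?m = 0" by (simp del: coeff_diff flip: coeff_diff)
    moreover have "coeff (f * q0) ?m = coeff f ?m * \<theta>s 0"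
      using coeff_mult_top[of f ?m q0 0] q0 by simp
    ultimately have "coeff f ?m * (\<theta>s 0 - \<theta>s ?m) = 0" using qf(2) by (simp add: algebra_simps)
    moreover have "\<theta>s 0 \<noteq> \<theta>s ?m" using injs f(1) m unfolding inj_on_def by fastforce
    moreover have "coeff f ?m \<noteq> 0" using m by auto
    ultimately show False by auto
  qed
  define c where "c = coeff f 3"
  have s: "\<theta>s (n + 2) - \<theta>s (n + 1) = c * (\<theta>s n - \<theta>s (n + 3))" if n: "n + 3 \<le> d" for n
  proof -
    have T: "\<exists>q. degree q \<le> n + m \<and> coeff q (n + m) = \<theta>s (n + m) * coeff p m \<and>
        (\<forall>i\<le>d. ?T (p * monom 1 n) i = poly q (\<theta> i))" if "degree p \<le> m" "m \<le> 3" for p m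
    proof -
      have "degree (p * monom 1 n) \<le> n + m"
        using degree_mult_le[of p "monom 1 n"] that(1) degree_monom_le[of "1::'a" n] by linarith
      moreover have "coeff (p * monom 1 n) (n + m) = coeff p m"
        using coeff_mult_top[OF that(1) degree_monom_le[of "1::'a" n]] by (simp add: add.commute)
      ultimately show ?thesis
        using split_action_degree[OF split, of "n + m" "p * monom 1 n"] that n by auto
    qed
    obtain q2 where q2: "degree q2 \<le> n + 2" "coeff q2 (n + 2) = \<theta>s (n + 2)"
        "\<forall>i\<le>d. ?T (monom 1 2 * monom 1 n) i = poly q2 (\<theta> i)"
      using T[of "monom 1 2" 2] by (auto simp: degree_monom_le)
    obtain q1 where q1: "degree q1 \<le> n + 1" "coeff q1 (n + 1) = \<theta>s (n + 1)"
        "\<forall>i\<le>d. ?T (monom 1 1 * monom 1 n) i = poly q1 (\<theta> i)"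
      using T[of "monom 1 1" 1] by (auto simp: degree_monom_le)
    obtain q0 where q0: "degree q0 \<le> n" "coeff q0 n = \<theta>s n"
        "\<forall>i\<le>d. ?T (1 * monom 1 n) i = poly q0 (\<theta> i)"
      using T[of 1 0] by auto
    obtain qf where qf: "degree qf \<le> n + 3" "coeff qf (n + 3) = \<theta>s (n + 3) * c"
        "\<forall>i\<le>d. ?T (f * monom 1 n) i = poly qf (\<theta> i)"
      using T[of f 3] deg3 by (auto simp: c_def)
    let ?L = "monom 1 1 * q2 - monom 1 2 * q1" and ?R = "f * q0 - qf"
    have degL: "degree ?L \<le> n + 3"
      using q1(1) q2(1) degree_mult_le[of "monom (1::'a) 1" q2] degree_mult_le[of "monom (1::'a) 2" q1]
        degree_monom_le[of "1::'a" 1] degree_monom_le[of "1::'a" 2]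
      by (intro degree_diff_le) linarith+
    have degR: "degree ?R \<le> n + 3"
      using q0(1) qf(1) deg3 degree_mult_le[of f q0] by (intro degree_diff_le) linarith+
    have "?L = ?R"
    proof (rule poly_eq_on_points[OF inj])
      fix i assume "i \<in> {..d}"
      then have i: "i \<le> d" by simp
      show "poly ?L (\<theta> i) = poly ?R (\<theta> i)"
        using comm[OF i, of "monom 1 n"] i q0(3) q1(3) q2(3) qf(3) f(2)[OF i]
        by (simp add: poly_monom)
    qed (use degL degR n in auto)
    then have "coeff ?L (n + 3) = coeff ?R (n + 3)" by simp
    moreover have "coeff (f * q0) (n + 3) = c * \<theta>s n"
      using coeff_mult_top[OF deg3 q0(1)] q0(2) by (simp add: c_def add.commute)
    moreover have "coeff (monom 1 1 * q2) (n + 3) = \<theta>s (n + 2)"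
      using coeff_mult_top[OF degree_monom_le[of "1::'a" 1] q2(1)] q2(2) by (simp add: eval_nat_numeral)
    moreover have "coeff (monom 1 2 * q1) (n + 3) = \<theta>s (n + 1)"
      using coeff_mult_top[OF degree_monom_le[of "1::'a" 2] q1(1)] q1(2) by (simp add: eval_nat_numeral)
    ultimately show ?thesis using qf(2) by (simp add: algebra_simps)
  qed
  have ne: "\<theta> i \<noteq> \<theta> j" "\<theta>s i \<noteq> \<theta>s j" if "i \<le> d" "j \<le> d" "i \<noteq> j" for i j
    using inj injs that unfolding inj_on_def by auto
  have c0: "c \<noteq> 0" using s[of 0] d ne(2)[of 2 1] by (auto simp: eval_nat_numeral)
  obtain c0 c1 c2 where fx: "\<And>x. poly f x = c0 + c1 * x + c2 * x ^ 2 + c * x ^ 3"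
  proof -
    have "poly f x = (\<Sum>i\<le>3. coeff f i * x ^ i)" for x
      unfolding poly_altdef using deg3 by (intro sum.mono_neutral_left) (auto simp: coeff_eq_0)
    then show ?thesis using that[of "coeff f 0" "coeff f 1" "coeff f 2"]
      by (simp add: c_def eval_nat_numeral)
  qed
  have 1: "- (\<theta> n * \<theta> (Suc n)) = c * (\<theta> n ^ 2 + \<theta> n * \<theta> (Suc n) + \<theta> (Suc n) ^ 2) + c2 * (\<theta> n + \<theta> (Suc n)) + c1"
    if "Suc n \<le> d" for n
  proof -
    have "\<theta> n - \<theta> (Suc n) \<noteq> 0" using ne(1)[of n "Suc n"] that by auto
    moreover have "(\<theta> n - \<theta> (Suc n)) * (- (\<theta> n * \<theta> (Suc n))) = (\<theta> n - \<theta> (Suc n)) *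
       (c * (\<theta> n ^ 2 + \<theta> n * \<theta> (Suc n) + \<theta> (Suc n) ^ 2) + c2 * (\<theta> n + \<theta> (Suc n)) + c1)"
    proof -
      have "(\<theta> n - \<theta> (Suc n)) * (- (\<theta> n * \<theta> (Suc n))) = F n - F (Suc n)"
        unfolding F by (simp add: algebra_simps)
      also have "\<dots> = poly f (\<theta> n) - poly f (\<theta> (Suc n))" using f(2) that by simp
      finally show ?thesis unfolding fx by (simp add: algebra_simps eval_nat_numeral)
    qed
    ultimately show ?thesis using mult_left_cancel by blast
  qed
  have 2: "- \<theta> (Suc n) = c * (\<theta> n + \<theta> (Suc n) + \<theta> (Suc (Suc n))) + c2" if "Suc (Suc n) \<le> d" for n
  proof -
    have "\<theta> n - \<theta> (Suc (Suc n)) \<noteq> 0" using ne(1)[of n "Suc (Suc n)"] that by auto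
    moreover have "(\<theta> n - \<theta> (Suc (Suc n))) * (- \<theta> (Suc n)) =
       (\<theta> n - \<theta> (Suc (Suc n))) * (c * (\<theta> n + \<theta> (Suc n) + \<theta> (Suc (Suc n))) + c2)"
    proof -
      have "(\<theta> n - \<theta> (Suc (Suc n))) * (- \<theta> (Suc n)) =
          - (\<theta> n * \<theta> (Suc n)) - (- (\<theta> (Suc n) * \<theta> (Suc (Suc n))))"
        by (simp add: algebra_simps)
      also have "\<dots> = (c * (\<theta> n ^ 2 + \<theta> n * \<theta> (Suc n) + \<theta> (Suc n) ^ 2) + c2 * (\<theta> n + \<theta> (Suc n)) + c1) -
          (c * (\<theta> (Suc n) ^ 2 + \<theta> (Suc n) * \<theta> (Suc (Suc n)) + \<theta> (Suc (Suc n)) ^ 2) +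
            c2 * (\<theta> (Suc n) + \<theta> (Suc (Suc n))) + c1)"
        using 1[of n] 1[of "Suc n"] that by simp
      finally show ?thesis by (simp add: algebra_simps power2_eq_square)
    qed
    ultimately show ?thesis using mult_left_cancel by blast
  qed
  show ?thesis
  proof (rule exI[of _ "- (1 / c)"], intro allI impI conjI)
    fix n assume n: "n + 3 \<le> d"
    have "c * (\<theta> n - \<theta> (n + 3)) = - (\<theta> (n + 1) - \<theta> (n + 2))"
    proof -
      have "- (\<theta> (Suc n) - \<theta> (Suc (Suc n))) = - \<theta> (Suc n) - (- \<theta> (Suc (Suc n)))" by simp
      also have "\<dots> = (c * (\<theta> n + \<theta> (Suc n) + \<theta> (Suc (Suc n))) + c2) -
          (c * (\<theta> (Suc n) + \<theta> (Suc (Suc n)) + \<theta> (Suc (Suc (Suc n)))) + c2)"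
        using 2[of n] 2[of "Suc n"] n by simp
      finally show ?thesis by (simp add: algebra_simps eval_nat_numeral)
    qed
    then show "\<theta> n - \<theta> (n + 3) = - (1 / c) * (\<theta> (n + 1) - \<theta> (n + 2))"
      using c0 by (simp add: field_simps)
    have "c * (\<theta>s n - \<theta>s (n + 3)) = - (\<theta>s (n + 1) - \<theta>s (n + 2))" using s[OF n] by simp
    then show "\<theta>s n - \<theta>s (n + 3) = - (1 / c) * (\<theta>s (n + 1) - \<theta>s (n + 2))"
      using c0 by (simp add: field_simps)
  qed
qed

section \<open>The tridiagonal relation\<close>

text \<open>In an eigenbasis of A, the entry (i, j) of the commutator of A with A^2 As - \<beta> A
  As A + As A^2 - \<gamma> (A As + As A) - \<rho> As is \<open>t i j\<close> times this value at
  \<open>\<theta> i\<close>, \<open>\<theta> j\<close>: left factors A become x, right ones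
  y.\<close>

definition td :: "'a::field \<Rightarrow> 'a \<Rightarrow> 'a \<Rightarrow> 'a \<Rightarrow> 'a \<Rightarrow> 'a" where
  "td \<beta> \<gamma> \<rho> x y = (x - y) * (x ^ 2 - \<beta> * x * y + y ^ 2 - \<gamma> * (x + y) - \<rho>)"

text \<open>The powers of y are regrouped into products of \<open>y - q\<close>,
  \<open>y - r\<close> and \<open>y - w\<close>. For consecutive points q, r, w these products turn
  the n-th Newton polynomial into the next three, so that every term becomes \<open>t\<close> acting
  on a Newton polynomial. The number \<open>\<gamma> + \<beta> * q - r\<close> is where the
  recurrence puts the predecessor of q.\<close>

lemma td_expand:
  assumes w: "w = \<gamma> + \<beta> * r - q" and rho: "\<rho> = q ^ 2 - \<beta> * q * r + r ^ 2 - \<gamma> * (q + r)"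
  shows "td \<beta> \<gamma> \<rho> x y =
    (x - q) * (x - r) * (x - (\<gamma> + \<beta> * q - r)) - (\<beta> + 1) * (x - q) * (x - r) * (y - q) +
    (\<beta> + 1) * (x - r) * (y - q) * (y - r) - (y - q) * (y - r) * (y - w)"
  unfolding td_def w rho by (simp add: algebra_simps power2_eq_square)

text \<open>Once \<open>\<theta>\<close> and \<open>\<theta>s\<close> satisfy their recurrences, the
  relation sends the n-th split basis vector to a multiple of the (n+2)-nd, and this is the
  multiple. Its vanishing is an inhomogeneous four-term recurrence for
  \<open>\<phi>\<close>.\<close>

definition td_coeff ::
    "'a::field \<Rightarrow> (nat \<Rightarrow> 'a) \<Rightarrow> (nat \<Rightarrow> 'a) \<Rightarrow> (nat \<Rightarrow> 'a) \<Rightarrow> nat \<Rightarrow> 'a" where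
  "td_coeff \<beta> \<theta> \<theta>s \<phi> n = \<phi> n - \<phi> (n + 3) - (\<beta> + 1) * (\<phi> (n + 1) - \<phi> (n + 2)) +
     (\<beta> + 1) * (\<theta>s n * (\<theta> (n + 1) - \<theta> n) - \<theta>s (n + 1) * (\<theta> (n + 2) - \<theta> n) +
                \<theta>s (n + 2) * (\<theta> (n + 2) - \<theta> (n + 1)))"

text \<open>
  The left-hand side is the effect of
  \<open>A\<^sup>3A\<^sup>* - (\<beta>+1)A\<^sup>2A\<^sup>*A + (\<beta>+1)AA\<^sup>*A\<^sup>2 - A\<^sup>*A\<^sup>3 - \<gamma>(A\<^sup>2A\<^sup>* - A\<^sup>*A\<^sup>2) - \<rho>(AA\<^sup>* - A\<^sup>*A)\<close>
  on the \<open>n\<close>-th split basis vector.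
\<close>

lemma td_newton:
  fixes \<theta> :: "nat \<Rightarrow> 'a::field"
  assumes act: "\<And>m. m \<in> {n..n + 3} \<Longrightarrow> act d \<theta> t (newton_poly \<theta> m) i =
        \<theta>s m * poly (newton_poly \<theta> m) (\<theta> i) + \<phi> m * poly (newton_poly \<theta> (m - 1)) (\<theta> i)"
    and phi0: "\<phi> 0 = 0"
    and rec1: "\<theta> (n + 2) = \<gamma> + \<beta> * \<theta> (n + 1) - \<theta> n"
    and rec0: "n > 0 \<Longrightarrow> \<theta> (n + 1) = \<gamma> + \<beta> * \<theta> n - \<theta> (n - 1)"
    and rho: "\<rho> = \<theta> n ^ 2 - \<beta> * \<theta> n * \<theta> (n + 1) + \<theta> (n + 1) ^ 2 - \<gamma> * (\<theta> n + \<theta> (n + 1))"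
    and recs: "\<theta>s n - \<theta>s (n + 3) = (\<beta> + 1) * (\<theta>s (n + 1) - \<theta>s (n + 2))"
  shows "(\<Sum>j\<le>d. t i j * td \<beta> \<gamma> \<rho> (\<theta> i) (\<theta> j) * poly (newton_poly \<theta> n) (\<theta> j)) =
     td_coeff \<beta> \<theta> \<theta>s \<phi> n * poly (newton_poly \<theta> (n + 2)) (\<theta> i)"
proof -
  define x q r w where xqrw: "x = \<theta> i" "q = \<theta> n" "r = \<theta> (n + 1)" "w = \<theta> (n + 2)"
  define G where "G m = poly (newton_poly \<theta> m)" for m
  have GS: "G (Suc m) y = (y - \<theta> m) * G m y" for m y by (simp add: G_def)
  have G1: "G (n + 1) y = (y - q) * G n y" for y by (simp add: GS xqrw)
  have G2: "G (n + 2) y = (y - r) * ((y - q) * G n y)" for y by (simp add: GS xqrw)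
  have G3: "G (n + 3) y = (y - w) * ((y - r) * ((y - q) * G n y))" for y
    by (simp add: GS xqrw eval_nat_numeral)
  let ?p = "\<gamma> + \<beta> * q - r"
  have td: "td \<beta> \<gamma> \<rho> x y = (x - q) * (x - r) * (x - ?p) - (\<beta> + 1) * (x - q) * (x - r) * (y - q) +
    (\<beta> + 1) * (x - r) * (y - q) * (y - r) - (y - q) * (y - r) * (y - w)" for y
    using rec1 rho unfolding xqrw by (rule td_expand)
  define T where "T m = (\<Sum>j\<le>d. t i j * G m (\<theta> j))" for m
  have T: "T m = \<theta>s m * G m x + \<phi> m * G (m - 1) x" if "m \<in> {n..n + 3}" for m
    using act[OF that] by (simp add: T_def G_def act_def xqrw)
  have "(\<Sum>j\<le>d. t i j * td \<beta> \<gamma> \<rho> x (\<theta> j) * G n (\<theta> j)) =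
     (\<Sum>j\<le>d. (x - q) * (x - r) * (x - ?p) * (t i j * G n (\<theta> j))
       - (\<beta> + 1) * (x - q) * (x - r) * (t i j * G (n + 1) (\<theta> j))
       + (\<beta> + 1) * (x - r) * (t i j * G (n + 2) (\<theta> j)) - t i j * G (n + 3) (\<theta> j))"
    unfolding td G1 G2 G3 by (intro sum.cong refl) (simp add: algebra_simps)
  also have "\<dots> = (x - q) * (x - r) * (x - ?p) * T n - (\<beta> + 1) * (x - q) * (x - r) * T (n + 1)
       + (\<beta> + 1) * (x - r) * T (n + 2) - T (n + 3)"
    unfolding T_def by (simp only: sum.distrib sum_subtractf sum_distrib_left)
  also have "\<dots> = (x - q) * (x - r) * ((x - ?p) * \<theta>s n * G n x + (x - ?p) * (\<phi> n * G (n - 1) x))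
       - (\<beta> + 1) * (x - q) * (x - r) * (\<theta>s (n + 1) * G (n + 1) x + \<phi> (n + 1) * G n x)
       + (\<beta> + 1) * (x - r) * (\<theta>s (n + 2) * G (n + 2) x + \<phi> (n + 2) * G (n + 1) x)
       - (\<theta>s (n + 3) * G (n + 3) x + \<phi> (n + 3) * G (n + 2) x)"
    by (simp add: T algebra_simps eval_nat_numeral)
  \<comment> \<open>For n > 0, \<open>?p\<close> is \<open>\<theta> (n - 1)\<close>, so the factor
    raises the predecessor back to \<open>G n\<close>. For n = 0 there is no predecessor, and
    \<open>\<phi> 0 = 0\<close> removes the term.\<close>
  also have "(x - ?p) * (\<phi> n * G (n - 1) x) = \<phi> n * G n x"
  proof (cases n)
    case (Suc m)
    then have "?p = \<theta> m" using rec0 xqrw by simp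
    then show ?thesis using Suc GS[of m x] by simp
  qed (simp add: phi0)
  also have "(x - q) * (x - r) * ((x - ?p) * \<theta>s n * G n x + \<phi> n * G n x)
       - (\<beta> + 1) * (x - q) * (x - r) * (\<theta>s (n + 1) * G (n + 1) x + \<phi> (n + 1) * G n x)
       + (\<beta> + 1) * (x - r) * (\<theta>s (n + 2) * G (n + 2) x + \<phi> (n + 2) * G (n + 1) x)
       - (\<theta>s (n + 3) * G (n + 3) x + \<phi> (n + 3) * G (n + 2) x) =
       td_coeff \<beta> \<theta> \<theta>s \<phi> n * G (n + 2) x"
  proof -
    have s3: "\<theta>s (n + 3) = \<theta>s n - (\<beta> + 1) * (\<theta>s (n + 1) - \<theta>s (n + 2))" using recs by (simp add: algebra_simps)
    have w: "w = \<gamma> + \<beta> * r - q" using rec1 xqrw by simp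
    show ?thesis
      unfolding G1 G2 G3 td_coeff_def s3 xqrw(2-4)[symmetric] unfolding w
      by (simp add: algebra_simps)
  qed
  finally show ?thesis unfolding G_def xqrw .
qed

text \<open>The right side of (3), with the range \<open>h < n\<close> in place of
  \<open>0..n - 1\<close> so that it makes sense at n = 0. It is used for all n up to d + 1: its
  zeros at both ends are the boundary values of the four-term recurrence.\<close>

definition split_value :: "nat \<Rightarrow> (nat \<Rightarrow> 'a::field) \<Rightarrow> (nat \<Rightarrow> 'a) \<Rightarrow> 'a \<Rightarrow> nat \<Rightarrow> 'a" where
  "split_value d \<theta> \<theta>s \<psi> n =
     \<psi> * (\<Sum>h<n. (\<theta> h - \<theta> (d - h)) / (\<theta> 0 - \<theta> d)) + (\<theta>s n - \<theta>s 0) * (\<theta> (n - 1) - \<theta> d)"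

lemma split_value_0 [simp]: "split_value d \<theta> \<theta>s \<psi> 0 = 0"
  by (simp add: split_value_def)

text \<open>Both terms of the numerators run through the same points, so the sum cancels, and the
  remaining factor is \<open>\<theta> d - \<theta> d\<close>. This zero stands for the missing entry
  of the split sequence at d + 1.\<close>

lemma split_value_Suc_d: "split_value d \<theta> \<theta>s \<psi> (Suc d) = 0"
proof -
  have "(\<Sum>h<Suc d. \<theta> (d - h)) = (\<Sum>h<Suc d. \<theta> h)"
    using sum.nat_diff_reindex[of \<theta> "Suc d"] by simp
  then have "(\<Sum>h<Suc d. \<theta> h - \<theta> (d - h)) = 0" by (simp only: sum_subtractf) simp
  then have "(\<Sum>h<Suc d. (\<theta> h - \<theta> (d - h)) / (\<theta> 0 - \<theta> d)) = 0"
    by (simp only: sum_divide_distrib[symmetric]) simp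
  then show ?thesis by (simp add: split_value_def del: sum.lessThan_Suc)
qed

text \<open>The partial sums solve the homogeneous recurrence: \<gamma> cancels in
  \<open>\<theta> h - \<theta> (d - h)\<close>, so the summands satisfy
  \<open>\<delta> n + \<delta> (n + 2) = \<beta> * \<delta> (n + 1)\<close>. The second term of
  \<open>split_value\<close> is a particular solution of the inhomogeneous recurrence, and hence
  every \<open>\<psi>\<close> gives a solution.\<close>

lemma td_coeff_split_value:
  fixes \<theta> :: "nat \<Rightarrow> 'a::field"
  assumes rec: "\<And>m. m + 2 \<le> d \<Longrightarrow> \<theta> (m + 2) = \<gamma> + \<beta> * \<theta> (m + 1) - \<theta> m"
    and recs: "\<theta>s n - \<theta>s (n + 3) = (\<beta> + 1) * (\<theta>s (n + 1) - \<theta>s (n + 2))"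
    and n: "n + 2 \<le> d"
  shows "td_coeff \<beta> \<theta> \<theta>s (split_value d \<theta> \<theta>s \<psi>) n = 0"
proof -
  define \<delta> where "\<delta> h = (\<theta> h - \<theta> (d - h)) / (\<theta> 0 - \<theta> d)" for h
  define W where "W n = (\<Sum>h<n. \<delta> h)" for n
  have s3: "\<theta>s (n + 3) = \<theta>s n - (\<beta> + 1) * (\<theta>s (n + 1) - \<theta>s (n + 2))" using recs by (simp add: algebra_simps)
  have "\<theta> (d - n) = \<gamma> + \<beta> * \<theta> (d - (n + 1)) - \<theta> (d - (n + 2))"
  proof -
    have "d - n = d - (n + 2) + 2" "d - (n + 1) = d - (n + 2) + 1" using n by auto
    then show ?thesis using rec[of "d - (n + 2)"] by simp
  qed
  then have "\<theta> (d - (n + 2)) = \<gamma> + \<beta> * \<theta> (d - (n + 1)) - \<theta> (d - n)" by simp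
  then have "(\<theta> n - \<theta> (d - n)) + (\<theta> (n + 2) - \<theta> (d - (n + 2))) = \<beta> * (\<theta> (n + 1) - \<theta> (d - (n + 1)))"
    unfolding rec[OF n] by (simp add: algebra_simps)
  then have "\<delta> n + \<delta> (n + 2) = \<beta> * \<delta> (n + 1)"
    unfolding \<delta>_def by (simp only: add_divide_distrib[symmetric] times_divide_eq_right)
  then have W: "W n - W (n + 3) - (\<beta> + 1) * (W (n + 1) - W (n + 2)) = 0"
    by (simp add: W_def eval_nat_numeral algebra_simps)
  define v where "v m = (\<theta>s m - \<theta>s 0) * (\<theta> (m - 1) - \<theta> d)" for m
  have v: "v n - v (n + 3) - (\<beta> + 1) * (v (n + 1) - v (n + 2)) +
     (\<beta> + 1) * (\<theta>s n * (\<theta> (n + 1) - \<theta> n) - \<theta>s (n + 1) * (\<theta> (n + 2) - \<theta> n) +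
                \<theta>s (n + 2) * (\<theta> (n + 2) - \<theta> (n + 1))) = 0"
  proof -
    \<comment> \<open>For n > 0 the recurrence rewrites \<open>\<theta> (n - 1)\<close>; for n = 0
      both sides carry the factor \<open>\<theta>s 0 - \<theta>s 0\<close>.\<close>
    have "v n = (\<theta>s n - \<theta>s 0) * (\<gamma> + \<beta> * \<theta> n - \<theta> (n + 1) - \<theta> d)"
    proof (cases n)
      case (Suc m)
      then have "\<theta> (n + 1) = \<gamma> + \<beta> * \<theta> n - \<theta> m" using rec[of m] n by (simp add: eval_nat_numeral)
      then show ?thesis using Suc by (simp add: v_def)
    qed (simp add: v_def)
    moreover have "v (n + 1) = (\<theta>s (n + 1) - \<theta>s 0) * (\<theta> n - \<theta> d)"
      "v (n + 2) = (\<theta>s (n + 2) - \<theta>s 0) * (\<theta> (n + 1) - \<theta> d)"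
      "v (n + 3) = (\<theta>s (n + 3) - \<theta>s 0) * (\<theta> (n + 2) - \<theta> d)"
      by (simp_all add: v_def eval_nat_numeral)
    ultimately show ?thesis
      unfolding s3 rec[OF n] by (simp only:) (simp add: algebra_simps)
  qed
  have sv: "split_value d \<theta> \<theta>s \<psi> m = \<psi> * W m + v m" for m
    by (simp add: split_value_def W_def v_def \<delta>_def)
  have "td_coeff \<beta> \<theta> \<theta>s (split_value d \<theta> \<theta>s \<psi>) n =
    \<psi> * (W n - W (n + 3) - (\<beta> + 1) * (W (n + 1) - W (n + 2))) + 
    (v n - v (n + 3) - (\<beta> + 1) * (v (n + 1) - v (n + 2)) +
     (\<beta> + 1) * (\<theta>s n * (\<theta> (n + 1) - \<theta> n) - \<theta>s (n + 1) * (\<theta> (n + 2) - \<theta> n) +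
                \<theta>s (n + 2) * (\<theta> (n + 2) - \<theta> (n + 1))))"
    unfolding td_coeff_def sv by (simp only: algebra_simps)
  then show ?thesis unfolding W v by simp
qed

lemma quadratic_newton:
  fixes a b u v :: "'a::field"
  shows "[:- u, 1:] * [:- v, 1:] = [:- a, 1:] * [:- b, 1:] +
    (Polynomial.smult (a - u + (b - v)) [:- a, 1:] + Polynomial.smult ((a - u) * (a - v)) 1)"
  by (simp add: one_pCons) (simp add: left_diff_distrib right_diff_distrib distrib_right distrib_left)

text \<open>
  The tridiagonal relation does not control the entry \<open>t d 0\<close>.  It is detected here: the quadratic
  polynomial below vanishes at \<open>\<theta> d\<close> and \<open>\<theta> (d - 1)\<close>.
\<close>

lemma act_eta2:
  fixes \<theta> :: "nat \<Rightarrow> 'a::field"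
  assumes split: "split_action d \<theta> \<theta>s \<phi> t" and d: "d \<ge> 2" and inj: "inj_on \<theta> {..d}"
    and psi: "\<psi> = \<phi> 1 + (\<theta>s 1 - \<theta>s 0) * (\<theta> d - \<theta> 0)"
  shows "act d \<theta> t ([:- \<theta> d, 1:] * [:- \<theta> (d - 1), 1:]) d =
     (\<theta> d - \<theta> 0) * (\<phi> 2 - split_value d \<theta> \<theta>s \<psi> 2)"
proof -
  let ?S = "\<theta> 0 - \<theta> d + (\<theta> 1 - \<theta> (d - 1))"
  let ?g = "newton_poly \<theta>"
  have g1: "?g 1 = [:- \<theta> 0, 1:]" by (simp add: newton_poly_def)
  have g2: "?g 2 = [:- \<theta> 0, 1:] * [:- \<theta> 1, 1:]" by (simp add: newton_poly_def eval_nat_numeral)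
  have e: "[:- \<theta> d, 1:] * [:- \<theta> (d - 1), 1:] =
    ?g 2 + (Polynomial.smult ?S (?g 1) + Polynomial.smult ((\<theta> 0 - \<theta> d) * (\<theta> 0 - \<theta> (d - 1))) (?g 0))"
    unfolding g1 g2 newton_poly_0 by (rule quadratic_newton)
  have T: "act d \<theta> t (?g n) d = \<theta>s n * poly (?g n) (\<theta> d) + \<phi> n * poly (?g (n - 1)) (\<theta> d)" if "n \<le> d" for n
    using split that unfolding split_action_def by blast
  have phi0: "\<phi> 0 = 0" using split by (simp add: split_action_def)
  have ne: "\<theta> 0 - \<theta> d \<noteq> 0" using inj_onD[OF inj, of 0 d] d by auto
  have v: "(\<theta> 0 - \<theta> d) * split_value d \<theta> \<theta>s \<psi> 2 =
      \<psi> * ?S + (\<theta> 0 - \<theta> d) * ((\<theta>s 2 - \<theta>s 0) * (\<theta> 1 - \<theta> d))"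
  proof -
    have "(\<Sum>h<2. (\<theta> h - \<theta> (d - h)) / (\<theta> 0 - \<theta> d)) = ?S / (\<theta> 0 - \<theta> d)"
      by (simp add: eval_nat_numeral add_divide_distrib)
    moreover have "a * (p * (s / a) + q) = p * s + a * q" if "a \<noteq> 0" for a p q s :: 'a
      using that by (simp add: distrib_left)
    ultimately show ?thesis using ne by (simp only: split_value_def) simp
  qed
  have a: "act d \<theta> t ([:- \<theta> d, 1:] * [:- \<theta> (d - 1), 1:]) d =
    (\<theta> d - \<theta> 0) * \<phi> 2 + (\<psi> * ?S + (\<theta> 0 - \<theta> d) * ((\<theta>s 2 - \<theta>s 0) * (\<theta> 1 - \<theta> d)))"
  proof -
    have A0: "act d \<theta> t (?g 0) d = \<theta>s 0" using T[of 0] phi0 by simp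
    have A1: "act d \<theta> t (?g 1) d = \<theta>s 1 * (\<theta> d - \<theta> 0) + \<phi> 1" using T[of 1] d by simp
    have A2: "act d \<theta> t (?g 2) d = \<theta>s 2 * ((\<theta> d - \<theta> 1) * (\<theta> d - \<theta> 0)) + \<phi> 2 * (\<theta> d - \<theta> 0)"
      using T[of 2] d by (simp add: numeral_2_eq_2)
    show ?thesis
      unfolding e act_add act_smult A0 A1 A2 psi by (simp add: algebra_simps)
  qed
  show ?thesis unfolding a v[symmetric] by (simp add: algebra_simps)
qed

lemma act_band:
  assumes band: "band d t" and i: "i \<le> d" and zero: "\<And>j. j \<le> d \<Longrightarrow> j \<le> i + 1 \<Longrightarrow> i \<le> j + 1 \<Longrightarrow> poly p (\<theta> j) = 0"
  shows "act d \<theta> t p i = 0"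
  unfolding act_def
proof (rule sum.neutral, intro ballI)
  fix j assume "j \<in> {..d}"
  then show "t i j * poly p (\<theta> j) = 0"
    using band i zero[of j] unfolding band_def by (cases "i + 1 < j \<or> j + 1 < i") auto
qed

text \<open>Two discrete integrations: the third-order recurrence says that
  \<open>\<theta> (n + 2) - (k - 1) * \<theta> (n + 1) + \<theta> n\<close> is a constant \<gamma>,
  and the resulting second-order one conserves the quadratic expression \<rho>. Thus \<beta> = k - 1
  in \<open>td\<close>, whose quadratic factor then vanishes at consecutive points.\<close>

lemma recurrence_imp_quadratic:
  fixes \<theta> :: "nat \<Rightarrow> 'a::field"
  assumes rec: "\<And>n. n + 3 \<le> N \<Longrightarrow> \<theta> n - \<theta> (n + 3) = k * (\<theta> (n + 1) - \<theta> (n + 2))"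
  obtains \<gamma> \<rho> where
    "\<And>n. n + 2 \<le> N \<Longrightarrow> \<theta> (n + 2) = \<gamma> + (k - 1) * \<theta> (n + 1) - \<theta> n"
    "\<And>n. n + 1 \<le> N \<Longrightarrow> \<rho> = \<theta> n ^ 2 - (k - 1) * \<theta> n * \<theta> (n + 1) + \<theta> (n + 1) ^ 2 - \<gamma> * (\<theta> n + \<theta> (n + 1))"
proof -
  define \<gamma> where "\<gamma> = \<theta> 2 - (k - 1) * \<theta> 1 + \<theta> 0"
  have 1: "\<theta> (n + 2) = \<gamma> + (k - 1) * \<theta> (n + 1) - \<theta> n" if "n + 2 \<le> N" for n
    using that
  proof (induction n)
    case (Suc n)
    have "\<theta> n - \<theta> (Suc n + 2) = k * (\<theta> (n + 1) - \<theta> (n + 2))" using rec[of n] Suc.prems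
      by (simp add: eval_nat_numeral)
    then have "\<theta> (Suc n + 2) = \<theta> n - k * (\<theta> (n + 1) - \<theta> (n + 2))" by (simp add: algebra_simps)
    moreover have "\<theta> n = \<gamma> + (k - 1) * \<theta> (n + 1) - \<theta> (n + 2)" using Suc by simp
    ultimately show ?case by (simp add: algebra_simps)
  qed (simp add: \<gamma>_def numeral_2_eq_2)
  define \<rho> where "\<rho> = \<theta> 0 ^ 2 - (k - 1) * \<theta> 0 * \<theta> 1 + \<theta> 1 ^ 2 - \<gamma> * (\<theta> 0 + \<theta> 1)"
  have 2: "\<rho> = \<theta> n ^ 2 - (k - 1) * \<theta> n * \<theta> (n + 1) + \<theta> (n + 1) ^ 2 - \<gamma> * (\<theta> n + \<theta> (n + 1))" if "n + 1 \<le> N" for n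
    using that
  proof (induction n)
    case (Suc n)
    have *: "\<theta> (Suc n + 1) = \<gamma> + (k - 1) * \<theta> (Suc n) - \<theta> n" using 1[of n] Suc.prems by simp
    have "\<rho> = \<theta> n ^ 2 - (k - 1) * \<theta> n * \<theta> (Suc n) + \<theta> (Suc n) ^ 2 - \<gamma> * (\<theta> n + \<theta> (Suc n))"
      using Suc by simp
    then show ?case unfolding * by (simp add: algebra_simps power2_eq_square)
  qed (simp add: \<rho>_def)
  from that[OF 1 2] show ?thesis by blast
qed

text \<open>For first argument r the quadratic factor is monic in y, and its roots are the two
  neighbours of r in the sequence. So the relation forces entries of \<open>t\<close> to vanish off
  the band whenever r is an interior point; the end points escape this argument.\<close>

lemma td_neighbour:
  assumes "w = \<gamma> + \<beta> * r - q" "\<rho> = q ^ 2 - \<beta> * q * r + r ^ 2 - \<gamma> * (q + r)"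
  shows "td \<beta> \<gamma> \<rho> r y = (r - y) * ((y - q) * (y - w))"
  unfolding td_def assms by (simp add: algebra_simps power2_eq_square)

lemma td_commute: "td \<beta> \<gamma> \<rho> x y = - td \<beta> \<gamma> \<rho> y x"
  unfolding td_def by (simp add: algebra_simps)

text \<open>Both sides satisfy the same four-term recurrence, so agreement at n = 0, 1, 2 suffices.
  The choice of \<open>\<psi>\<close> settles n = 1, and n = 2 is read off the bottom row of
  \<open>t\<close>.\<close>

lemma band_imp_split_value:
  fixes \<theta> :: "nat \<Rightarrow> 'a::field"
  assumes inj: "inj_on \<theta> {..d}" and injs: "inj_on \<theta>s {..d}"
    and split: "split_action d \<theta> \<theta>s \<phi> t" and band: "band d t"
    and rec: "\<And>n. n + 3 \<le> d \<Longrightarrow> \<theta> n - \<theta> (n + 3) = k * (\<theta> (n + 1) - \<theta> (n + 2)) \<and>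
                          \<theta>s n - \<theta>s (n + 3) = k * (\<theta>s (n + 1) - \<theta>s (n + 2))"
    and psi: "\<psi> = \<phi> 1 + (\<theta>s 1 - \<theta>s 0) * (\<theta> d - \<theta> 0)"
  shows "n \<le> d \<Longrightarrow> \<phi> n = split_value d \<theta> \<theta>s \<psi> n"
proof (induction n rule: less_induct)
  case (less n)
  have phi0: "\<phi> 0 = 0" using split by (simp add: split_action_def)
  have ne: "\<theta> i \<noteq> \<theta> j" if "i \<le> d" "j \<le> d" "i \<noteq> j" for i j
    using inj that by (auto simp: inj_on_def)
  consider "n = 0" | "n = 1" | "n = 2" | m where "n = m + 3"
    by (metis One_nat_def add.commute add_2_eq_Suc'
        less_2_cases_iff less_Suc_eq not_less_eq numeral_3_eq_3 numeral_2_eq_2 le_Suc_ex not_less)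
  then show ?case
  proof cases
    case 1
    then show ?thesis by (simp add: phi0)
  next
    case 2
    then have "\<theta> 0 - \<theta> d \<noteq> 0" using ne[of 0 d] less.prems by auto
    with 2 show ?thesis by (simp add: split_value_def psi algebra_simps)
  next
    case 3
    then have d: "d \<ge> 2" using less.prems by simp
    have "act d \<theta> t ([:- \<theta> d, 1:] * [:- \<theta> (d - 1), 1:]) d = 0"
    proof (rule act_band[OF band order.refl])
      fix j assume "j \<le> d" "d \<le> j + 1"
      then have "j = d \<or> j = d - 1" by auto
      then show "poly ([:- \<theta> d, 1:] * [:- \<theta> (d - 1), 1:]) (\<theta> j) = 0" by auto
    qed
    then show ?thesis using act_eta2[OF split d inj psi] ne[of d 0] d 3 by auto
  next
    case (4 m)
    then have m: "m + 3 \<le> d" using less.prems by simp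
    obtain \<gamma> \<rho> where gam: "\<And>n. n + 2 \<le> d \<Longrightarrow> \<theta> (n + 2) = \<gamma> + (k - 1) * \<theta> (n + 1) - \<theta> n"
      and rho: "\<And>n. n + 1 \<le> d \<Longrightarrow> \<rho> = \<theta> n ^ 2 - (k - 1) * \<theta> n * \<theta> (n + 1) + \<theta> (n + 1) ^ 2 - \<gamma> * (\<theta> n + \<theta> (n + 1))"
      using recurrence_imp_quadratic[of d \<theta> k] rec by blast
    let ?td = "td (k - 1) \<gamma> \<rho>"
    have recs: "\<theta>s m - \<theta>s (m + 3) = (k - 1 + 1) * (\<theta>s (m + 1) - \<theta>s (m + 2))" using rec[OF m] by simp
    have td0: "?td (\<theta> j) (\<theta> (Suc j)) = 0" if "Suc j \<le> d" for j
      using rho[of j] that by (simp add: td_def algebra_simps)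
    \<comment> \<open>Within the band \<open>td\<close> is zero. One row is enough, because
      \<open>newton_poly \<theta> (m + 2)\<close> does not vanish at
      \<open>\<theta> (m + 2)\<close>, so the equation for row m + 2 already forces
      \<open>td_coeff\<close> to vanish.\<close>
    have "(\<Sum>j\<le>d. t (m + 2) j * ?td (\<theta> (m + 2)) (\<theta> j) * poly (newton_poly \<theta> m) (\<theta> j)) = 0"
    proof (rule sum.neutral, intro ballI)
      fix j assume j: "j \<in> {..d}"
      show "t (m + 2) j * ?td (\<theta> (m + 2)) (\<theta> j) * poly (newton_poly \<theta> m) (\<theta> j) = 0"
      proof (cases "m + 2 + 1 < j \<or> j + 1 < m + 2")
        case True
        then have "t (m + 2) j = 0" using band j m unfolding band_def by auto
        then show ?thesis by simp
      next
        case False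
        then consider "j = m + 2" | "j = Suc (m + 2)" | "Suc j = m + 2" by linarith
        then have "?td (\<theta> (m + 2)) (\<theta> j) = 0"
        proof cases
          case 1
          then show ?thesis by (simp add: td_def)
        next
          case 2
          then show ?thesis using td0[of "m + 2"] m by simp
        next
          case 3
          then show ?thesis using td0[of j] td_commute[of _ _ _ "\<theta> (m + 2)"] m by simp
        qed
        then show ?thesis by simp
      qed
    qed
    moreover have "(\<Sum>j\<le>d. t (m + 2) j * ?td (\<theta> (m + 2)) (\<theta> j) * poly (newton_poly \<theta> m) (\<theta> j)) =
       td_coeff (k - 1) \<theta> \<theta>s \<phi> m * poly (newton_poly \<theta> (m + 2)) (\<theta> (m + 2))"
    proof (rule td_newton)
      show "\<phi> 0 = 0" by (fact phi0)
      show "\<theta>s m - \<theta>s (m + 3) = (k - 1 + 1) * (\<theta>s (m + 1) - \<theta>s (m + 2))" by (fact recs)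
      show "\<theta> (m + 2) = \<gamma> + (k - 1) * \<theta> (m + 1) - \<theta> m" using gam m by simp
      show "\<rho> = \<theta> m ^ 2 - (k - 1) * \<theta> m * \<theta> (m + 1) + \<theta> (m + 1) ^ 2 - \<gamma> * (\<theta> m + \<theta> (m + 1))"
        using rho m by simp
    next
      fix l assume "l \<in> {m..m + 3}"
      then show "act d \<theta> t (newton_poly \<theta> l) (m + 2) = \<theta>s l * poly (newton_poly \<theta> l) (\<theta> (m + 2)) +
         \<phi> l * poly (newton_poly \<theta> (l - 1)) (\<theta> (m + 2))"
        using split m unfolding split_action_def by auto
    next
      assume "m > 0"
      then show "\<theta> (m + 1) = \<gamma> + (k - 1) * \<theta> m - \<theta> (m - 1)"
        using gam[of "m - 1"] m \<open>m > 0\<close> by (simp add: Suc_diff_Suc numeral_2_eq_2)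
    qed
    ultimately have "td_coeff (k - 1) \<theta> \<theta>s \<phi> m = 0"
      using newton_poly_nonroot[OF inj, of "m + 2" "m + 2"] m by simp
    moreover have "td_coeff (k - 1) \<theta> \<theta>s (split_value d \<theta> \<theta>s \<psi>) m = 0"
      using td_coeff_split_value[OF gam recs] m by simp
    moreover have "\<phi> m = split_value d \<theta> \<theta>s \<psi> m" "\<phi> (m + 1) = split_value d \<theta> \<theta>s \<psi> (m + 1)"
      "\<phi> (m + 2) = split_value d \<theta> \<theta>s \<psi> (m + 2)"
      using less.IH[of m] less.IH[of "m + 1"] less.IH[of "m + 2"] 4 m by auto
    ultimately show ?thesis unfolding 4 by (simp add: td_coeff_def algebra_simps)
  qed
qed

section \<open>Tridiagonality from the parameter array\<close>

text \<open>\<open>newton_poly \<theta> n\<close> lives on the points with index at least n, so the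
  equations are triangular and are solved downwards from d. This passes from sums against Newton
  polynomials to single entries of a row.\<close>

lemma newton_functional_zero:
  assumes inj: "inj_on \<theta> {..d}"
    and zero: "\<And>n. n \<le> d \<Longrightarrow> (\<Sum>j\<le>d. c j * poly (newton_poly \<theta> n) (\<theta> j)) = 0"
    and n: "n \<le> d"
  shows "c n = 0"
  using n
proof (induction "d - n" arbitrary: n rule: less_induct)
  case (less n)
  have "c j * poly (newton_poly \<theta> n) (\<theta> j) = 0" if "j \<in> {..d} - {n}" for j
  proof (cases "j < n")
    case False
    then have "c j = 0" using less.hyps[of j] that by auto
    then show ?thesis by simp
  qed simp
  then have "(\<Sum>j\<le>d. c j * poly (newton_poly \<theta> n) (\<theta> j)) = c n * poly (newton_poly \<theta> n) (\<theta> n)"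
    using less.prems by (subst sum.remove[of _ n]) (auto simp del: mult_eq_0_iff)
  then show ?case
    using zero[OF less.prems] newton_poly_nonroot[OF inj, of n n] less.prems by simp
qed

text \<open>The tridiagonal relation on \<open>newton_poly \<theta> n\<close> with n up to d refers
  to \<open>\<theta> (d + 2)\<close> and \<open>\<theta>s (d + 3)\<close>. Prolonging both sequences
  by their recurrence supplies such values, so that the indices near d can be treated like all
  others.\<close>

fun continue_recurrence :: "'a::field \<Rightarrow> (nat \<Rightarrow> 'a) \<Rightarrow> nat \<Rightarrow> 'a" where
  "continue_recurrence k \<theta> (Suc (Suc (Suc n))) = continue_recurrence k \<theta> n -
     k * (continue_recurrence k \<theta> (Suc n) - continue_recurrence k \<theta> (Suc (Suc n)))"
| "continue_recurrence k \<theta> n = \<theta> n"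

lemma continue_recurrence_rec:
  "continue_recurrence k \<theta> n - continue_recurrence k \<theta> (n + 3) =
     k * (continue_recurrence k \<theta> (n + 1) - continue_recurrence k \<theta> (n + 2))"
  by (simp add: eval_nat_numeral)

lemma continue_recurrence_eq:
  assumes "\<And>n. n + 3 \<le> d \<Longrightarrow> \<theta> n - \<theta> (n + 3) = k * (\<theta> (n + 1) - \<theta> (n + 2))"
  shows "n \<le> d \<Longrightarrow> continue_recurrence k \<theta> n = \<theta> n"
proof (induction n rule: less_induct)
  case (less n)
  show ?case
  proof (cases "n < 3")
    case True
    then have "n = 0 \<or> n = 1 \<or> n = 2" by auto
    then show ?thesis by (auto simp: numeral_2_eq_2)
  next
    case False
    then obtain m where n: "n = m + 3" by (metis le_add_diff_inverse2 not_less)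
    then have m: "m + 3 \<le> d" using less.prems by simp
    have "continue_recurrence k \<theta> m = \<theta> m" "continue_recurrence k \<theta> (m + 1) = \<theta> (m + 1)"
      "continue_recurrence k \<theta> (m + 2) = \<theta> (m + 2)"
      using less.IH[of m] less.IH[of "m + 1"] less.IH[of "m + 2"] n less.prems by auto
    moreover have "continue_recurrence k \<theta> n = continue_recurrence k \<theta> m -
        k * (continue_recurrence k \<theta> (m + 1) - continue_recurrence k \<theta> (m + 2))"
      unfolding n by (simp add: eval_nat_numeral)
    moreover have "\<theta> n = \<theta> m - k * (\<theta> (m + 1) - \<theta> (m + 2))"
      using assms[OF m] n by (simp add: algebra_simps)
    ultimately show ?thesis by simp
  qed
qed

text \<open>On every Newton polynomial the tridiagonal relation vanishes, by the four-term
  recurrence or because \<open>newton_poly \<theta> (n + 2)\<close> is zero at all points. So every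
  product of an entry of \<open>t\<close> with the corresponding value of \<open>td\<close> is zero,
  and off the band \<open>td\<close> is nonzero as soon as one index is interior. That leaves the
  two corners.\<close>

lemma split_value_imp_band_ext:
  fixes \<theta> :: "nat \<Rightarrow> 'a::field"
  assumes inj: "inj_on \<theta> {..d}"
    and split: "split_action d \<theta> \<theta>s \<phi> t"
    and rec: "\<And>n. \<theta> n - \<theta> (n + 3) = k * (\<theta> (n + 1) - \<theta> (n + 2))"
    and recs: "\<And>n. \<theta>s n - \<theta>s (n + 3) = k * (\<theta>s (n + 1) - \<theta>s (n + 2))"
    and psi: "\<psi> = \<phi> 1 + (\<theta>s 1 - \<theta>s 0) * (\<theta> d - \<theta> 0)"
    and phi: "\<And>n. n \<le> d \<Longrightarrow> \<phi> n = split_value d \<theta> \<theta>s \<psi> n" "\<phi> (Suc d) = 0"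
  shows "band d t"
proof (cases "d \<ge> 2")
  case False
  then show ?thesis by (auto simp: band_def)
next
  case d: True
  have phi0: "\<phi> 0 = 0" using split by (simp add: split_action_def)
  have ne: "\<theta> i \<noteq> \<theta> j" if "i \<le> d" "j \<le> d" "i \<noteq> j" for i j
    using inj that by (auto simp: inj_on_def)
  obtain \<gamma> \<rho> where gam': "\<And>n. n + 2 \<le> d + 2 \<Longrightarrow> \<theta> (n + 2) = \<gamma> + (k - 1) * \<theta> (n + 1) - \<theta> n"
    and rho': "\<And>n. n + 1 \<le> d + 2 \<Longrightarrow> \<rho> = \<theta> n ^ 2 - (k - 1) * \<theta> n * \<theta> (n + 1) + \<theta> (n + 1) ^ 2 - \<gamma> * (\<theta> n + \<theta> (n + 1))"
    using recurrence_imp_quadratic[of "d + 2" \<theta> k] rec by blast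
  have gam: "\<theta> (n + 2) = \<gamma> + (k - 1) * \<theta> (n + 1) - \<theta> n" if "n \<le> d" for n using gam'[of n] that by simp
  have rho: "\<rho> = \<theta> n ^ 2 - (k - 1) * \<theta> n * \<theta> (n + 1) + \<theta> (n + 1) ^ 2 - \<gamma> * (\<theta> n + \<theta> (n + 1))" if "n \<le> d" for n
    using rho'[of n] that by simp
  have recs': "\<theta>s n - \<theta>s (n + 3) = (k - 1 + 1) * (\<theta>s (n + 1) - \<theta>s (n + 2))" for n using recs by simp
  let ?td = "td (k - 1) \<gamma> \<rho>"
  have phi_all: "\<phi> n = split_value d \<theta> \<theta>s \<psi> n" if "n \<le> Suc d" for n
    using phi split_value_Suc_d[of d \<theta> \<theta>s \<psi>] that by (auto simp: le_Suc_eq)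
  have td_zero: "t i j * ?td (\<theta> i) (\<theta> j) = 0" if i: "i \<le> d" and j: "j \<le> d" for i j
  proof (rule newton_functional_zero[OF inj _ j, of "\<lambda>j. t i j * ?td (\<theta> i) (\<theta> j)"])
    fix n assume n: "n \<le> d"
    have "(\<Sum>j\<le>d. t i j * ?td (\<theta> i) (\<theta> j) * poly (newton_poly \<theta> n) (\<theta> j)) =
       td_coeff (k - 1) \<theta> \<theta>s \<phi> n * poly (newton_poly \<theta> (n + 2)) (\<theta> i)"
    proof (rule td_newton)
      show "\<phi> 0 = 0" by (fact phi0)
      show "\<theta>s n - \<theta>s (n + 3) = (k - 1 + 1) * (\<theta>s (n + 1) - \<theta>s (n + 2))" by (fact recs')
      show "\<theta> (n + 2) = \<gamma> + (k - 1) * \<theta> (n + 1) - \<theta> n" using gam n by simp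
      show "\<rho> = \<theta> n ^ 2 - (k - 1) * \<theta> n * \<theta> (n + 1) + \<theta> (n + 1) ^ 2 - \<gamma> * (\<theta> n + \<theta> (n + 1))"
        using rho n by simp
    next
      fix m
      show "act d \<theta> t (newton_poly \<theta> m) i = \<theta>s m * poly (newton_poly \<theta> m) (\<theta> i) +
         \<phi> m * poly (newton_poly \<theta> (m - 1)) (\<theta> i)"
      proof (cases "m \<le> d")
        case True
        then show ?thesis using split i unfolding split_action_def by auto
      next
        \<comment> \<open>Beyond d the polynomial vanishes at all points. The only other term that
          could survive is the one for m = d + 1, as \<open>newton_poly \<theta> d\<close> is
          nonzero at \<open>\<theta> d\<close>; there \<open>\<phi>\<close> is zero.\<close>
        case False
        then have "act d \<theta> t (newton_poly \<theta> m) i = 0" by (simp add: act_def)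
        moreover have "\<phi> m * poly (newton_poly \<theta> (m - 1)) (\<theta> i) = 0"
          using False phi(2) i by (cases "m = Suc d") auto
        ultimately show ?thesis using False i by simp
      qed
    next
      assume "n > 0"
      then show "\<theta> (n + 1) = \<gamma> + (k - 1) * \<theta> n - \<theta> (n - 1)"
        using gam[of "n - 1"] n \<open>n > 0\<close> by (simp add: Suc_diff_Suc numeral_2_eq_2)
    qed
    also have "\<dots> = 0"
    proof (cases "n + 2 \<le> d")
      case True
      have "td_coeff (k - 1) \<theta> \<theta>s \<phi> n = td_coeff (k - 1) \<theta> \<theta>s (split_value d \<theta> \<theta>s \<psi>) n"
        unfolding td_coeff_def using phi_all True by simp
      also have "\<dots> = 0" using gam recs' True by (intro td_coeff_split_value) auto
      finally show ?thesis by simp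
    next
      case False
      then show ?thesis using newton_poly_root[of i "n + 2" \<theta>] i by (simp del: poly_newton_poly_Suc)
    qed
    finally show "(\<Sum>j\<le>d. t i j * ?td (\<theta> i) (\<theta> j) * poly (newton_poly \<theta> n) (\<theta> j)) = 0" .
  qed
  have td_nz: "?td (\<theta> i) (\<theta> j) \<noteq> 0"
    if "0 < i" "i < d" "j \<le> d" "i + 1 < j \<or> j + 1 < i" for i j
  proof -
    define l where "l = i - 1"
    with that(1) have l: "i = l + 1" by simp
    have "?td (\<theta> i) (\<theta> j) = (\<theta> i - \<theta> j) * ((\<theta> j - \<theta> l) * (\<theta> j - \<theta> (l + 2)))"
      unfolding l using td_neighbour[OF gam[of l] rho[of l]] that(2) l by simp
    moreover have "\<theta> i - \<theta> j \<noteq> 0" "\<theta> j - \<theta> l \<noteq> 0" "\<theta> j - \<theta> (l + 2) \<noteq> 0"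
      using ne[of i j] ne[of j l] ne[of j "l + 2"] that l by auto
    ultimately show ?thesis by simp
  qed
  have inner: "t i j = 0" if ij: "i \<le> d" "j \<le> d" "i + 1 < j \<or> j + 1 < i"
    and int: "0 < i \<and> i < d \<or> 0 < j \<and> j < d" for i j
  proof -
    have "?td (\<theta> i) (\<theta> j) \<noteq> 0"
    proof (cases "0 < i \<and> i < d")
      case True
      then show ?thesis using td_nz[of i j] ij by blast
    next
      case False
      then have "?td (\<theta> j) (\<theta> i) \<noteq> 0" using td_nz[of j i] ij int by blast
      then show ?thesis using td_commute[of "k - 1" \<gamma> \<rho> "\<theta> i" "\<theta> j"] by simp
    qed
    then show ?thesis using td_zero[OF ij(1,2)] by simp
  qed
  \<comment> \<open>\<open>newton_poly \<theta> d\<close> sees only the last column; its image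
    combines it with \<open>newton_poly \<theta> (d - 1)\<close>, and both vanish at
    \<open>\<theta> 0\<close> since d \<ge> 2.\<close>
  have upper: "t 0 d = 0"
  proof -
    have "act d \<theta> t (newton_poly \<theta> d) 0 = 0"
      using split d unfolding split_action_def by simp
    moreover have "act d \<theta> t (newton_poly \<theta> d) 0 = t 0 d * poly (newton_poly \<theta> d) (\<theta> d)"
      unfolding act_def by (subst sum.remove[of _ d]) (auto intro!: sum.neutral)
    ultimately show ?thesis using newton_poly_nonroot[OF inj, of d d] by simp
  qed
  \<comment> \<open>In row d only the columns 0, d - 1 and d can still be nonzero, and the last two
    belong to roots of \<open>?e\<close>.\<close>
  have lower: "t d 0 = 0"
  proof -
    let ?e = "[:- \<theta> d, 1:] * [:- \<theta> (d - 1), 1:]"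
    have "t d j * poly ?e (\<theta> j) = 0" if "j \<in> {..d} - {0}" for j
    proof (cases "j = d \<or> j = d - 1")
      case False
      then have "t d j = 0" using inner[of d j] that by auto
      then show ?thesis by simp
    qed auto
    then have "(\<Sum>j\<in>{..d} - {0}. t d j * poly ?e (\<theta> j)) = 0" by (intro sum.neutral) blast
    then have "act d \<theta> t ?e d = t d 0 * poly ?e (\<theta> 0)"
      unfolding act_def using sum.remove[of "{..d}" 0 "\<lambda>j. t d j * poly ?e (\<theta> j)"] by simp
    moreover have "act d \<theta> t ?e d = 0"
      unfolding act_eta2[OF split d inj psi] using phi(1)[OF d] by simp
    moreover have "poly ?e (\<theta> 0) = (\<theta> 0 - \<theta> d) * (\<theta> 0 - \<theta> (d - 1))" by (simp add: algebra_simps)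
    then have "poly ?e (\<theta> 0) \<noteq> 0" using ne[of 0 d] ne[of 0 "d - 1"] d by simp
    ultimately show ?thesis by simp
  qed
  show ?thesis unfolding band_def
  proof (intro allI impI)
    fix i j assume ij: "i \<le> d" "j \<le> d" "i + 1 < j \<or> j + 1 < i"
    show "t i j = 0"
    proof (cases "0 < i \<and> i < d \<or> 0 < j \<and> j < d")
      case False
      then have "i = 0 \<and> j = d \<or> i = d \<and> j = 0" using ij by auto
      then show ?thesis using upper lower by auto
    qed (use inner ij in blast)
  qed
qed

lemma split_value_imp_band:
  fixes \<theta> :: "nat \<Rightarrow> 'a::field"
  assumes inj: "inj_on \<theta> {..d}"
    and split: "split_action d \<theta> \<theta>s \<phi> t"
    and rec: "\<And>n. n + 3 \<le> d \<Longrightarrow> \<theta> n - \<theta> (n + 3) = k * (\<theta> (n + 1) - \<theta> (n + 2)) \<and>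
                          \<theta>s n - \<theta>s (n + 3) = k * (\<theta>s (n + 1) - \<theta>s (n + 2))"
    and psi: "\<psi> = \<phi> 1 + (\<theta>s 1 - \<theta>s 0) * (\<theta> d - \<theta> 0)"
    and phi: "\<And>n. n \<le> d \<Longrightarrow> \<phi> n = split_value d \<theta> \<theta>s \<psi> n"
  shows "band d t"
proof (cases "d = 0")
  case True
  then show ?thesis by (simp add: band_def)
next
  case False
  define \<theta>' \<theta>s' where "\<theta>' = continue_recurrence k \<theta>" and "\<theta>s' = continue_recurrence k \<theta>s"
  define \<phi>' where "\<phi>' n = (if n \<le> d then \<phi> n else 0)" for n
  have eq: "\<theta>' n = \<theta> n" "\<theta>s' n = \<theta>s n" if "n \<le> d" for n
    using continue_recurrence_eq[of d _ k n] rec that unfolding \<theta>'_def \<theta>s'_def by auto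
  have newton: "newton_poly \<theta>' n = newton_poly \<theta> n" if "n \<le> d" for n
    using that eq by (intro newton_poly_cong) auto
  have val: "split_value d \<theta>' \<theta>s' \<psi> n = split_value d \<theta> \<theta>s \<psi> n" if "n \<le> d" for n
    unfolding split_value_def using that eq by simp
  show ?thesis
  proof (rule split_value_imp_band_ext[of \<theta>' d \<theta>s' \<phi>' t k])
    show "inj_on \<theta>' {..d}" using inj eq by (auto simp: inj_on_def)
    show "split_action d \<theta>' \<theta>s' \<phi>' t"
      using split unfolding split_action_def by (auto simp: \<phi>'_def act_def eq newton)
    show "\<theta>' n - \<theta>' (n + 3) = k * (\<theta>' (n + 1) - \<theta>' (n + 2))"
      "\<theta>s' n - \<theta>s' (n + 3) = k * (\<theta>s' (n + 1) - \<theta>s' (n + 2))" for n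
      unfolding \<theta>'_def \<theta>s'_def by (rule continue_recurrence_rec)+
    show "\<psi> = \<phi>' 1 + (\<theta>s' 1 - \<theta>s' 0) * (\<theta>' d - \<theta>' 0)"
      using psi False by (simp add: \<phi>'_def eq)
    show "\<phi>' n = split_value d \<theta>' \<theta>s' \<psi> n" if "n \<le> d" for n
      using phi val that by (simp add: \<phi>'_def)
    show "\<phi>' (Suc d) = 0" by (simp add: \<phi>'_def)
  qed
qed

section \<open>The second split form\<close>

lemma act_reverse:
  "act d (\<lambda>i. \<theta> (d - i)) (\<lambda>i j. t (d - i) (d - j)) p i = act d \<theta> t p (d - i)"
  unfolding act_def using sum.nat_diff_reindex[of "\<lambda>j. t (d - i) j * poly p (\<theta> j)" "Suc d"]
  by (simp add: lessThan_Suc_atMost)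

lemma band_reverse: "band d t \<Longrightarrow> band d (\<lambda>i j. t (d - i) (d - j))"
  unfolding band_def by auto

lemma inj_on_reverse: "inj_on \<theta> {..d} \<Longrightarrow> inj_on (\<lambda>i. \<theta> (d - i)) {..d::nat}"
proof (rule inj_onI)
  fix x y assume "inj_on \<theta> {..d}" "x \<in> {..d}" "y \<in> {..d}" "\<theta> (d - x) = \<theta> (d - y)"
  then have "d - x = d - y" by (intro inj_onD[of \<theta> "{..d}" "d - x"]) auto
  with \<open>x \<in> {..d}\<close> \<open>y \<in> {..d}\<close> show "x = y" by auto
qed

lemma poly_eq_reverse_newton:
  fixes p :: "'a::field poly"
  assumes inj: "inj_on \<theta> {..d}" and i: "i \<le> d" and deg: "degree p \<le> i"
    and roots: "\<And>j. d - i < j \<Longrightarrow> j \<le> d \<Longrightarrow> poly p (\<theta> j) = 0"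
  shows "p = Polynomial.smult (coeff p i) (newton_poly (\<lambda>k. \<theta> (d - k)) i)"
proof (cases i)
  case 0
  then show ?thesis using deg by (auto elim!: degree_eq_zeroE)
next
  case (Suc m)
  let ?e = "newton_poly (\<lambda>k. \<theta> (d - k)) i"
  have "p - Polynomial.smult (coeff p i) ?e = 0"
  proof (rule poly_eq_on_points[where I = "{d - m..d}" and \<theta> = \<theta>])
    show "inj_on \<theta> {d - m..d}" using inj by (rule inj_on_subset) auto
    have "degree (p - Polynomial.smult (coeff p i) ?e) \<le> m"
      unfolding Suc using deg Suc by (intro degree_diff_top) auto
    moreover have "card {d - m..d} = Suc m" using i Suc by auto
    ultimately show "degree (p - Polynomial.smult (coeff p i) ?e) < card {d - m..d}"
      "degree 0 < card {d - m..d}" by auto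
    fix j assume j: "j \<in> {d - m..d}"
    then have "poly p (\<theta> j) = 0" using Suc i by (intro roots) auto
    moreover have "poly ?e (\<theta> j) = 0"
      using newton_poly_root[of "d - j" i "\<lambda>k. \<theta> (d - k)"] j Suc i by auto
    ultimately show "poly (p - Polynomial.smult (coeff p i) ?e) (\<theta> j) = poly 0 (\<theta> j)" by simp
  qed simp
  then show ?thesis by simp
qed

text \<open>Two bounds meet. For the reversed Newton polynomial e_n, the split form gives T e_n -
  \<theta>s_n e_n degree at most n - 1, and the band gives it roots at the last n - 1 points. So it
  is a multiple of e_(n-1), and these multiples form \<open>\<psi>\<close>.\<close>

lemma band_imp_second_split:
  fixes \<theta> :: "nat \<Rightarrow> 'a::field"
  assumes inj: "inj_on \<theta> {..d}"
    and split: "split_action d \<theta> \<theta>s \<phi> t" and band: "band d t"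
  shows "\<exists>\<psi>. split_action d (\<lambda>i. \<theta> (d - i)) \<theta>s \<psi> (\<lambda>i j. t (d - i) (d - j))"
proof -
  let ?e = "newton_poly (\<lambda>i. \<theta> (d - i))"
  have "\<exists>c. (n = 0 \<longrightarrow> c = 0) \<and>
      (\<forall>i\<le>d. act d \<theta> t (?e n) i = \<theta>s n * poly (?e n) (\<theta> i) + c * poly (?e (n - 1)) (\<theta> i))"
    if n: "n \<le> d" for n
  proof -
    obtain q where q: "degree q \<le> n" "coeff q n = \<theta>s n" "\<forall>i\<le>d. act d \<theta> t (?e n) i = poly q (\<theta> i)"
      using split_action_degree[OF split n, of "?e n"] by auto
    show ?thesis
    proof (cases n)
      case 0
      then have "q = [:\<theta>s 0:]" using q by (metis bot_nat_0.extremum_uniqueI coeff_pCons_0 degree_eq_zeroE)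
      then show ?thesis using q 0 by auto
    next
      case (Suc m)
      define r where "r = q - Polynomial.smult (\<theta>s n) (?e n)"
      have degr: "degree r \<le> m"
        unfolding r_def q(2)[symmetric] unfolding Suc using q(1) Suc by (intro degree_diff_top) auto
      have root_e: "poly (?e l) (\<theta> j) = 0" if "j \<le> d" "d < j + l" for j l
        using newton_poly_root[of "d - j" l "\<lambda>i. \<theta> (d - i)"] that by simp
      have root: "poly r (\<theta> i) = 0" if i: "i \<le> d" "d < i + m" for i
      proof -
        have "act d \<theta> t (?e n) i = 0"
          using i Suc by (intro act_band[OF band] root_e) auto
        then show ?thesis using q(3) i root_e[of i n] Suc by (simp add: r_def)
      qed
      define c where "c = coeff r m"
      have "r = Polynomial.smult c (?e m)"
        unfolding c_def using n Suc by (intro poly_eq_reverse_newton[OF inj _ degr] root) auto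
      then have "q = Polynomial.smult (\<theta>s n) (?e n) + Polynomial.smult c (?e m)"
        by (simp add: r_def algebra_simps)
      then show ?thesis using q(3) Suc by (intro exI[of _ c]) simp
    qed
  qed
  then obtain \<psi> where psi: "\<And>n. n \<le> d \<Longrightarrow> (n = 0 \<longrightarrow> \<psi> n = 0) \<and>
      (\<forall>i\<le>d. act d \<theta> t (?e n) i = \<theta>s n * poly (?e n) (\<theta> i) + \<psi> n * poly (?e (n - 1)) (\<theta> i))"
    by metis
  then have "split_action d (\<lambda>i. \<theta> (d - i)) \<theta>s \<psi> (\<lambda>i j. t (d - i) (d - j))"
    unfolding split_action_def act_reverse by auto
  then show ?thesis by (rule exI[of _ \<psi>])
qed

text \<open>Row n applied to \<open>newton_poly \<theta> (Suc n)\<close> sees only the superdiagonal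
  entry: the polynomial vanishes at the earlier points, and the band removes the later ones. Applied
  to the reversed form, this controls the subdiagonal through the second split sequence.\<close>

lemma superdiagonal_nonzero_iff:
  fixes \<theta> :: "nat \<Rightarrow> 'a::field"
  assumes inj: "inj_on \<theta> {..d}"
    and split: "split_action d \<theta> \<theta>s \<phi> t" and band: "band d t" and n: "Suc n \<le> d"
  shows "t n (Suc n) \<noteq> 0 \<longleftrightarrow> \<phi> (Suc n) \<noteq> 0"
proof -
  let ?g = "newton_poly \<theta>"
  have "t n j * poly (?g (Suc n)) (\<theta> j) = 0" if "j \<in> {..d} - {Suc n}" for j
  proof (cases "j < Suc n")
    case True
    then show ?thesis using newton_poly_root[of j "Suc n" \<theta>] by simp
  next
    case False
    then show ?thesis using that band n unfolding band_def by auto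
  qed
  then have "act d \<theta> t (?g (Suc n)) n = t n (Suc n) * poly (?g (Suc n)) (\<theta> (Suc n))"
    unfolding act_def using n by (subst sum.remove[of _ "Suc n"]) (auto simp del: mult_eq_0_iff)
  moreover have "act d \<theta> t (?g (Suc n)) n = \<phi> (Suc n) * poly (?g n) (\<theta> n)"
    using split n unfolding split_action_def by fastforce
  ultimately show ?thesis
    using newton_poly_nonroot[OF inj, of n n] newton_poly_nonroot[OF inj, of "Suc n" "Suc n"] n
    by (metis Suc_leD mult_eq_0_iff order.refl)
qed

lemma split_action_cong:
  "split_action d \<theta> \<theta>s \<phi> t \<Longrightarrow> (\<And>n. n \<le> d \<Longrightarrow> \<phi> n = \<phi>' n) \<Longrightarrow> split_action d \<theta> \<theta>s \<phi>' t"
  unfolding split_action_def by simp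

text \<open>The polynomial x - \<theta>_d belongs to the second split form and is x - \<theta>_0
  plus a constant in the first; the two values of its image at \<theta>_0 must agree. This is (3)
  for i = 1, solved for \<psi>_1.\<close>

lemma first_split_values:
  fixes \<theta> :: "nat \<Rightarrow> 'a::field"
  assumes split: "split_action d \<theta> \<theta>s \<phi> t" and d: "d > 0"
    and split': "split_action d (\<lambda>i. \<theta> (d - i)) \<theta>s \<psi> (\<lambda>i j. t (d - i) (d - j))"
  shows "\<psi> 1 = \<phi> 1 + (\<theta>s 1 - \<theta>s 0) * (\<theta> d - \<theta> 0)"
proof -
  have g1: "newton_poly \<theta> 1 = [:- \<theta> 0, 1:]" "newton_poly (\<lambda>i. \<theta> (d - i)) 1 = [:- \<theta> d, 1:]"
    by (simp_all add: newton_poly_def)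
  have phi0: "\<phi> 0 = 0" using split by (simp add: split_action_def)
  have A0: "act d \<theta> t 1 0 = \<theta>s 0"
    using split phi0 unfolding split_action_def
    by (metis newton_poly_0 add.right_neutral le0 mult.right_neutral mult_zero_left poly_1)
  have A1: "act d \<theta> t [:- \<theta> 0, 1:] 0 = \<phi> 1"
    using split d unfolding split_action_def g1(1)[symmetric] by (auto simp: Suc_leI)
  have "act d \<theta> t [:- \<theta> d, 1:] 0 = \<theta>s 1 * (\<theta> 0 - \<theta> d) + \<psi> 1"
  proof -
    have A: "\<forall>n\<le>d. \<forall>i\<le>d. act d \<theta> t (newton_poly (\<lambda>i. \<theta> (d - i)) n) (d - i) =
       \<theta>s n * poly (newton_poly (\<lambda>i. \<theta> (d - i)) n) (\<theta> (d - i)) +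
       \<psi> n * poly (newton_poly (\<lambda>i. \<theta> (d - i)) (n - 1)) (\<theta> (d - i))"
      using split' unfolding split_action_def act_reverse by blast
    then have "act d \<theta> t (newton_poly (\<lambda>i. \<theta> (d - i)) 1) (d - d) =
       \<theta>s 1 * poly (newton_poly (\<lambda>i. \<theta> (d - i)) 1) (\<theta> (d - d)) +
       \<psi> 1 * poly (newton_poly (\<lambda>i. \<theta> (d - i)) (1 - 1)) (\<theta> (d - d))"
      using A[rule_format, of 1 d] d by simp
    then show ?thesis unfolding g1 by simp
  qed
  moreover have "[:- \<theta> d, 1:] = [:- \<theta> 0, 1:] + Polynomial.smult (\<theta> 0 - \<theta> d) 1" by simp
  then have "act d \<theta> t [:- \<theta> d, 1:] 0 = \<phi> 1 + (\<theta> 0 - \<theta> d) * \<theta>s 0"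
    by (simp only: act_add act_smult A0 A1)
  ultimately show ?thesis by (simp add: algebra_simps)
qed

lemma split_value_eq:
  assumes "n \<in> {1..d}"
  shows "split_value d \<theta> \<theta>s \<psi> n =
    \<psi> * (\<Sum>h = 0..n - 1. (\<theta> h - \<theta> (d - h)) / (\<theta> 0 - \<theta> d)) + (\<theta>s n - \<theta>s 0) * (\<theta> (n - 1) - \<theta> d)"
proof -
  have "{0..n - 1} = {..<n}" using assms by auto
  then show ?thesis by (simp add: split_value_def)
qed

lemma split_value_reverse_eq:
  fixes \<theta> :: "nat \<Rightarrow> 'a::field"
  assumes n: "n \<in> {1..d}"
  shows "split_value d (\<lambda>i. \<theta> (d - i)) \<theta>s \<psi> n =
    \<psi> * (\<Sum>h = 0..n - 1. (\<theta> h - \<theta> (d - h)) / (\<theta> 0 - \<theta> d)) + (\<theta>s n - \<theta>s 0) * (\<theta> (d - n + 1) - \<theta> 0)"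
proof -
  have "(\<theta> (d - h) - \<theta> (d - (d - h))) / (\<theta> (d - 0) - \<theta> (d - d)) = (\<theta> h - \<theta> (d - h)) / (\<theta> 0 - \<theta> d)"
    if "h \<le> n - 1" for h
  proof -
    have "d - (d - h) = h" using that n by auto
    then have "(\<theta> (d - h) - \<theta> (d - (d - h))) / (\<theta> (d - 0) - \<theta> (d - d)) =
      (- (\<theta> h - \<theta> (d - h))) / (- (\<theta> 0 - \<theta> d))" by simp
    then show ?thesis by (simp only: minus_divide_divide)
  qed
  moreover have "d - (n - 1) = d - n + 1" using n by auto
  ultimately show ?thesis unfolding split_value_eq[OF n] by simp
qed

section \<open>Tridiagonality versus parameter arrays\<close>

lemma band_imp_parameter_array:
  fixes \<theta> :: "nat \<Rightarrow> 'a::field"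
  assumes inj: "inj_on \<theta> {..d}" and injs: "inj_on \<theta>s {..d}"
    and split: "split_action d \<theta> \<theta>s \<phi> t" and band: "band d t"
    and nz: "\<And>n. n < d \<Longrightarrow> t n (Suc n) \<noteq> 0 \<and> t (Suc n) n \<noteq> 0"
  shows "\<exists>\<psi>. parameter_array d \<theta> \<theta>s \<phi> \<psi>"
proof -
  let ?r = "\<lambda>i. \<theta> (d - i)" and ?rt = "\<lambda>i j. t (d - i) (d - j)"
  obtain \<psi> where split': "split_action d ?r \<theta>s \<psi> ?rt"
    using band_imp_second_split[OF inj split band] by blast
  note inj' = inj_on_reverse[OF inj] and band' = band_reverse[OF band]
  have ne: "\<theta> i \<noteq> \<theta> j" "\<theta>s i \<noteq> \<theta>s j" if "i \<le> d" "j \<le> d" "i \<noteq> j" for i j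
    using inj injs that unfolding inj_on_def by auto
  obtain k where k: "\<And>n. n + 3 \<le> d \<Longrightarrow> \<theta> n - \<theta> (n + 3) = k * (\<theta> (n + 1) - \<theta> (n + 2)) \<and>
      \<theta>s n - \<theta>s (n + 3) = k * (\<theta>s (n + 1) - \<theta>s (n + 2))"
    using band_imp_recurrence[OF inj injs split band] by blast
  obtain k' where k': "\<And>n. n + 3 \<le> d \<Longrightarrow> ?r n - ?r (n + 3) = k' * (?r (n + 1) - ?r (n + 2)) \<and>
      \<theta>s n - \<theta>s (n + 3) = k' * (\<theta>s (n + 1) - \<theta>s (n + 2))"
    using band_imp_recurrence[OF inj' injs split' band'] by blast
  have nz_n: "\<phi> n \<noteq> 0 \<and> \<psi> n \<noteq> 0" if n: "n \<in> {1..d}" for n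
  proof -
    obtain m where m: "n = Suc m" "m < d" using n by (cases n) auto
    have "\<phi> n \<noteq> 0" using superdiagonal_nonzero_iff[OF inj split band, of m] nz[of m] m by simp
    moreover have "d - m = Suc (d - Suc m)" "d - Suc m < d" using m by auto
    then have "\<psi> n \<noteq> 0"
      using superdiagonal_nonzero_iff[OF inj' split' band', of m] nz[of "d - Suc m"] m by simp
    ultimately show ?thesis ..
  qed
  have psi1: "\<psi> 1 = \<phi> 1 + (\<theta>s 1 - \<theta>s 0) * (\<theta> d - \<theta> 0)" if "d > 0"
    using first_split_values[OF split that split'] .
  have 3: "\<phi> n = split_value d \<theta> \<theta>s (\<psi> 1) n" if n: "n \<in> {1..d}" for n
    using band_imp_split_value[OF inj injs split band k refl, of n] psi1 n by auto
  have 4: "\<psi> n = split_value d ?r \<theta>s (\<phi> 1) n" if n: "n \<in> {1..d}" for n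
  proof -
    have "\<psi> n = split_value d ?r \<theta>s (\<psi> 1 + (\<theta>s 1 - \<theta>s 0) * (?r d - ?r 0)) n"
      using band_imp_split_value[OF inj' injs split' band' k' refl, of n] n by auto
    moreover have "\<psi> 1 + (\<theta>s 1 - \<theta>s 0) * (?r d - ?r 0) = \<phi> 1"
      using psi1 n by (simp add: algebra_simps)
    ultimately show ?thesis by simp
  qed
  have 5: "(\<theta> (i - 2) - \<theta> (i + 1)) / (\<theta> (i - 1) - \<theta> i) = k \<and>
        (\<theta>s (i - 2) - \<theta>s (i + 1)) / (\<theta>s (i - 1) - \<theta>s i) = k" if i: "i \<in> {2..d - 1}" for i
  proof -
    define n where "n = i - 2"
    have "2 \<le> i" using i by simp
    then have n: "i = n + 2" unfolding n_def by simp
    have "n + 3 \<le> d" using i n by auto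
    with k[OF this] show ?thesis unfolding n using ne[of "n + 1" "n + 2"] by (simp add: eval_nat_numeral)
  qed
  have "parameter_array d \<theta> \<theta>s \<phi> \<psi>"
    unfolding parameter_array_def
  proof (intro conjI ballI exI[of _ k])
    fix n assume n: "n \<in> {1..d}"
    show "\<phi> n = \<psi> 1 * (\<Sum>h = 0..n - 1. (\<theta> h - \<theta> (d - h)) / (\<theta> 0 - \<theta> d)) +
        (\<theta>s n - \<theta>s 0) * (\<theta> (n - 1) - \<theta> d)"
      using 3[OF n] unfolding split_value_eq[OF n] .
    show "\<psi> n = \<phi> 1 * (\<Sum>h = 0..n - 1. (\<theta> h - \<theta> (d - h)) / (\<theta> 0 - \<theta> d)) +
        (\<theta>s n - \<theta>s 0) * (\<theta> (d - n + 1) - \<theta> 0)"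
      using 4[OF n] unfolding split_value_reverse_eq[OF n] .
  qed (use nz_n ne 5 in blast)+
  then show ?thesis by blast
qed

text \<open>(3) and (5) make \<open>t\<close> tridiagonal, which yields a second split form with
  some sequence \<open>\<psi>'\<close>. By the forward direction \<open>\<psi>'\<close> obeys (4),
  so it is the given \<open>\<psi>\<close>, and its nonvanishing makes the subdiagonal
  nonzero.\<close>

lemma parameter_array_imp_band:
  fixes \<theta> :: "nat \<Rightarrow> 'a::field"
  assumes par: "parameter_array d \<theta> \<theta>s \<phi> \<psi>"
    and split: "split_action d \<theta> \<theta>s (\<lambda>n. if n \<in> {1..d} then \<phi> n else 0) t"
  shows "band d t"
    and "\<And>n. n < d \<Longrightarrow> t n (Suc n) \<noteq> 0 \<and> t (Suc n) n \<noteq> 0"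
    and "split_action d (\<lambda>i. \<theta> (d - i)) \<theta>s (\<lambda>n. if n \<in> {1..d} then \<psi> n else 0) (\<lambda>i j. t (d - i) (d - j))"
proof -
  let ?r = "\<lambda>i. \<theta> (d - i)" and ?rt = "\<lambda>i j. t (d - i) (d - j)"
  let ?\<phi> = "\<lambda>n. if n \<in> {1..d} then \<phi> n else 0"
  have inj: "inj_on \<theta> {..d}" and injs: "inj_on \<theta>s {..d}"
    using par unfolding parameter_array_def inj_on_def by auto
  note inj' = inj_on_reverse[OF inj]
  have ne: "\<theta> i \<noteq> \<theta> j" "\<theta>s i \<noteq> \<theta>s j" if "i \<le> d" "j \<le> d" "i \<noteq> j" for i j
    using inj injs that unfolding inj_on_def by auto
  have phi: "\<phi> n = split_value d \<theta> \<theta>s (\<psi> 1) n" "\<psi> n = split_value d ?r \<theta>s (\<phi> 1) n"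
    if n: "n \<in> {1..d}" for n
    unfolding split_value_eq[OF n, of \<theta>] split_value_reverse_eq[OF n]
    using par n unfolding parameter_array_def by blast+
  have psi1: "\<psi> 1 = ?\<phi> 1 + (\<theta>s 1 - \<theta>s 0) * (\<theta> d - \<theta> 0)" if d: "d > 0"
  proof -
    have "\<theta> 0 - \<theta> d \<noteq> 0" using ne(1)[of 0 d] d by simp
    then show ?thesis using phi(1)[of 1] d by (simp add: split_value_def algebra_simps)
  qed
  obtain c where c: "\<And>i. i \<in> {2..d - 1} \<Longrightarrow> (\<theta> (i - 2) - \<theta> (i + 1)) / (\<theta> (i - 1) - \<theta> i) = c \<and>
        (\<theta>s (i - 2) - \<theta>s (i + 1)) / (\<theta>s (i - 1) - \<theta>s i) = c"
    using par unfolding parameter_array_def by blast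
  have k: "\<theta> n - \<theta> (n + 3) = c * (\<theta> (n + 1) - \<theta> (n + 2)) \<and>
      \<theta>s n - \<theta>s (n + 3) = c * (\<theta>s (n + 1) - \<theta>s (n + 2))" if n: "n + 3 \<le> d" for n
  proof -
    have "n + 2 \<in> {2..d - 1}" using n by auto
    from c[OF this] have "(\<theta> n - \<theta> (n + 3)) / (\<theta> (n + 1) - \<theta> (n + 2)) = c \<and>
        (\<theta>s n - \<theta>s (n + 3)) / (\<theta>s (n + 1) - \<theta>s (n + 2)) = c"
      by (simp add: eval_nat_numeral)
    moreover have "\<theta> (n + 1) - \<theta> (n + 2) \<noteq> 0" "\<theta>s (n + 1) - \<theta>s (n + 2) \<noteq> 0"
      using ne[of "n + 1" "n + 2"] n by auto
    moreover have "a = c * b" if "a / b = c" "b \<noteq> 0" for a b :: 'a using that by auto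
    ultimately show ?thesis by blast
  qed
  show band: "band d t"
  proof (cases "d = 0")
    case True
    then show ?thesis by (simp add: band_def)
  next
    case False
    show ?thesis
    proof (rule split_value_imp_band[OF inj split k psi1])
      fix n assume "n \<le> d"
      then show "?\<phi> n = split_value d \<theta> \<theta>s (\<psi> 1) n"
        using phi(1)[of n] by (cases "n = 0") auto
    qed (use False in auto)
  qed
  note band' = band_reverse[OF band]
  obtain \<psi>' where split': "split_action d ?r \<theta>s \<psi>' ?rt"
    using band_imp_second_split[OF inj split band] by blast
  obtain k' where k': "\<And>n. n + 3 \<le> d \<Longrightarrow> ?r n - ?r (n + 3) = k' * (?r (n + 1) - ?r (n + 2)) \<and>
      \<theta>s n - \<theta>s (n + 3) = k' * (\<theta>s (n + 1) - \<theta>s (n + 2))"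
    using band_imp_recurrence[OF inj' injs split' band'] by blast
  have psi': "\<psi>' n = (if n \<in> {1..d} then \<psi> n else 0)" if n: "n \<le> d" for n
  proof (cases "n = 0")
    case True
    then show ?thesis using split' by (simp add: split_action_def)
  next
    case False
    then have d: "d > 0" using n by simp
    have e1: "\<psi>' n = split_value d ?r \<theta>s (\<psi>' 1 + (\<theta>s 1 - \<theta>s 0) * (?r d - ?r 0)) n"
      using band_imp_split_value[OF inj' injs split' band' k' refl n] .
    have e2: "\<psi>' 1 + (\<theta>s 1 - \<theta>s 0) * (?r d - ?r 0) = \<phi> 1"
      using first_split_values[OF split d split'] d by (simp add: algebra_simps)
    have "n \<in> {1..d}" using n False by simp
    then show ?thesis unfolding e1 e2 using phi(2)[symmetric] by simp
  qed
  show second: "split_action d ?r \<theta>s (\<lambda>n. if n \<in> {1..d} then \<psi> n else 0) ?rt"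
    by (rule split_action_cong[OF split' psi'])
  fix n assume n: "n < d"
  have nz: "\<phi> i \<noteq> 0" "\<psi> i \<noteq> 0" if "i \<in> {1..d}" for i
    using par that unfolding parameter_array_def by blast+
  have "t n (Suc n) \<noteq> 0"
    using superdiagonal_nonzero_iff[OF inj split band, of n] nz(1)[of "Suc n"] n by simp
  moreover have "d - (d - Suc n) = Suc n" "d - Suc (d - Suc n) = n" using n by auto
  then have "t (Suc n) n \<noteq> 0"
    using superdiagonal_nonzero_iff[OF inj' second band', of "d - Suc n"] nz(2)[of "d - n"] n
    by (simp add: Suc_diff_Suc)
  ultimately show "t n (Suc n) \<noteq> 0 \<and> t (Suc n) n \<noteq> 0" ..
qed

section \<open>Diagonalisation and primitive idempotents\<close>

lemma index_mult_mat_sum: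
  assumes "A \<in> carrier_mat n n" "B \<in> carrier_mat n n" "i < n" "j < n"
  shows "(A * B) $$ (i, j) = (\<Sum>k<n. A $$ (i, k) * B $$ (k, j))"
  using assms by (simp add: scalar_prod_def lessThan_atLeast0)

lemma index_mult_mat_vec_sum:
  assumes "A \<in> carrier_mat n n" "v \<in> carrier_vec n" "i < n"
  shows "(A *\<^sub>v v) $ i = (\<Sum>k<n. A $$ (i, k) * v $ k)"
  using assms by (simp add: scalar_prod_def lessThan_atLeast0)

lemma index_smult_carrier: "v \<in> carrier_vec n \<Longrightarrow> i < n \<Longrightarrow> (c \<cdot>\<^sub>v v) $ i = c * v $ i"
  unfolding carrier_vec_def by simp

lemma sum_eq_single:
  assumes "finite S" "k \<in> S" "\<And>i. i \<in> S \<Longrightarrow> i \<noteq> k \<Longrightarrow> f i = (0 :: 'b::comm_monoid_add)"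
  shows "sum f S = f k"
  using assms by (subst sum.remove[of S k]) (auto intro!: sum.neutral)

text \<open>The columns of P are right eigenvectors and the rows of Q left eigenvectors; both are
  kept, as triangularity is proved for each. The product is nested to the right, the form that
  rewriting by associativity produces.\<close>

definition diagonalizes ::
    "nat \<Rightarrow> 'a::field mat \<Rightarrow> (nat \<Rightarrow> 'a) \<Rightarrow> 'a mat \<Rightarrow> 'a mat \<Rightarrow> bool" where
  "diagonalizes n A \<mu> P Q \<longleftrightarrow> P \<in> carrier_mat n n \<and> Q \<in> carrier_mat n n \<and>
     P * Q = 1\<^sub>m n \<and> Q * P = 1\<^sub>m n \<and> A = P * (mat_diag n \<mu> * Q)"

lemma diagonalizesD:
  assumes "diagonalizes n A \<mu> P Q"
  shows "P \<in> carrier_mat n n" "Q \<in> carrier_mat n n" "P * Q = 1\<^sub>m n" "Q * P = 1\<^sub>m n"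
    "A = P * (mat_diag n \<mu> * Q)" "A \<in> carrier_mat n n"
  using assms unfolding diagonalizes_def by (auto intro!: mult_carrier_mat)

lemma mult_inverse_cancel:
  fixes P :: "'a::field mat"
  assumes "P \<in> carrier_mat n n" "Q \<in> carrier_mat n n" "Q * P = 1\<^sub>m n" "X \<in> carrier_mat n n"
  shows "Q * (P * X) = X"
  using assms by (simp flip: assoc_mult_mat[of Q n n P n X n])

lemma diagonalizes_left:
  assumes "diagonalizes n A \<mu> P Q"
  shows "Q * A = mat_diag n \<mu> * Q"
proof -
  note D = diagonalizesD[OF assms]
  have "mat_diag n \<mu> * Q \<in> carrier_mat n n" using D(2) by (intro mult_carrier_mat) auto
  then show ?thesis using mult_inverse_cancel[OF D(1,2,4)] D(5) by simp
qed

lemma diagonalizes_right: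
  assumes "diagonalizes n A \<mu> P Q"
  shows "A * P = P * mat_diag n \<mu>"
proof -
  note D = diagonalizesD[OF assms]
  have "A * P = P * (mat_diag n \<mu> * (Q * P))"
    unfolding D(5) using D(1,2)
    by (simp add: assoc_mult_mat[of _ n n _ n _ n] mult_carrier_mat[of _ n n])
  then show ?thesis using D(1,4) by (simp add: right_mult_one_mat[of _ n n])
qed

lemma diagonalizesI_right:
  assumes "A \<in> carrier_mat n n" "P \<in> carrier_mat n n" "Q \<in> carrier_mat n n"
    "P * Q = 1\<^sub>m n" "A * P = P * mat_diag n \<mu>"
  shows "diagonalizes n A \<mu> P Q"
proof -
  have "A = A * (P * Q)" using assms(1,4) by (simp add: right_mult_one_mat[of _ n n])
  also have "\<dots> = P * mat_diag n \<mu> * Q" unfolding assms(5)[symmetric] by (rule assoc_mult_mat[OF assms(1-3), symmetric])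
  also have "\<dots> = P * (mat_diag n \<mu> * Q)" using assms by (simp add: assoc_mult_mat[of _ n n _ n _ n])
  finally show ?thesis
    unfolding diagonalizes_def using assms mat_mult_left_right_inverse by blast
qed

lemma diagonalizesI_left:
  assumes "A \<in> carrier_mat n n" "P \<in> carrier_mat n n" "Q \<in> carrier_mat n n"
    "P * Q = 1\<^sub>m n" "Q * A = mat_diag n \<mu> * Q"
  shows "diagonalizes n A \<mu> P Q"
proof -
  have "A = P * (Q * A)" using mult_inverse_cancel[OF assms(3,2,4,1)] by simp
  then show ?thesis
    unfolding diagonalizes_def using assms mat_mult_left_right_inverse by metis
qed

lemma transpose_mat_diag: "transpose_mat (mat_diag n \<mu>) = mat_diag n \<mu>"
  by (rule eq_matI) (auto simp: mat_diag_def)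

lemma diagonalizes_transpose:
  assumes "diagonalizes n A \<mu> P Q"
  shows "diagonalizes n (transpose_mat A) \<mu> (transpose_mat Q) (transpose_mat P)"
proof (rule diagonalizesI_right)
  note D = diagonalizesD[OF assms]
  show "transpose_mat A \<in> carrier_mat n n" "transpose_mat P \<in> carrier_mat n n"
    "transpose_mat Q \<in> carrier_mat n n" using D by auto
  show "transpose_mat Q * transpose_mat P = 1\<^sub>m n"
    using D by (simp flip: transpose_mult[of P n n Q n])
  have "transpose_mat A * transpose_mat Q = transpose_mat (Q * A)"
    by (rule transpose_mult[OF D(2,6), symmetric])
  also have "\<dots> = transpose_mat (mat_diag n \<mu> * Q)" unfolding diagonalizes_left[OF assms] ..
  also have "\<dots> = transpose_mat Q * mat_diag n \<mu>"
    using D(2) by (simp add: transpose_mult[of _ n n _ n] transpose_mat_diag)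
  finally show "transpose_mat A * transpose_mat Q = transpose_mat Q * mat_diag n \<mu>" .
qed

lemma diagonalizes_eigenvalues:
  assumes "diagonalizes n A \<mu> P Q"
  shows "{x. eigenvalue A x} = \<mu> ` {..<n}"
proof -
  note D = diagonalizesD[OF assms]
  show ?thesis
  proof (intro equalityI subsetI)
    fix x assume "x \<in> {x. eigenvalue A x}"
    then obtain v where v: "v \<in> carrier_vec n" "v \<noteq> 0\<^sub>v n" "A *\<^sub>v v = x \<cdot>\<^sub>v v"
      using D(6) unfolding eigenvalue_def eigenvector_def by auto
    let ?w = "Q *\<^sub>v v"
    have w: "?w \<in> carrier_vec n" using D(2) v(1) by simp
    have "P *\<^sub>v ?w = v" using D v(1) by (simp flip: assoc_mult_mat_vec[of P n n Q n v])
    moreover have "P *\<^sub>v 0\<^sub>v n = 0\<^sub>v n" using D(1) by (intro eq_vecI) (auto simp: scalar_prod_def)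
    ultimately have "?w \<noteq> 0\<^sub>v n" using v(2) by metis
    then obtain k where k: "k < n" "?w $ k \<noteq> 0" using w by (metis eq_vecI carrier_vecD index_zero_vec)
    have "mat_diag n \<mu> *\<^sub>v ?w = Q *\<^sub>v (A *\<^sub>v v)"
      using D v(1) diagonalizes_left[OF assms]
      by (simp flip: assoc_mult_mat_vec[of _ n n _ n])
    also have "\<dots> = x \<cdot>\<^sub>v ?w" unfolding v(3) using D(2) v(1) by (simp add: mult_mat_vec)
    finally have "(mat_diag n \<mu> *\<^sub>v ?w) $ k = x * ?w $ k" using index_smult_carrier[OF w k(1)] by simp
    moreover have "(mat_diag n \<mu> *\<^sub>v ?w) $ k = \<mu> k * ?w $ k"
      unfolding index_mult_mat_vec_sum[OF mat_diag_dim w k(1)]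
      using k(1) by (subst sum_eq_single[where k = k]) (auto simp: mat_diag_def)
    ultimately show "x \<in> \<mu> ` {..<n}" using k by auto
  next
    fix x assume "x \<in> \<mu> ` {..<n}"
    then obtain k where k: "k < n" "x = \<mu> k" by auto
    have "A *\<^sub>v col P k = x \<cdot>\<^sub>v col P k"
    proof -
      have "col (A * P) k = A *\<^sub>v col P k" by (rule col_mult2[OF D(6,1) k(1)])
      moreover have "col (P * mat_diag n \<mu>) k = x \<cdot>\<^sub>v col P k"
        unfolding mat_diag_mult_right[OF D(1)] using D(1) k by (intro eq_vecI) auto
      ultimately show ?thesis using diagonalizes_right[OF assms] by simp
    qed
    moreover have "col P k \<noteq> 0\<^sub>v n"
    proof
      assume "col P k = 0\<^sub>v n"
      moreover have "(Q * P) $$ (k, k) = row Q k \<bullet> col P k" using D(1,2) k by simp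
      ultimately have "(Q * P) $$ (k, k) = 0" by (simp add: scalar_prod_def)
      then show False using D(4) k by simp
    qed
    moreover have "col P k \<in> carrier_vec n" using D(1) by auto
    ultimately show "x \<in> {x. eigenvalue A x}"
      using D(6) unfolding eigenvalue_def eigenvector_def by auto
  qed
qed

lemma distinct_eigenvalues_diagonalizes:
  fixes A :: "'a::field mat"
  assumes A: "A \<in> carrier_mat n n" and inj: "inj_on \<mu> {..<n}"
    and ev: "\<And>i. i < n \<Longrightarrow> eigenvalue A (\<mu> i)"
  obtains P Q where "diagonalizes n A \<mu> P Q"
proof -
  have "\<exists>v. v \<in> carrier_vec n \<and> v \<noteq> 0\<^sub>v n \<and> A *\<^sub>v v = \<mu> i \<cdot>\<^sub>v v" if "i < n" for i
    using ev[OF that] A unfolding eigenvalue_def eigenvector_def by auto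
  then obtain v where v: "\<And>i. i < n \<Longrightarrow> v i \<in> carrier_vec n \<and> v i \<noteq> 0\<^sub>v n \<and> A *\<^sub>v v i = \<mu> i \<cdot>\<^sub>v v i"
    by metis
  define P where "P = mat n n (\<lambda>(a, i). v i $ a)"
  have P: "P \<in> carrier_mat n n" by (simp add: P_def)
  have AP: "A * P = P * mat_diag n \<mu>"
  proof (rule eq_matI)
    fix a i assume "a < dim_row (P * mat_diag n \<mu>)" "i < dim_col (P * mat_diag n \<mu>)"
    then have ai: "a < n" "i < n" using P by (auto simp: mat_diag_def)
    have "col P i = v i" using v[OF ai(2)] ai by (intro eq_vecI) (auto simp: P_def)
    then have "(A * P) $$ (a, i) = (A *\<^sub>v v i) $ a" using A P ai by simp
    also have "\<dots> = \<mu> i * v i $ a" using v[OF ai(2)] index_smult_carrier[OF _ ai(1), of "v i"] by simp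
    finally have "(A * P) $$ (a, i) = \<mu> i * v i $ a" .
    then show "(A * P) $$ (a, i) = (P * mat_diag n \<mu>) $$ (a, i)"
    proof -
      have "(P * mat_diag n \<mu>) $$ (a, i) = P $$ (a, i) * \<mu> i" using mat_diag_mult_right[OF P] ai by simp
      moreover have "P $$ (a, i) = v i $ a" using ai by (simp add: P_def)
      ultimately show ?thesis using \<open>(A * P) $$ (a, i) = \<mu> i * v i $ a\<close> by simp
    qed
  qed (use A P in \<open>auto simp: mat_diag_def\<close>)
  \<comment> \<open>Induction on the size of the support: applying diag(\<mu>) - \<mu>_k to the
    coefficients stays in the kernel and deletes coordinate k from the support, so the result is
    zero by induction. Then only coordinate k was present, and the k-th eigenvector would
    vanish.\<close>
  have ker: "c = 0\<^sub>v n" if "c \<in> carrier_vec n" "P *\<^sub>v c = 0\<^sub>v n" for c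
    using that
  proof (induction "card {k. k < n \<and> c $ k \<noteq> 0}" arbitrary: c rule: less_induct)
    case less
    show ?case
    proof (rule ccontr)
      assume "c \<noteq> 0\<^sub>v n"
      then obtain k where k: "k < n" "c $ k \<noteq> 0" using less.prems(1) by (metis eq_vecI carrier_vecD index_zero_vec)
      define c' where "c' = mat_diag n \<mu> *\<^sub>v c - \<mu> k \<cdot>\<^sub>v c"
      have Dc: "mat_diag n \<mu> *\<^sub>v c \<in> carrier_vec n" by (rule mult_mat_vec_carrier[OF mat_diag_dim less.prems(1)])
      have c': "c' \<in> carrier_vec n" using Dc less.prems(1) by (simp add: c'_def)
      have idx: "c' $ i = (\<mu> i - \<mu> k) * c $ i" if "i < n" for i
      proof -
        have "(mat_diag n \<mu> *\<^sub>v c) $ i = \<mu> i * c $ i"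
          unfolding index_mult_mat_vec_sum[OF mat_diag_dim less.prems(1) that]
          using that by (subst sum_eq_single[where k = i]) (auto simp: mat_diag_def)
        then show ?thesis using that less.prems(1) Dc by (simp add: c'_def algebra_simps)
      qed
      have "P *\<^sub>v (mat_diag n \<mu> *\<^sub>v c) = A *\<^sub>v (P *\<^sub>v c)"
        using P A less.prems(1) AP by (simp flip: assoc_mult_mat_vec[of _ n n _ n])
      also have "\<dots> = 0\<^sub>v n" unfolding less.prems(2) using A by (intro eq_vecI) (auto simp: scalar_prod_def)
      finally have "P *\<^sub>v (mat_diag n \<mu> *\<^sub>v c) = 0\<^sub>v n" .
      moreover have "P *\<^sub>v c' = P *\<^sub>v (mat_diag n \<mu> *\<^sub>v c) - P *\<^sub>v (\<mu> k \<cdot>\<^sub>v c)"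
        unfolding c'_def using less.prems(1) by (intro mult_minus_distrib_mat_vec[OF P Dc]) simp
      moreover have "P *\<^sub>v (\<mu> k \<cdot>\<^sub>v c) = \<mu> k \<cdot>\<^sub>v 0\<^sub>v n"
        unfolding mult_mat_vec[OF P less.prems(1)] less.prems(2) ..
      moreover have "\<mu> k \<cdot>\<^sub>v 0\<^sub>v n = 0\<^sub>v n" by (intro eq_vecI) auto
      ultimately have "P *\<^sub>v c' = 0\<^sub>v n" by simp
      moreover have "k \<notin> {i. i < n \<and> c' $ i \<noteq> 0}" using idx[OF k(1)] by simp
      moreover have "k \<in> {i. i < n \<and> c $ i \<noteq> 0}" using k by simp
      moreover have "{i. i < n \<and> c' $ i \<noteq> 0} \<subseteq> {i. i < n \<and> c $ i \<noteq> 0}"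
      proof
        fix i assume i: "i \<in> {i. i < n \<and> c' $ i \<noteq> 0}"
        then have "i < n" by simp
        then show "i \<in> {i. i < n \<and> c $ i \<noteq> 0}" using i idx[of i] by simp
      qed
      ultimately have "P *\<^sub>v c' = 0\<^sub>v n" and "{i. i < n \<and> c' $ i \<noteq> 0} \<subset> {i. i < n \<and> c $ i \<noteq> 0}"
        by (simp, blast)
      moreover from this(2) have "card {i. i < n \<and> c' $ i \<noteq> 0} < card {i. i < n \<and> c $ i \<noteq> 0}"
        by (intro psubset_card_mono) auto
      ultimately have "c' = 0\<^sub>v n" using less.hyps c' by blast
      then have 0: "c $ i = 0" if "i < n" "i \<noteq> k" for i
        using idx[OF that(1)] that k(1) inj unfolding inj_on_def by auto
      have "v k $ a = 0" if "a < n" for a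
      proof -
        have "(P *\<^sub>v c) $ a = v k $ a * c $ k"
          unfolding index_mult_mat_vec_sum[OF P less.prems(1) that]
          using k(1) that 0 by (subst sum_eq_single[where k = k]) (auto simp: P_def)
        then show ?thesis using less.prems(2) k that by simp
      qed
      then have "v k = 0\<^sub>v n" using v[OF k(1)] by (intro eq_vecI) auto
      with v[OF k(1)] show False by simp
    qed
  qed
  have "det P \<noteq> 0" using det_0_iff_vec_prod_zero_field[OF P] ker by auto
  then have "P \<in> Units (ring_mat TYPE('a) n ())" by (rule det_non_zero_imp_unit[OF P])
  then obtain Q where "Q \<in> carrier_mat n n" "P * Q = 1\<^sub>m n"
    unfolding Units_def ring_mat_def by auto
  then show ?thesis using that diagonalizesI_right[OF A P _ _ AP] by blast
qed

section \<open>Primitive idempotents in an eigenbasis\<close>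

lemma foldr_diagonalizes:
  assumes D: "diagonalizes n A \<mu> P Q"
  shows "foldr (\<lambda>j M. c j \<cdot>\<^sub>m (A - x j \<cdot>\<^sub>m 1\<^sub>m n) * M) js (1\<^sub>m n) =
    P * (mat_diag n (\<lambda>k. \<Prod>j\<leftarrow>js. c j * (\<mu> k - x j)) * Q)"
proof (induction js)
  case Nil
  show ?case using diagonalizesD[OF D] by simp
next
  case (Cons j js)
  note D' = diagonalizesD[OF D]
  let ?f = "\<lambda>k. \<Prod>j\<leftarrow>js. c j * (\<mu> k - x j)"
  have car: "P * (mat_diag n f * Q) \<in> carrier_mat n n" for f
    using D' by (intro mult_carrier_mat[of _ n n]) auto
  have "c j \<cdot>\<^sub>m (A - x j \<cdot>\<^sub>m 1\<^sub>m n) = P * (mat_diag n (\<lambda>k. c j * (\<mu> k - x j)) * Q)"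
  proof (rule eq_matI)
    fix a b assume "a < dim_row (P * (mat_diag n (\<lambda>k. c j * (\<mu> k - x j)) * Q))"
      "b < dim_col (P * (mat_diag n (\<lambda>k. c j * (\<mu> k - x j)) * Q))"
    then have ab: "a < n" "b < n" using D' by auto
    have idx: "(P * (mat_diag n f * Q)) $$ (a, b) = (\<Sum>k<n. P $$ (a, k) * (f k * Q $$ (k, b)))" for f
      using ab D' by (subst index_mult_mat_sum[of _ n]) (auto simp: mat_diag_mult_left[of Q n n])
    have one: "(1\<^sub>m n :: 'a mat) $$ (a, b) = (\<Sum>k<n. P $$ (a, k) * Q $$ (k, b))"
      using index_mult_mat_sum[OF D'(1,2) ab] D'(3) by simp
    have "(c j \<cdot>\<^sub>m (A - x j \<cdot>\<^sub>m 1\<^sub>m n)) $$ (a, b) =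
        c j * ((P * (mat_diag n \<mu> * Q)) $$ (a, b) - x j * (1\<^sub>m n :: 'a mat) $$ (a, b))"
      using ab D'(5,6) by simp
    also have "\<dots> = (\<Sum>k<n. P $$ (a, k) * ((c j * (\<mu> k - x j)) * Q $$ (k, b)))"
      unfolding idx one by (simp add: sum_distrib_left sum_subtractf[symmetric] algebra_simps)
    finally show "(c j \<cdot>\<^sub>m (A - x j \<cdot>\<^sub>m 1\<^sub>m n)) $$ (a, b) =
        (P * (mat_diag n (\<lambda>k. c j * (\<mu> k - x j)) * Q)) $$ (a, b)"
      unfolding idx .
  qed (use D' car in auto)
  then have "foldr (\<lambda>j M. c j \<cdot>\<^sub>m (A - x j \<cdot>\<^sub>m 1\<^sub>m n) * M) (j # js) (1\<^sub>m n) =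
      P * (mat_diag n (\<lambda>k. c j * (\<mu> k - x j)) * Q) * (P * (mat_diag n ?f * Q))"
    using Cons by simp
  also have "\<dots> = P * (mat_diag n (\<lambda>k. c j * (\<mu> k - x j)) * (Q * (P * (mat_diag n ?f * Q))))"
    using D'(1,2) car[of ?f]
    by (simp add: assoc_mult_mat[of _ n n _ n _ n] mult_carrier_mat[of _ n n])
  also have "Q * (P * (mat_diag n ?f * Q)) = mat_diag n ?f * Q"
    using D' by (intro mult_inverse_cancel[of _ n]) (auto intro: mult_carrier_mat[of _ n n])
  also have "P * (mat_diag n (\<lambda>k. c j * (\<mu> k - x j)) * (mat_diag n ?f * Q)) =
      P * (mat_diag n (\<lambda>k. \<Prod>j\<leftarrow>j # js. c j * (\<mu> k - x j)) * Q)"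
    using D' by (simp flip: assoc_mult_mat[of _ n n _ n _ n])
  finally show ?case .
qed

text \<open>The product is the Lagrange polynomial of \<open>x i\<close> evaluated at A, which in an
  eigenbasis becomes an indicator. The sequence \<open>x\<close> may list the eigenvalues in another
  order than \<open>\<mu>\<close>, hence the test \<open>\<mu> k = x i\<close> in place of
  \<open>k = i\<close>.\<close>

lemma primitive_idempotent_diagonalizes:
  assumes D: "diagonalizes (d + 1) A \<mu> P Q"
    and inj: "inj_on x {..d}" and sub: "\<mu> ` {..d} \<subseteq> x ` {..d}" and i: "i \<le> d"
  shows "primitive_idempotent d A x i =
    P * (mat_diag (d + 1) (\<lambda>k. if \<mu> k = x i then 1 else 0) * Q)"
proof -
  let ?js = "filter (\<lambda>j. j \<noteq> i) [0..<d + 1]"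
  have "(\<Prod>j\<leftarrow>?js. 1 / (x i - x j) * (\<mu> k - x j)) = (if \<mu> k = x i then 1 else 0)" if k: "k < d + 1" for k
  proof (cases "\<mu> k = x i")
    case True
    have "1 / (x i - x j) * (\<mu> k - x j) = 1" if "j \<in> set ?js" for j
    proof -
      have "x i - x j \<noteq> 0" using that i inj unfolding inj_on_def by (auto simp del: upt_Suc)
      then show ?thesis using True by simp
    qed
    then have "map (\<lambda>j. 1 / (x i - x j) * (\<mu> k - x j)) ?js = map (\<lambda>j. 1) ?js" by (intro map_cong) auto
    then show ?thesis using True by (simp add: map_replicate_const del: map_eq_conv)
  next
    case False
    obtain j where j: "j \<le> d" "\<mu> k = x j" using sub k by (metis atMost_iff image_subset_iff image_iff Suc_eq_plus1 less_Suc_eq_le)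
    then have "j \<in> set ?js" using False by (auto simp del: upt_Suc)
    then have "0 \<in> set (map (\<lambda>j. 1 / (x i - x j) * (\<mu> k - x j)) ?js)" using j(2) by force
    then show ?thesis using False by (simp only: prod_list_zero_iff if_False)
  qed
  then have "mat_diag (d + 1) (\<lambda>k. \<Prod>j\<leftarrow>?js. 1 / (x i - x j) * (\<mu> k - x j)) =
      mat_diag (d + 1) (\<lambda>k. if \<mu> k = x i then 1 else 0)"
    unfolding mat_diag_def by (intro cong_mat) auto
  then show ?thesis unfolding primitive_idempotent_def foldr_diagonalizes[OF D] by simp
qed

section \<open>Idempotent sequences as matrix patterns\<close>

definition irreducible_tridiagonal :: "nat \<Rightarrow> (nat \<Rightarrow> nat \<Rightarrow> 'a::zero) \<Rightarrow> bool" where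
  "irreducible_tridiagonal d M \<longleftrightarrow> band d M \<and> (\<forall>n<d. M n (Suc n) \<noteq> 0 \<and> M (Suc n) n \<noteq> 0)"

lemma irreducible_tridiagonal_altdef:
  "irreducible_tridiagonal d M \<longleftrightarrow> (\<forall>i\<le>d. \<forall>j\<le>d.
     (\<bar>int i - int j\<bar> > 1 \<longrightarrow> M i j = 0) \<and> (\<bar>int i - int j\<bar> = 1 \<longrightarrow> M i j \<noteq> 0))" (is "?L \<longleftrightarrow> ?R")
proof
  assume L: ?L
  show ?R
  proof (intro allI impI conjI)
    fix i j assume ij: "i \<le> d" "j \<le> d"
    {
      assume "\<bar>int i - int j\<bar> > 1"
      then have "i + 1 < j \<or> j + 1 < i" by linarith
      then show "M i j = 0" using L ij unfolding irreducible_tridiagonal_def band_def by blast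
    next
      assume "\<bar>int i - int j\<bar> = 1"
      then have "j = Suc i \<or> i = Suc j" by linarith
      then show "M i j \<noteq> 0" using L ij unfolding irreducible_tridiagonal_def by (auto simp: Suc_le_eq)
    }
  qed
next
  assume R: ?R
  have "M i j = 0" if "i \<le> d" "j \<le> d" "i + 1 < j \<or> j + 1 < i" for i j
  proof -
    have "\<bar>int i - int j\<bar> > 1" using that by linarith
    then show ?thesis using R that by blast
  qed
  moreover have "M n (Suc n) \<noteq> 0 \<and> M (Suc n) n \<noteq> 0" if "n < d" for n
    using R[rule_format, of n "Suc n"] R[rule_format, of "Suc n" n] that by simp
  ultimately show ?L unfolding irreducible_tridiagonal_def band_def by blast
qed

text \<open>Between the invertible outer factors remains a matrix whose only possible nonzero entry
  is the (a, b) entry of X in the eigenbasis. Conditions on products of idempotents thus become a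
  pattern of matrix entries.\<close>

lemma idempotent_sandwich:
  fixes X :: "'a::field mat"
  assumes P: "P \<in> carrier_mat n n" and Q: "Q \<in> carrier_mat n n" and QP: "Q * P = 1\<^sub>m n"
    and X: "X \<in> carrier_mat n n" and a: "a < n" and b: "b < n"
  shows "P * (mat_diag n (\<lambda>k. if k = a then 1 else 0) * Q) * X *
      (P * (mat_diag n (\<lambda>k. if k = b then 1 else 0) * Q)) = 0\<^sub>m n n \<longleftrightarrow> (Q * (X * P)) $$ (a, b) = 0"
proof -
  let ?D = "\<lambda>a. mat_diag n (\<lambda>k. if k = a then 1 else (0::'a))"
  let ?Y = "Q * (X * P)"
  define Z where "Z = ?D a * (?Y * ?D b)"
  note car = mult_carrier_mat[of _ n n _ n]
  have Y: "?Y \<in> carrier_mat n n" using P Q X by (intro car)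
  have Z: "Z \<in> carrier_mat n n" unfolding Z_def by (rule car[OF mat_diag_dim car[OF Y mat_diag_dim]])
  have idx: "Z $$ (i, j) = (if i = a \<and> j = b then ?Y $$ (a, b) else 0)" if "i < n" "j < n" for i j
  proof -
    have "?Y * ?D b \<in> carrier_mat n n" by (rule car[OF Y mat_diag_dim])
    then have "Z $$ (i, j) = (if i = a then 1 else 0) * (?Y * ?D b) $$ (i, j)"
      unfolding Z_def using that by (subst mat_diag_mult_left) auto
    also have "(?Y * ?D b) $$ (i, j) = ?Y $$ (i, j) * (if j = b then 1 else 0)"
      using that by (subst mat_diag_mult_right[OF Y]) auto
    finally show ?thesis by simp
  qed
  have E: "P * (?D a * Q) * X * (P * (?D b * Q)) = P * (Z * Q)"
    unfolding Z_def using P Q X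
    by (simp add: assoc_mult_mat[of _ n n _ n _ n] car)
  have "P * (Z * Q) = 0\<^sub>m n n \<longleftrightarrow> Z = 0\<^sub>m n n"
  proof
    assume 0: "P * (Z * Q) = 0\<^sub>m n n"
    have "Z = Z * (Q * P)" using Z QP by simp
    also have "\<dots> = Z * Q * P" using Z P Q by (simp add: assoc_mult_mat[of _ n n _ n _ n])
    also have "Z * Q = Q * (P * (Z * Q))" using mult_inverse_cancel[OF P Q QP car[OF Z Q]] by simp
    finally show "Z = 0\<^sub>m n n" unfolding 0 using P Q by simp
  next
    assume "Z = 0\<^sub>m n n"
    then show "P * (Z * Q) = 0\<^sub>m n n" using P Q by simp
  qed
  also have "Z = 0\<^sub>m n n \<longleftrightarrow> ?Y $$ (a, b) = 0"
  proof
    assume "Z = 0\<^sub>m n n"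
    then show "?Y $$ (a, b) = 0" using idx[OF a b] a b by simp
  next
    assume "?Y $$ (a, b) = 0"
    then show "Z = 0\<^sub>m n n" using idx Z by (intro eq_matI) auto
  qed
  finally show ?thesis unfolding E .
qed

lemma eigenvalue_sequence_permutation:
  fixes A :: "'a::field mat"
  assumes D: "diagonalizes (d + 1) A \<mu> P Q" and inj: "inj_on \<mu> {..d}"
    and E: "eigenvalue_sequence d A E x"
  obtains \<rho> where "bij_betw \<rho> {..d} {..d}" "\<And>i. i \<le> d \<Longrightarrow> x i = \<mu> (\<rho> i)"
    "\<And>i. i \<le> d \<Longrightarrow> E i = P * (mat_diag (d + 1) (\<lambda>k. if k = \<rho> i then 1 else 0) * Q)"
proof -
  have x: "bij_betw x {..d} (\<mu> ` {..d})"
    using E unfolding eigenvalue_sequence_def diagonalizes_eigenvalues[OF D]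
    by (simp add: atLeast0AtMost lessThan_Suc_atMost)
  define \<rho> where "\<rho> = inv_into {..d} \<mu> \<circ> x"
  have "bij_betw (inv_into {..d} \<mu>) (\<mu> ` {..d}) {..d}"
    using inj by (intro bij_betw_inv_into) (simp add: bij_betw_def)
  with x have bij: "bij_betw \<rho> {..d} {..d}" unfolding \<rho>_def by (rule bij_betw_trans)
  have x\<rho>: "x i = \<mu> (\<rho> i)" if "i \<le> d" for i
  proof -
    have "x i \<in> \<mu> ` {..d}" using x that by (auto simp: bij_betw_def)
    then show ?thesis unfolding \<rho>_def by (simp add: f_inv_into_f)
  qed
  have "E i = P * (mat_diag (d + 1) (\<lambda>k. if k = \<rho> i then 1 else 0) * Q)" if i: "i \<le> d" for i
  proof -
    have \<rho>i: "\<rho> i \<le> d" using bij i by (auto simp: bij_betw_def)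
    have "E i = primitive_idempotent d A x i" using E i unfolding eigenvalue_sequence_def by blast
    also have "\<dots> = P * (mat_diag (d + 1) (\<lambda>k. if \<mu> k = x i then 1 else 0) * Q)"
      using x i by (intro primitive_idempotent_diagonalizes[OF D]) (auto simp: bij_betw_def)
    also have "mat_diag (d + 1) (\<lambda>k. if \<mu> k = x i then 1 else (0::'a)) =
        mat_diag (d + 1) (\<lambda>k. if k = \<rho> i then 1 else 0)"
      unfolding mat_diag_def x\<rho>[OF i] using inj \<rho>i by (intro cong_mat) (auto simp: inj_on_def)
    finally show ?thesis .
  qed
  with bij x\<rho> that show ?thesis by blast
qed

lemma idempotent_sequence_pattern:
  fixes A As :: "'a::field mat"
  assumes D: "diagonalizes (d + 1) A \<mu> P Q" and inj: "inj_on \<mu> {..d}"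
    and As: "As \<in> carrier_mat (d + 1) (d + 1)" and I: "idempotent_sequence d A As E"
  obtains \<rho> where "bij_betw \<rho> {..d} {..d}"
    "irreducible_tridiagonal d (\<lambda>i j. (Q * (As * P)) $$ (\<rho> i, \<rho> j))"
proof -
  obtain x where "eigenvalue_sequence d A E x" using I unfolding idempotent_sequence_def by blast
  then obtain \<rho> where \<rho>: "bij_betw \<rho> {..d} {..d}"
    "\<And>i. i \<le> d \<Longrightarrow> E i = P * (mat_diag (d + 1) (\<lambda>k. if k = \<rho> i then 1 else 0) * Q)"
    using eigenvalue_sequence_permutation[OF D inj] by metis
  have "E i * As * E j = 0\<^sub>m (d + 1) (d + 1) \<longleftrightarrow> (Q * (As * P)) $$ (\<rho> i, \<rho> j) = 0" if "i \<le> d" "j \<le> d" for i j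
  proof -
    have "\<rho> i < d + 1" "\<rho> j < d + 1" using \<rho>(1) that by (auto simp: bij_betw_def less_Suc_eq_le)
    then show ?thesis
      unfolding \<rho>(2)[OF that(1)] \<rho>(2)[OF that(2)] using diagonalizesD[OF D] As
      by (intro idempotent_sandwich) auto
  qed
  then have "irreducible_tridiagonal d (\<lambda>i j. (Q * (As * P)) $$ (\<rho> i, \<rho> j))"
    using I unfolding irreducible_tridiagonal_altdef idempotent_sequence_def by simp
  with \<rho>(1) that show ?thesis by blast
qed

lemma diagonalizes_eigenvalue_sequence:
  assumes D: "diagonalizes (d + 1) A \<mu> P Q" and inj: "inj_on \<mu> {..d}"
  shows "eigenvalue_sequence d A (primitive_idempotent d A \<mu>) \<mu>"
  using inj unfolding eigenvalue_sequence_def diagonalizes_eigenvalues[OF D]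
  by (simp add: atLeast0AtMost lessThan_Suc_atMost bij_betw_def)

lemma diagonalizes_idempotent:
  fixes A :: "'a::field mat"
  assumes D: "diagonalizes (d + 1) A \<mu> P Q" and inj: "inj_on \<mu> {..d}" and i: "i \<le> d"
  shows "primitive_idempotent d A \<mu> i = P * (mat_diag (d + 1) (\<lambda>k. if k = i then 1 else 0) * Q)"
proof -
  have "mat_diag (d + 1) (\<lambda>k. if \<mu> k = \<mu> i then 1 else (0::'a)) =
        mat_diag (d + 1) (\<lambda>k. if k = i then 1 else 0)"
    unfolding mat_diag_def using inj i by (intro cong_mat) (auto simp: inj_on_def)
  then show ?thesis using primitive_idempotent_diagonalizes[OF D inj _ i] by simp
qed

lemma pattern_imp_idempotent_sequence:
  fixes A As :: "'a::field mat"
  assumes D: "diagonalizes (d + 1) A \<mu> P Q" and inj: "inj_on \<mu> {..d}"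
    and As: "As \<in> carrier_mat (d + 1) (d + 1)"
    and T: "irreducible_tridiagonal d (\<lambda>i j. (Q * (As * P)) $$ (i, j))"
  shows "idempotent_sequence d A As (primitive_idempotent d A \<mu>)"
proof -
  let ?E = "primitive_idempotent d A \<mu>"
  have "?E i * As * ?E j = 0\<^sub>m (d + 1) (d + 1) \<longleftrightarrow> (Q * (As * P)) $$ (i, j) = 0" if "i \<le> d" "j \<le> d" for i j
    unfolding diagonalizes_idempotent[OF D inj that(1)] diagonalizes_idempotent[OF D inj that(2)]
    using diagonalizesD[OF D] As that by (intro idempotent_sandwich) auto
  moreover have "eigenvalue_sequence d A ?E \<mu>"
    using D inj by (rule diagonalizes_eigenvalue_sequence)
  ultimately show ?thesis
    using T unfolding irreducible_tridiagonal_altdef idempotent_sequence_def by auto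
qed

section \<open>Bidiagonal matrices\<close>

text \<open>By injectivity each step is +1 or -1 and may not undo the step before it, so all steps
  have the same sign; the range \<open>{..d}\<close> then fixes the starting value.\<close>

lemma path_permutation:
  fixes \<rho> :: "nat \<Rightarrow> nat"
  assumes bij: "bij_betw \<rho> {..d} {..d}"
    and step: "\<And>k. k < d \<Longrightarrow> \<rho> (Suc k) \<le> \<rho> k + 1 \<and> \<rho> k \<le> \<rho> (Suc k) + 1"
  shows "(\<forall>k\<le>d. \<rho> k = k) \<or> (\<forall>k\<le>d. \<rho> k = d - k)"
proof (cases "d = 0")
  case True
  then show ?thesis using bij by (auto simp: bij_betw_def)
next
  case False
  have ne: "\<rho> i \<noteq> \<rho> j" if "i \<le> d" "j \<le> d" "i \<noteq> j" for i j
    using bij that unfolding bij_betw_def inj_on_def by auto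
  have le: "\<rho> i \<le> d" if "i \<le> d" for i using bij that by (auto simp: bij_betw_def)
  have cases: "\<rho> (Suc k) = \<rho> k + 1 \<or> \<rho> k = \<rho> (Suc k) + 1" if "k < d" for k
    using step[OF that] ne[of k "Suc k"] that by linarith
  show ?thesis
  proof (cases "\<rho> 1 = \<rho> 0 + 1")
    case True
    have up: "\<rho> (Suc k) = \<rho> k + 1" if "k < d" for k
      using that
    proof (induction k)
      case (Suc k)
      have "\<rho> (Suc (Suc k)) \<noteq> \<rho> k" using ne[of "Suc (Suc k)" k] Suc.prems by simp
      then show ?case using cases[OF Suc.prems] Suc by linarith
    qed (use True in simp)
    have add: "\<rho> k = \<rho> 0 + k" if "k \<le> d" for k using that by (induction k) (auto simp: up)
    then have "\<rho> 0 = 0" using add[of d] le[of d] by linarith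
    then have "\<rho> k = k" if "k \<le> d" for k using add[OF that] by linarith
    then show ?thesis by blast
  next
    case down0: False
    have down: "\<rho> k = \<rho> (Suc k) + 1" if "k < d" for k
      using that
    proof (induction k)
      case 0
      then show ?case using down0 cases[of 0] by simp
    next
      case (Suc k)
      have "\<rho> (Suc (Suc k)) \<noteq> \<rho> k" using ne[of "Suc (Suc k)" k] Suc.prems by simp
      then show ?case using cases[OF Suc.prems] Suc by linarith
    qed
    have sum: "\<rho> k + k = \<rho> 0" if "k \<le> d" for k
      using that
    proof (induction k)
      case (Suc k)
      then show ?case using down[of k] by simp
    qed simp
    have "\<rho> 0 = d" using sum[of d] le[of 0] by simp
    then have "\<rho> k = d - k" if "k \<le> d" for k using sum[OF that] that by linarith
    then show ?thesis by blast
  qed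
qed

lemma lower_bidiagonal_entry:
  "lower_bidiagonal A \<Longrightarrow> A \<in> carrier_mat n n \<Longrightarrow> i < n \<Longrightarrow> j < n \<Longrightarrow> i \<noteq> j \<Longrightarrow> i \<noteq> Suc j \<Longrightarrow> A $$ (i, j) = 0"
  unfolding lower_bidiagonal_def by auto

lemma upper_bidiagonal_entry:
  "upper_bidiagonal A \<Longrightarrow> A \<in> carrier_mat n n \<Longrightarrow> i < n \<Longrightarrow> j < n \<Longrightarrow> i \<noteq> j \<Longrightarrow> j \<noteq> Suc i \<Longrightarrow> A $$ (i, j) = 0"
  unfolding upper_bidiagonal_def lower_bidiagonal_def by auto

lemma lower_bidiagonal_right_eigenvector:
  fixes A :: "'a::field mat"
  assumes A: "A \<in> carrier_mat n n" "lower_bidiagonal A" and inj: "inj_on (\<lambda>i. A $$ (i, i)) {..<n}"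
    and i: "i < n" and ev: "\<And>h. h < n \<Longrightarrow> (\<Sum>k<n. A $$ (h, k) * v k) = A $$ (i, i) * v h"
  shows "h < i \<Longrightarrow> v h = 0"
proof (induction h rule: less_induct)
  case (less h)
  have h: "h < n" using less.prems i by simp
  have "(\<Sum>k<n. A $$ (h, k) * v k) = A $$ (h, h) * v h"
  proof (rule sum_eq_single)
    fix k assume k: "k \<in> {..<n}" "k \<noteq> h"
    show "A $$ (h, k) * v k = 0"
      using lower_bidiagonal_entry[OF A(2,1) h, of k] less.IH[of k] less.prems k by (cases "h = Suc k") auto
  qed (use h in auto)
  then have "(A $$ (h, h) - A $$ (i, i)) * v h = 0" using ev[OF h] by (auto simp: algebra_simps)
  moreover have "A $$ (h, h) - A $$ (i, i) \<noteq> 0" using inj h i less.prems unfolding inj_on_def by auto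
  ultimately show ?case by simp
qed

lemma lower_bidiagonal_left_eigenvector:
  fixes A :: "'a::field mat"
  assumes A: "A \<in> carrier_mat n n" "lower_bidiagonal A" and inj: "inj_on (\<lambda>i. A $$ (i, i)) {..<n}"
    and i: "i < n" and ev: "\<And>h. h < n \<Longrightarrow> (\<Sum>k<n. v k * A $$ (k, h)) = A $$ (i, i) * v h"
  shows "h < n \<Longrightarrow> i < h \<Longrightarrow> v h = 0"
proof (induction "n - h" arbitrary: h rule: less_induct)
  case (less h)
  have "(\<Sum>k<n. v k * A $$ (k, h)) = v h * A $$ (h, h)"
  proof (rule sum_eq_single)
    fix k assume k: "k \<in> {..<n}" "k \<noteq> h"
    show "v k * A $$ (k, h) = 0"
      using lower_bidiagonal_entry[OF A(2,1) _ less.prems(1), of k] less.hyps[of k] less.prems k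
      by (cases "k = Suc h") auto
  qed (use less.prems in auto)
  then have "(A $$ (h, h) - A $$ (i, i)) * v h = 0" using ev[OF less.prems(1)] by (auto simp: algebra_simps)
  moreover have "A $$ (h, h) - A $$ (i, i) \<noteq> 0"
    using inj_onD[OF inj, of h i] i less.prems by auto
  ultimately show ?case by simp
qed

text \<open>Substitution along the bidiagonal equations: a right eigenvector for the i-th diagonal
  entry vanishes before index i, a left one after it. With both factors lower triangular, the
  diagonal of Q P is the product of the diagonals.\<close>

lemma lower_bidiagonal_diagonalizes:
  fixes A :: "'a::field mat"
  assumes L: "lower_bidiagonal A" and inj: "inj_on (\<lambda>i. A $$ (i, i)) {..<n}"
    and D: "diagonalizes n A (\<lambda>i. A $$ (i, i)) P Q"
  shows "\<And>i j. i < j \<Longrightarrow> j < n \<Longrightarrow> P $$ (i, j) = 0"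
    and "\<And>i j. i < j \<Longrightarrow> j < n \<Longrightarrow> Q $$ (i, j) = 0"
    and "\<And>i. i < n \<Longrightarrow> Q $$ (i, i) * P $$ (i, i) = 1"
proof -
  note D' = diagonalizesD[OF D]
  show P0: "P $$ (i, j) = 0" if "i < j" "j < n" for i j
  proof (rule lower_bidiagonal_right_eigenvector[OF D'(6) L inj that(2) _ that(1), of "\<lambda>h. P $$ (h, j)"])
    fix h assume h: "h < n"
    have "(A * P) $$ (h, j) = (\<Sum>k<n. A $$ (h, k) * P $$ (k, j))"
      using index_mult_mat_sum[OF D'(6,1) h that(2)] .
    moreover have "(P * mat_diag n (\<lambda>i. A $$ (i, i))) $$ (h, j) = P $$ (h, j) * A $$ (j, j)"
      using mat_diag_mult_right[OF D'(1)] h that by simp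
    ultimately show "(\<Sum>k<n. A $$ (h, k) * P $$ (k, j)) = A $$ (j, j) * P $$ (h, j)"
      using diagonalizes_right[OF D] by (simp add: mult.commute)
  qed
  show Q0: "Q $$ (i, j) = 0" if "i < j" "j < n" for i j
  proof (rule lower_bidiagonal_left_eigenvector[OF D'(6) L inj _ _ that(2,1), of "\<lambda>h. Q $$ (i, h)"])
    show i: "i < n" using that by simp
    fix h assume h: "h < n"
    have "(Q * A) $$ (i, h) = (\<Sum>k<n. Q $$ (i, k) * A $$ (k, h))"
      using index_mult_mat_sum[OF D'(2,6) i h] .
    moreover have "(mat_diag n (\<lambda>i. A $$ (i, i)) * Q) $$ (i, h) = A $$ (i, i) * Q $$ (i, h)"
      using mat_diag_mult_left[OF D'(2)] h i by simp
    ultimately show "(\<Sum>k<n. Q $$ (i, k) * A $$ (k, h)) = A $$ (i, i) * Q $$ (i, h)"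
      using diagonalizes_left[OF D] by simp
  qed
  fix i assume i: "i < n"
  have "(Q * P) $$ (i, i) = (\<Sum>k<n. Q $$ (i, k) * P $$ (k, i))"
    using index_mult_mat_sum[OF D'(2,1) i i] .
  also have "\<dots> = Q $$ (i, i) * P $$ (i, i)"
  proof (rule sum_eq_single)
    fix k assume "k \<in> {..<n}" "k \<noteq> i"
    then show "Q $$ (i, k) * P $$ (k, i) = 0" using P0[of k i] Q0[of i k] i by (cases "k < i") auto
  qed (use i in auto)
  finally show "Q $$ (i, i) * P $$ (i, i) = 1" using D'(4) i by simp
qed

text \<open>Lower triangular times upper bidiagonal times lower triangular reaches at most one place
  above the diagonal. There only \<open>As $$ (i, Suc i)\<close> survives, multiplied by diagonal
  entries of Q and P, which are nonzero.\<close>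

lemma bidiagonal_Hessenberg:
  fixes A As :: "'a::field mat"
  assumes L: "lower_bidiagonal A" and inj: "inj_on (\<lambda>i. A $$ (i, i)) {..<n}"
    and D: "diagonalizes n A (\<lambda>i. A $$ (i, i)) P Q"
    and As: "As \<in> carrier_mat n n" and U: "upper_bidiagonal As"
  shows "\<And>i j. i + 1 < j \<Longrightarrow> j < n \<Longrightarrow> (Q * (As * P)) $$ (i, j) = 0"
    and "\<And>i. Suc i < n \<Longrightarrow> (Q * (As * P)) $$ (i, Suc i) \<noteq> 0 \<longleftrightarrow> As $$ (i, Suc i) \<noteq> 0"
proof -
  note D' = diagonalizesD[OF D] and T = lower_bidiagonal_diagonalizes[OF L inj D]
  have AsP: "As * P \<in> carrier_mat n n" using As D' by simp
  have AsP0: "(As * P) $$ (h, j) = (if j = Suc h then As $$ (h, j) * P $$ (j, j) else 0)"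
    if "h < j" "j < n" for h j
  proof -
    have h: "h < n" using that by simp
    have "(As * P) $$ (h, j) = (\<Sum>k<n. As $$ (h, k) * P $$ (k, j))"
      by (rule index_mult_mat_sum[OF As D'(1) h that(2)])
    also have "\<dots> = As $$ (h, j) * P $$ (j, j)"
    proof (rule sum_eq_single)
      fix k assume k: "k \<in> {..<n}" "k \<noteq> j"
      show "As $$ (h, k) * P $$ (k, j) = 0"
      proof (cases "k < j")
        case True
        then show ?thesis using T(1)[OF True that(2)] by simp
      next
        case False
        then show ?thesis using upper_bidiagonal_entry[OF U As h, of k] k that by auto
      qed
    qed (use that in auto)
    finally show ?thesis using upper_bidiagonal_entry[OF U As h that(2)] that by auto
  qed
  have sum: "(Q * (As * P)) $$ (i, j) = Q $$ (i, i) * (As * P) $$ (i, j)" if ij: "i < j" "j < n" for i j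
  proof -
    have "(Q * (As * P)) $$ (i, j) = (\<Sum>k<n. Q $$ (i, k) * (As * P) $$ (k, j))"
      using ij by (intro index_mult_mat_sum[OF D'(2) AsP]) auto
    also have "\<dots> = Q $$ (i, i) * (As * P) $$ (i, j)"
    proof (rule sum_eq_single)
      fix k assume k: "k \<in> {..<n}" "k \<noteq> i"
      show "Q $$ (i, k) * (As * P) $$ (k, j) = 0"
        using T(2)[of i k] AsP0[of k j] k ij by (cases "i < k") auto
    qed (use ij in auto)
    finally show ?thesis .
  qed
  show "(Q * (As * P)) $$ (i, j) = 0" if "i + 1 < j" "j < n" for i j
    using sum[of i j] AsP0[of i j] that by simp
  show "(Q * (As * P)) $$ (i, Suc i) \<noteq> 0 \<longleftrightarrow> As $$ (i, Suc i) \<noteq> 0" if "Suc i < n" for i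
  proof -
    have "Q $$ (i, i) \<noteq> 0" "P $$ (Suc i, Suc i) \<noteq> 0" using T(3)[of i] T(3)[of "Suc i"] that by auto
    then show ?thesis using sum[of i "Suc i"] AsP0[of i "Suc i"] that by simp
  qed
qed

text \<open>
  A Hessenberg matrix that becomes irreducible tridiagonal under a reordering of the basis was so
  already: consecutive positions in the new order are adjacent in the old one.
\<close>

lemma bidiagonal_pattern:
  fixes A As :: "'a::field mat"
  assumes L: "lower_bidiagonal A" and inj: "inj_on (\<lambda>i. A $$ (i, i)) {..<d + 1}"
    and D: "diagonalizes (d + 1) A (\<lambda>i. A $$ (i, i)) P Q"
    and As: "As \<in> carrier_mat (d + 1) (d + 1)" and U: "upper_bidiagonal As"
    and \<rho>: "bij_betw \<rho> {..d} {..d}" "irreducible_tridiagonal d (\<lambda>i j. (Q * (As * P)) $$ (\<rho> i, \<rho> j))"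
  shows "irreducible_tridiagonal d (\<lambda>i j. (Q * (As * P)) $$ (i, j))"
    and "\<And>i. i < d \<Longrightarrow> As $$ (i, Suc i) \<noteq> 0"
proof -
  let ?M = "\<lambda>i j. (Q * (As * P)) $$ (i, j)"
  note H = bidiagonal_Hessenberg[OF L inj D As U]
  have le: "\<rho> i \<le> d" if "i \<le> d" for i using \<rho>(1) that by (auto simp: bij_betw_def)
  have "\<rho> (Suc k) \<le> \<rho> k + 1 \<and> \<rho> k \<le> \<rho> (Suc k) + 1" if k: "k < d" for k
  proof -
    have "?M (\<rho> k) (\<rho> (Suc k)) \<noteq> 0" "?M (\<rho> (Suc k)) (\<rho> k) \<noteq> 0"
      using \<rho>(2) k unfolding irreducible_tridiagonal_def by blast+
    then show ?thesis
      using H(1)[of "\<rho> k" "\<rho> (Suc k)"] H(1)[of "\<rho> (Suc k)" "\<rho> k"] le[of k] le[of "Suc k"] k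
      by (metis Suc_leI leI less_Suc_eq_le less_imp_le_nat Suc_eq_plus1)
  qed
  then consider "\<And>k. k \<le> d \<Longrightarrow> \<rho> k = k" | "\<And>k. k \<le> d \<Longrightarrow> \<rho> k = d - k"
    using path_permutation[OF \<rho>(1)] by blast
  then show T: "irreducible_tridiagonal d ?M"
  proof cases
    case 1
    then show ?thesis using \<rho>(2) unfolding irreducible_tridiagonal_altdef by simp
  next
    case 2
    show ?thesis
      unfolding irreducible_tridiagonal_altdef
    proof (intro allI impI)
      fix i j assume ij: "i \<le> d" "j \<le> d"
      have "\<rho> (d - i) = i" "\<rho> (d - j) = j" using 2[of "d - i"] 2[of "d - j"] ij by auto
      moreover have "\<bar>int (d - i) - int (d - j)\<bar> = \<bar>int i - int j\<bar>" using ij by linarith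
      ultimately show "(\<bar>int i - int j\<bar> > 1 \<longrightarrow> ?M i j = 0) \<and> (\<bar>int i - int j\<bar> = 1 \<longrightarrow> ?M i j \<noteq> 0)"
        using \<rho>(2)[unfolded irreducible_tridiagonal_altdef, rule_format, of "d - i" "d - j"] by auto
    qed
  qed
  show "As $$ (i, Suc i) \<noteq> 0" if "i < d" for i
    using H(2)[of i] T that unfolding irreducible_tridiagonal_def by auto
qed

lemma sum_eq_two:
  assumes "finite S" "k \<in> S" "l \<in> S" "k \<noteq> l" "\<And>i. i \<in> S \<Longrightarrow> i \<noteq> k \<Longrightarrow> i \<noteq> l \<Longrightarrow> f i = (0 :: 'b::comm_monoid_add)"
  shows "sum f S = f k + f l"
proof -
  have "sum f S = f k + sum f (S - {k})" using assms(1,2) by (rule sum.remove)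
  also have "sum f (S - {k}) = f l" using assms by (intro sum_eq_single) auto
  finally show ?thesis .
qed

lemma diagonalizes_cong:
  "diagonalizes n A \<mu> P Q \<Longrightarrow> (\<And>i. i < n \<Longrightarrow> \<mu> i = \<mu>' i) \<Longrightarrow> diagonalizes n A \<mu>' P Q"
proof -
  assume *: "\<And>i. i < n \<Longrightarrow> \<mu> i = \<mu>' i"
  have "mat_diag n \<mu> = mat_diag n \<mu>'" unfolding mat_diag_def by (intro cong_mat) (auto simp: *)
  then show "diagonalizes n A \<mu> P Q \<Longrightarrow> ?thesis" unfolding diagonalizes_def by simp
qed

lemma irreducible_tridiagonal_flip:
  "irreducible_tridiagonal d M \<Longrightarrow> irreducible_tridiagonal d (\<lambda>i j. M j i)"
  unfolding irreducible_tridiagonal_def band_def by blast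

lemma lower_bidiagonal_eigenvalue:
  fixes A :: "'a::field mat"
  assumes A: "A \<in> carrier_mat n n" "lower_bidiagonal A" and ev: "eigenvalue A x"
  shows "x \<in> (\<lambda>i. A $$ (i, i)) ` {..<n}"
proof -
  obtain v where v: "v \<in> carrier_vec n" "v \<noteq> 0\<^sub>v n" "A *\<^sub>v v = x \<cdot>\<^sub>v v"
    using ev A unfolding eigenvalue_def eigenvector_def by auto
  then have "\<exists>h. h < n \<and> v $ h \<noteq> 0" by (metis eq_vecI carrier_vecD index_zero_vec)
  then obtain h where h: "h < n" "v $ h \<noteq> 0" and least: "\<And>k. k < h \<Longrightarrow> v $ k = 0"
    using exists_least_iff[of "\<lambda>h. h < n \<and> v $ h \<noteq> 0"] by (meson order.strict_trans)
  have "(A *\<^sub>v v) $ h = (\<Sum>k<n. A $$ (h, k) * v $ k)" by (rule index_mult_mat_vec_sum[OF A(1) v(1) h(1)])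
  also have "\<dots> = A $$ (h, h) * v $ h"
  proof (rule sum_eq_single)
    fix k assume k: "k \<in> {..<n}" "k \<noteq> h"
    show "A $$ (h, k) * v $ k = 0"
      using lower_bidiagonal_entry[OF A(2,1) h(1), of k] least[of k] k by (cases "k < h") auto
  qed (use h in auto)
  finally have "x * v $ h = A $$ (h, h) * v $ h" unfolding v(3) index_smult_carrier[OF v(1) h(1)] .
  then show ?thesis using h by auto
qed

text \<open>The spectrum lies in the set of diagonal entries, which has at most d + 1 elements; d +
  1 distinct eigenvalues exhaust it and leave no repetition.\<close>

lemma lower_bidiagonal_multiplicity_free:
  fixes A :: "'a::field mat"
  assumes "multiplicity_free d A" "lower_bidiagonal A"
  shows "inj_on (\<lambda>i. A $$ (i, i)) {..<d + 1}" and "\<And>i. i < d + 1 \<Longrightarrow> eigenvalue A (A $$ (i, i))"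
proof -
  let ?D = "(\<lambda>i. A $$ (i, i)) ` {..<d + 1}"
  have A: "A \<in> carrier_mat (d + 1) (d + 1)" and card: "card {x. eigenvalue A x} = d + 1"
    using assms(1) unfolding multiplicity_free_def by auto
  have sub: "{x. eigenvalue A x} \<subseteq> ?D" using lower_bidiagonal_eigenvalue[OF A assms(2)] by blast
  have "card ?D \<le> d + 1" using card_image_le[of "{..<d + 1}" "\<lambda>i. A $$ (i, i)"] by simp
  moreover have "d + 1 \<le> card ?D" using card_mono[OF _ sub] card by simp
  ultimately have cD: "card ?D = d + 1" by simp
  then show "inj_on (\<lambda>i. A $$ (i, i)) {..<d + 1}" by (intro eq_card_imp_inj_on) auto
  have "{x. eigenvalue A x} = ?D" using sub card cD by (intro card_subset_eq) auto
  then show "eigenvalue A (A $$ (i, i))" if "i < d + 1" for i using that by auto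
qed

lemma eigenvalue_transpose:
  fixes A :: "'a::field mat"
  assumes A: "A \<in> carrier_mat n n"
  shows "eigenvalue (transpose_mat A) x \<longleftrightarrow> eigenvalue A x"
  using A by (simp add: eigenvalue_root_char_poly[of _ n] char_poly_transpose_mat[of _ n])

lemma multiplicity_free_transpose:
  "multiplicity_free d A \<Longrightarrow> multiplicity_free d (transpose_mat A)"
proof -
  assume mf: "multiplicity_free d A"
  then have "A \<in> carrier_mat (d + 1) (d + 1)" by (simp add: multiplicity_free_def)
  then have "eigenvalue (transpose_mat A) = eigenvalue A" by (intro ext eigenvalue_transpose)
  with mf show ?thesis by (simp add: multiplicity_free_def)
qed

section \<open>The Newton matrix of a lower bidiagonal matrix\<close>

lemma lower_bidiagonal_column_sum:
  assumes A: "A \<in> carrier_mat n n" "lower_bidiagonal A" and k: "k < n"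
  shows "(\<Sum>h<n. x h * A $$ (h, k)) = x k * (A $$ (k, k) :: 'a::field) +
    (if Suc k < n then x (Suc k) * A $$ (Suc k, k) else 0)"
proof (cases "Suc k < n")
  case True
  have "(\<Sum>h<n. x h * A $$ (h, k)) = x k * A $$ (k, k) + x (Suc k) * A $$ (Suc k, k)"
    using True k lower_bidiagonal_entry[OF A(2,1)] by (intro sum_eq_two) auto
  then show ?thesis using True by simp
next
  case False
  then show ?thesis
    using k lower_bidiagonal_entry[OF A(2,1)] by (subst sum_eq_single[of _ k]) auto
qed

lemma upper_bidiagonal_column_sum:
  assumes A: "A \<in> carrier_mat n n" "upper_bidiagonal A" and k: "k < n"
  shows "(\<Sum>h<n. x h * A $$ (h, k)) = x k * (A $$ (k, k) :: 'a::field) +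
    (if k = 0 then 0 else x (k - 1) * A $$ (k - 1, k))"
proof (cases "k = 0")
  case False
  have "(\<Sum>h<n. x h * A $$ (h, k)) = x k * A $$ (k, k) + x (k - 1) * A $$ (k - 1, k)"
    using False k upper_bidiagonal_entry[OF A(2,1)] by (intro sum_eq_two) auto
  then show ?thesis using False by simp
next
  case True
  then show ?thesis
    using k upper_bidiagonal_entry[OF A(2,1)] by (subst sum_eq_single[of _ k]) auto
qed

text \<open>
  Up to scaling, \<open>newton_matrix\<close> expresses the standard basis in an eigenbasis of \<open>A\<close>: the \<open>k\<close>-th
  standard basis vector is a multiple of \<open>(A - \<theta>\<^sub>0) \<cdots> (A - \<theta>\<^sub>k\<^sub>-\<^sub>1)\<close> applied to the \<open>0\<close>-th.
\<close>

definition newton_matrix :: "nat \<Rightarrow> 'a::field mat \<Rightarrow> 'a mat" where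
  "newton_matrix n A = mat n n (\<lambda>(i, k).
     poly (newton_poly (\<lambda>i. A $$ (i, i)) k) (A $$ (i, i)) / (\<Prod>j<k. A $$ (Suc j, j)))"

text \<open>Column by column, G A = D G is the recursion of the Newton polynomials, with the
  subdiagonal of A absorbed in the denominators. G is invertible because it is triangular: the k-th
  Newton polynomial vanishes at the diagonal entries of index below k, but not at index k.\<close>

lemma newton_matrix_diagonalizes:
  fixes A :: "'a::field mat"
  assumes A: "A \<in> carrier_mat (d + 1) (d + 1)" "lower_bidiagonal A"
    and inj: "inj_on (\<lambda>i. A $$ (i, i)) {..d}" and nz: "\<And>i. i < d \<Longrightarrow> A $$ (Suc i, i) \<noteq> 0"
  obtains P where "diagonalizes (d + 1) A (\<lambda>i. A $$ (i, i)) P (newton_matrix (d + 1) A)"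
proof -
  let ?n = "d + 1" and ?\<theta> = "\<lambda>i. A $$ (i, i)"
  define G where "G = newton_matrix ?n A"
  define \<alpha> where "\<alpha> k = (\<Prod>j<k. A $$ (Suc j, j))" for k
  have G: "G \<in> carrier_mat ?n ?n" by (simp add: G_def newton_matrix_def)
  have G_idx: "G $$ (i, k) = poly (newton_poly ?\<theta> k) (?\<theta> i) / \<alpha> k" if "i < ?n" "k < ?n" for i k
    using that by (simp add: G_def newton_matrix_def \<alpha>_def)
  have \<alpha>_nz: "\<alpha> k \<noteq> 0" if "k < ?n" for k using nz that by (auto simp: \<alpha>_def)
  have "prod_list (diag_mat G) \<noteq> 0"
  proof -
    have "G $$ (i, i) \<noteq> 0" if "i < ?n" for i
      using G_idx[OF that that] \<alpha>_nz[OF that] newton_poly_nonroot[OF inj order.refl, of i] that by simp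
    then show ?thesis using G by (auto simp: diag_mat_def prod_list_zero_iff simp del: upt_Suc)
  qed
  moreover have "G $$ (i, k) = 0" if "i < k" "k < ?n" for i k
    using G_idx[of i k] newton_poly_root[of i k ?\<theta>] that by simp
  ultimately have "det G \<noteq> 0" using det_lower_triangular[OF _ G] by metis
  then have "G \<in> Units (ring_mat TYPE('a) ?n ())" by (rule det_non_zero_imp_unit[OF G])
  then obtain P where P: "P \<in> carrier_mat ?n ?n" "P * G = 1\<^sub>m ?n"
    unfolding Units_def ring_mat_def by auto
  have "G * A = mat_diag ?n ?\<theta> * G"
  proof (rule eq_matI)
    fix i k assume "i < dim_row (mat_diag ?n ?\<theta> * G)" "k < dim_col (mat_diag ?n ?\<theta> * G)"
    then have ik: "i < ?n" "k < ?n" using G by (auto simp: mat_diag_def)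
    let ?g = "\<lambda>k. poly (newton_poly ?\<theta> k) (?\<theta> i)"
    have "(G * A) $$ (i, k) = (\<Sum>h<?n. G $$ (i, h) * A $$ (h, k))"
      by (rule index_mult_mat_sum[OF G A(1) ik])
    also have "\<dots> = G $$ (i, k) * A $$ (k, k) + (if Suc k < ?n then G $$ (i, Suc k) * A $$ (Suc k, k) else 0)"
      by (rule lower_bidiagonal_column_sum[OF A ik(2)])
    \<comment> \<open>Column d has no subdiagonal entry, but there the Newton polynomial of degree d
      + 1 vanishes at every diagonal entry, so one formula serves all columns.\<close>
    also have "(if Suc k < ?n then G $$ (i, Suc k) * A $$ (Suc k, k) else 0) = ?g (Suc k) / \<alpha> k"
    proof (cases "Suc k < ?n")
      case True
      have "\<alpha> (Suc k) = \<alpha> k * A $$ (Suc k, k)" by (simp add: \<alpha>_def)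
      moreover have "A $$ (Suc k, k) \<noteq> 0" using nz True by simp
      ultimately show ?thesis using True G_idx[OF ik(1) True] by (simp del: poly_newton_poly_Suc)
    next
      case False
      then have "i < Suc k" using ik by simp
      then show ?thesis using False newton_poly_root[of i "Suc k" ?\<theta>] by (simp del: poly_newton_poly_Suc)
    qed
    also have "G $$ (i, k) * A $$ (k, k) + ?g (Suc k) / \<alpha> k = ?\<theta> i * G $$ (i, k)"
      unfolding G_idx[OF ik] by (simp add: add_divide_distrib[symmetric] algebra_simps)
    also have "\<dots> = (mat_diag ?n ?\<theta> * G) $$ (i, k)" using mat_diag_mult_left[OF G] ik by simp
    finally show "(G * A) $$ (i, k) = (mat_diag ?n ?\<theta> * G) $$ (i, k)" .
  qed (use G A in \<open>auto simp: mat_diag_def\<close>)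
  then have "diagonalizes ?n A ?\<theta> P G" by (rule diagonalizesI_left[OF A(1) P(1) G P(2)])
  then show ?thesis using that unfolding G_def by blast
qed

text \<open>From t G = G As: column k of G is the k-th Newton polynomial divided by the product of
  the first k subdiagonal entries of A. Clearing this denominator multiplies
  \<open>As $$ (k - 1, k)\<close> by \<open>A $$ (k, k - 1)\<close>, which is why only products of
  opposite off-diagonal entries occur in the criterion.\<close>

lemma newton_matrix_split_action:
  fixes A As :: "'a::field mat"
  assumes A: "A \<in> carrier_mat (d + 1) (d + 1)"
    and As: "As \<in> carrier_mat (d + 1) (d + 1)" "upper_bidiagonal As"
    and nz: "\<And>i. i < d \<Longrightarrow> A $$ (Suc i, i) \<noteq> 0"
    and D: "diagonalizes (d + 1) A (\<lambda>i. A $$ (i, i)) P (newton_matrix (d + 1) A)"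
  shows "split_action d (\<lambda>i. A $$ (i, i)) (\<lambda>i. As $$ (i, i))
    (\<lambda>n. if n \<in> {1..d} then A $$ (n, n - 1) * As $$ (n - 1, n) else 0)
    (\<lambda>i j. (newton_matrix (d + 1) A * (As * P)) $$ (i, j))"
proof -
  let ?n = "d + 1" and ?\<theta> = "\<lambda>i. A $$ (i, i)"
  define G where "G = newton_matrix ?n A"
  define \<alpha> where "\<alpha> k = (\<Prod>j<k. A $$ (Suc j, j))" for k
  note D' = diagonalizesD[OF D, folded G_def]
  define t where "t = G * (As * P)"
  have t: "t \<in> carrier_mat ?n ?n" unfolding t_def using D' As by (intro mult_carrier_mat[of _ ?n ?n]) auto
  have G_idx: "G $$ (i, k) = poly (newton_poly ?\<theta> k) (?\<theta> i) / \<alpha> k" if "i < ?n" "k < ?n" for i k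
    using that by (simp add: G_def newton_matrix_def \<alpha>_def)
  have \<alpha>_nz: "\<alpha> k \<noteq> 0" if "k < ?n" for k using nz that by (auto simp: \<alpha>_def)
  have tG: "t * G = G * As"
  proof -
    have "t * G = G * (As * (P * G))"
      unfolding t_def using D'(1,2) As(1)
      by (simp add: assoc_mult_mat[of _ ?n ?n _ ?n _ ?n] mult_carrier_mat[of _ ?n ?n])
    then show ?thesis using D'(3) As(1) by simp
  qed
  have "act d ?\<theta> (\<lambda>i j. t $$ (i, j)) (newton_poly ?\<theta> k) i =
      As $$ (k, k) * poly (newton_poly ?\<theta> k) (?\<theta> i) +
      (if k \<in> {1..d} then A $$ (k, k - 1) * As $$ (k - 1, k) else 0) * poly (newton_poly ?\<theta> (k - 1)) (?\<theta> i)"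
    if "k \<le> d" "i \<le> d" for k i
  proof -
    have ik: "i < ?n" "k < ?n" using that by auto
    let ?g = "\<lambda>k. poly (newton_poly ?\<theta> k) (?\<theta> i)"
    have "act d ?\<theta> (\<lambda>i j. t $$ (i, j)) (newton_poly ?\<theta> k) i = \<alpha> k * (\<Sum>j<?n. t $$ (i, j) * G $$ (j, k))"
    proof -
      have e: "t $$ (i, j) * poly (newton_poly ?\<theta> k) (?\<theta> j) = \<alpha> k * (t $$ (i, j) * G $$ (j, k))" if "j < ?n" for j
        using G_idx[OF that ik(2)] \<alpha>_nz[OF ik(2)] by simp
      have n: "{..d} = {..<?n}" by auto
      show ?thesis unfolding act_def n sum_distrib_left by (rule sum.cong[OF refl], rule e) simp
    qed
    also have "(\<Sum>j<?n. t $$ (i, j) * G $$ (j, k)) = (\<Sum>j<?n. G $$ (i, j) * As $$ (j, k))"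
      unfolding index_mult_mat_sum[OF t D'(2) ik, symmetric] index_mult_mat_sum[OF D'(2) As(1) ik, symmetric] tG ..
    also have "\<dots> = G $$ (i, k) * As $$ (k, k) + (if k = 0 then 0 else G $$ (i, k - 1) * As $$ (k - 1, k))"
      by (rule upper_bidiagonal_column_sum[OF As ik(2)])
    also have "\<alpha> k * \<dots> = As $$ (k, k) * ?g k +
        (if k \<in> {1..d} then A $$ (k, k - 1) * As $$ (k - 1, k) else 0) * ?g (k - 1)"
    proof (cases k)
      case 0
      then show ?thesis using G_idx[OF ik] \<alpha>_nz[OF ik(2)] by simp
    next
      case (Suc m)
      have m: "m < ?n" "k - 1 = m" "k \<in> {1..d}" "k \<noteq> 0" using ik Suc by auto
      have e1: "\<alpha> k * G $$ (i, k) = ?g k" using G_idx[OF ik] \<alpha>_nz[OF ik(2)] by simp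
      have "\<alpha> k = \<alpha> m * A $$ (k, m)" unfolding Suc by (simp add: \<alpha>_def)
      then have e2: "\<alpha> k * G $$ (i, m) = A $$ (k, m) * ?g m"
        using G_idx[OF ik(1) m(1)] \<alpha>_nz[OF m(1)] by simp
      have "\<alpha> k * (G $$ (i, k) * As $$ (k, k) + G $$ (i, m) * As $$ (m, k)) =
          (\<alpha> k * G $$ (i, k)) * As $$ (k, k) + (\<alpha> k * G $$ (i, m)) * As $$ (m, k)"
        by (simp only: distrib_left mult.assoc)
      also have "\<dots> = As $$ (k, k) * ?g k + A $$ (k, m) * As $$ (m, k) * ?g m"
        unfolding e1 e2 by (simp only: mult.assoc mult.commute mult.left_commute)
      finally show ?thesis using m by (simp only: if_False if_True)
    qed
    finally show ?thesis .
  qed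
  then show ?thesis unfolding split_action_def t_def G_def by simp
qed

section \<open>The dual pattern\<close>

text \<open>
  An irreducible tridiagonal matrix is self-adjoint for a diagonal bilinear form, for which
  diagonal matrices are self-adjoint as well.  In an eigenbasis of \<open>A\<^sup>*\<close> this form is again diagonal.
\<close>

lemma irreducible_tridiagonal_weights:
  fixes t :: "nat \<Rightarrow> nat \<Rightarrow> 'a::field"
  assumes T: "irreducible_tridiagonal d t"
  obtains w where "\<And>i. i \<le> d \<Longrightarrow> w i \<noteq> 0" "\<And>i j. i \<le> d \<Longrightarrow> j \<le> d \<Longrightarrow> w i * t i j = t j i * w j"
proof -
  define w where "w i = (\<Prod>k<i. t k (Suc k) / t (Suc k) k)" for i
  have nz: "t n (Suc n) \<noteq> 0" "t (Suc n) n \<noteq> 0" if "n < d" for n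
    using T that unfolding irreducible_tridiagonal_def by auto
  have w_nz: "w i \<noteq> 0" if "i \<le> d" for i using nz that by (auto simp: w_def)
  have step: "w n * t n (Suc n) = t (Suc n) n * w (Suc n)" if "n < d" for n
    using nz[OF that] by (simp add: w_def)
  have sym: "w i * t i j = t j i * w j" if ij: "i \<le> d" "j \<le> d" for i j
  proof (cases "i + 1 < j \<or> j + 1 < i")
    case True
    then show ?thesis using T ij unfolding irreducible_tridiagonal_def band_def by auto
  next
    case False
    then consider "i = j" | "j = Suc i" | "i = Suc j" by linarith
    then show ?thesis
    proof cases
      case 3
      then show ?thesis using step[of j] ij by (simp add: mult.commute)
    qed (use step ij in auto)
  qed
  show ?thesis using that[OF w_nz sym] .
qed

text \<open>R takes coordinates in the eigenbasis of As to coordinates in that of A, and B is the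
  Gram matrix of the form diag(w) transported by R. Self-adjointness of As makes B commute with
  diag(\<theta>s), hence diagonal as the \<theta>s are distinct; self-adjointness of A is
  \<open>B * M = transpose_mat M * B\<close>. The diagonal of B is \<open>\<kappa>\<close>.\<close>

lemma dual_symmetrizable:
  fixes A As :: "'a::field mat"
  assumes D: "diagonalizes (d + 1) A \<theta> P Q" and Ds: "diagonalizes (d + 1) As \<theta>s Ps Qs"
    and injs: "inj_on \<theta>s {..d}"
    and T: "irreducible_tridiagonal d (\<lambda>i j. (Q * (As * P)) $$ (i, j))"
  obtains \<kappa> where "\<And>i. i \<le> d \<Longrightarrow> \<kappa> i \<noteq> 0"
    "\<And>i j. i \<le> d \<Longrightarrow> j \<le> d \<Longrightarrow> \<kappa> i * (Qs * (A * Ps)) $$ (i, j) = (Qs * (A * Ps)) $$ (j, i) * \<kappa> j"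
proof -
  define n where "n = d + 1"
  note P = diagonalizesD[OF D, folded n_def] and Ps = diagonalizesD[OF Ds, folded n_def]
  note car = mult_carrier_mat[of _ n n _ n] and assoc = assoc_mult_mat[of _ n n _ n _ n]
  define t where "t = Q * (As * P)"
  define M where "M = Qs * (A * Ps)"
  define R where "R = Q * Ps"
  define R' where "R' = Qs * P"
  let ?D = "mat_diag n \<theta>" and ?Ds = "mat_diag n \<theta>s"
  have t: "t \<in> carrier_mat n n" unfolding t_def by (intro car P Ps)
  have M: "M \<in> carrier_mat n n" unfolding M_def by (intro car P Ps)
  have R: "R \<in> carrier_mat n n" unfolding R_def by (intro car P Ps)
  have R': "R' \<in> carrier_mat n n" unfolding R'_def by (intro car P Ps)
  have RR': "R * R' = 1\<^sub>m n"
  proof -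
    have "R * R' = Q * (Ps * (Qs * P))" unfolding R_def R'_def by (intro assoc car P Ps)
    also have "Ps * (Qs * P) = P" by (rule mult_inverse_cancel[OF Ps(2,1,3) P(1)])
    finally show ?thesis using P(4) by simp
  qed
  have R'R: "R' * R = 1\<^sub>m n" by (rule mat_mult_left_right_inverse[OF R R' RR'])
  have tR: "t * R = R * ?Ds"
  proof -
    have "t * R = Q * (As * (P * (Q * Ps)))" unfolding t_def R_def
      using P(1,2) Ps(1,6) by (simp add: assoc car)
    also have "P * (Q * Ps) = Ps" by (rule mult_inverse_cancel[OF P(2,1,3) Ps(1)])
    also have "As * Ps = Ps * ?Ds" by (rule diagonalizes_right[OF Ds, folded n_def])
    finally show ?thesis unfolding R_def using P(2) Ps(1) by (simp add: assoc)
  qed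
  have RM: "R * M = ?D * R"
  proof -
    have "R * M = Q * (Ps * (Qs * (A * Ps)))" unfolding M_def R_def
      using P(2,6) Ps(1,2) by (simp add: assoc car)
    also have "Ps * (Qs * (A * Ps)) = A * Ps" by (rule mult_inverse_cancel[OF Ps(2,1,3) car[OF P(6) Ps(1)]])
    also have "Q * (A * Ps) = (Q * A) * Ps" using P(2,6) Ps(1) by (simp add: assoc)
    also have "\<dots> = ?D * R" unfolding diagonalizes_left[OF D, folded n_def] R_def using P(2) Ps(1) by (simp add: assoc)
    finally show ?thesis .
  qed
  obtain w where w: "\<And>i. i \<le> d \<Longrightarrow> w i \<noteq> 0" "\<And>i j. i \<le> d \<Longrightarrow> j \<le> d \<Longrightarrow> w i * t $$ (i, j) = t $$ (j, i) * w j"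
    using irreducible_tridiagonal_weights[OF T[folded t_def]] by metis
  let ?K = "mat_diag n w"
  have Kt: "?K * t = transpose_mat t * ?K"
  proof -
    have tT: "transpose_mat t \<in> carrier_mat n n" using t by simp
    show ?thesis
      unfolding mat_diag_mult_left[OF t] mat_diag_mult_right[OF tT]
      using t w(2) by (intro cong_mat) (auto simp: less_Suc_eq_le n_def)
  qed
  let ?RT = "transpose_mat R"
  have RT: "?RT \<in> carrier_mat n n" using R by simp
  define B where "B = ?RT * (?K * R)"
  have KR: "?K * R \<in> carrier_mat n n" by (intro car R mat_diag_dim)
  have B: "B \<in> carrier_mat n n" unfolding B_def by (rule car[OF RT KR])
  have BDs: "B * ?Ds = ?Ds * B"
  proof -
    have "B * ?Ds = ?RT * (?K * (R * ?Ds))" unfolding B_def using R by (simp add: assoc car)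
    also have "\<dots> = ?RT * (transpose_mat t * (?K * R))"
      unfolding tR[symmetric] using R t Kt by (simp add: car flip: assoc)
    also have "\<dots> = transpose_mat (t * R) * (?K * R)"
      using R t by (simp add: transpose_mult[OF t R] assoc car)
    also have "\<dots> = ?Ds * B"
      unfolding tR B_def using R by (simp add: transpose_mult[of _ n n _ n] transpose_mat_diag assoc car)
    finally show ?thesis .
  qed
  have BM: "B * M = transpose_mat M * B"
  proof -
    have "B * M = ?RT * (?K * (R * M))" unfolding B_def using R M by (simp add: assoc car)
    also have "\<dots> = ?RT * ((?K * ?D) * R)" unfolding RM using R by (simp add: assoc car del: mat_diag_diag)
    also have "?K * ?D = ?D * ?K" by (simp add: mult.commute)
    also have "?RT * ((?D * ?K) * R) = transpose_mat (?D * R) * (?K * R)"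
      using R by (simp add: transpose_mult[of _ n n _ n] transpose_mat_diag assoc car del: mat_diag_diag)
    also have "\<dots> = transpose_mat M * B"
      unfolding RM[symmetric] B_def using R M by (simp add: transpose_mult[OF R M] assoc car)
    finally show ?thesis .
  qed
  have B0: "B $$ (i, j) = 0" if ij: "i \<le> d" "j \<le> d" "i \<noteq> j" for i j
  proof -
    have "B $$ (i, j) * \<theta>s j = \<theta>s i * B $$ (i, j)"
    proof -
      have "i < n" "j < n" using ij by (auto simp: n_def)
      then have "(B * ?Ds) $$ (i, j) = B $$ (i, j) * \<theta>s j" "(?Ds * B) $$ (i, j) = \<theta>s i * B $$ (i, j)"
        unfolding mat_diag_mult_left[OF B] mat_diag_mult_right[OF B] by auto
      then show ?thesis using BDs by (simp only:)
    qed
    then have "B $$ (i, j) * (\<theta>s j - \<theta>s i) = 0" by (simp add: algebra_simps)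
    moreover have "\<theta>s j - \<theta>s i \<noteq> 0" using injs ij unfolding inj_on_def by auto
    ultimately show ?thesis by simp
  qed
  have B_nz: "B $$ (i, i) \<noteq> 0" if i: "i \<le> d" for i
  proof -
    let ?K' = "mat_diag n (\<lambda>i. 1 / w i)"
    define Y where "Y = R' * (?K' * transpose_mat R')"
    have Y: "Y \<in> carrier_mat n n" unfolding Y_def using R' by (simp add: car)
    have KK': "?K * ?K' = 1\<^sub>m n"
    proof -
      have "mat_diag n (\<lambda>i. w i * (1 / w i)) = mat_diag n (\<lambda>i. 1)"
        unfolding mat_diag_def using w(1) by (intro cong_mat) (auto simp: n_def less_Suc_eq_le)
      then show ?thesis by (simp only: mat_diag_diag mat_diag_one)
    qed
    have "B * Y = ?RT * (?K * (R * (R' * (?K' * transpose_mat R'))))"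
      unfolding B_def Y_def using R R' by (simp add: assoc car)
    also have "R * (R' * (?K' * transpose_mat R')) = ?K' * transpose_mat R'"
      using R' by (intro mult_inverse_cancel[OF R' R RR']) (simp add: car)
    also have "?K * (?K' * transpose_mat R') = transpose_mat R'"
      using R' by (intro mult_inverse_cancel[OF _ _ KK']) auto
    also have "?RT * transpose_mat R' = 1\<^sub>m n"
      using R'R by (simp flip: transpose_mult[OF R' R])
    finally have BY: "B * Y = 1\<^sub>m n" .
    have "(B * Y) $$ (i, i) = (\<Sum>k<n. B $$ (i, k) * Y $$ (k, i))"
      using i by (intro index_mult_mat_sum[OF B Y]) (auto simp: n_def)
    also have "\<dots> = B $$ (i, i) * Y $$ (i, i)"
      using B0 i by (intro sum_eq_single) (auto simp: n_def)
    finally show ?thesis using BY i by (auto simp: n_def)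
  qed
  have "B $$ (i, i) * M $$ (i, j) = M $$ (j, i) * B $$ (j, j)" if ij: "i \<le> d" "j \<le> d" for i j
  proof -
    have ij': "i < n" "j < n" using ij by (auto simp: n_def)
    have "(B * M) $$ (i, j) = (\<Sum>k<n. B $$ (i, k) * M $$ (k, j))"
      by (rule index_mult_mat_sum[OF B M ij'])
    also have "\<dots> = B $$ (i, i) * M $$ (i, j)" using B0 ij by (intro sum_eq_single) (auto simp: n_def)
    finally have 1: "(B * M) $$ (i, j) = B $$ (i, i) * M $$ (i, j)" .
    have "(transpose_mat M * B) $$ (i, j) = (\<Sum>k<n. transpose_mat M $$ (i, k) * B $$ (k, j))"
      using M by (intro index_mult_mat_sum[OF _ B ij']) simp
    also have "\<dots> = transpose_mat M $$ (i, j) * B $$ (j, j)" using B0 ij by (intro sum_eq_single) (auto simp: n_def)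
    also have "transpose_mat M $$ (i, j) = M $$ (j, i)" using M ij' by simp
    finally show ?thesis using 1 BM by simp
  qed
  with B_nz that[of "\<lambda>i. B $$ (i, i)"] show ?thesis unfolding M_def by blast
qed

lemma upper_bidiagonal_diagonalizes:
  fixes As :: "'a::field mat"
  assumes As: "As \<in> carrier_mat n n" "upper_bidiagonal As" and inj: "inj_on (\<lambda>i. As $$ (i, i)) {..<n}"
    and D: "diagonalizes n As (\<lambda>i. As $$ (i, i)) P Q"
  shows "lower_bidiagonal (transpose_mat As)"
    and "inj_on (\<lambda>i. transpose_mat As $$ (i, i)) {..<n}"
    and "diagonalizes n (transpose_mat As) (\<lambda>i. transpose_mat As $$ (i, i)) (transpose_mat Q) (transpose_mat P)"
    and "\<And>i j. j < i \<Longrightarrow> i < n \<Longrightarrow> P $$ (i, j) = 0"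
    and "\<And>i j. j < i \<Longrightarrow> i < n \<Longrightarrow> Q $$ (i, j) = 0"
proof -
  show L: "lower_bidiagonal (transpose_mat As)" using As by (simp add: upper_bidiagonal_def)
  show inj': "inj_on (\<lambda>i. transpose_mat As $$ (i, i)) {..<n}"
    using inj As by (auto simp: inj_on_def)
  show D': "diagonalizes n (transpose_mat As) (\<lambda>i. transpose_mat As $$ (i, i)) (transpose_mat Q) (transpose_mat P)"
    using As by (intro diagonalizes_cong[OF diagonalizes_transpose[OF D]]) auto
  note T = lower_bidiagonal_diagonalizes[OF L inj' D']
  show "P $$ (i, j) = 0" if "j < i" "i < n" for i j
    using T(2)[OF that] that diagonalizesD(1)[OF D] by auto
  show "Q $$ (i, j) = 0" if "j < i" "i < n" for i j
    using T(1)[OF that] that diagonalizesD(2)[OF D] by auto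
qed

lemma transpose_sandwich:
  fixes A :: "'a::field mat"
  assumes "P \<in> carrier_mat n n" "Q \<in> carrier_mat n n" "A \<in> carrier_mat n n"
  shows "transpose_mat P * (transpose_mat A * transpose_mat Q) = transpose_mat (Q * (A * P))"
  using assms by (simp add: transpose_mult[of _ n n _ n] assoc_mult_mat[of _ n n _ n _ n])

text \<open>The Hessenberg argument on the transposed pair gives zeros below the subdiagonal and,
  from the subdiagonal of A, nonzero entries on it. The symmetrization carries both facts across the
  diagonal.\<close>

lemma dual_irreducible_tridiagonal:
  fixes A As :: "'a::field mat"
  assumes A: "A \<in> carrier_mat (d + 1) (d + 1)" "lower_bidiagonal A"
    and As: "As \<in> carrier_mat (d + 1) (d + 1)" "upper_bidiagonal As"
    and nz: "\<And>i. i < d \<Longrightarrow> A $$ (Suc i, i) \<noteq> 0"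
    and D: "diagonalizes (d + 1) A \<theta> P Q"
    and injs: "inj_on (\<lambda>i. As $$ (i, i)) {..d}"
    and Ds: "diagonalizes (d + 1) As (\<lambda>i. As $$ (i, i)) Ps Qs"
    and T: "irreducible_tridiagonal d (\<lambda>i j. (Q * (As * P)) $$ (i, j))"
  shows "irreducible_tridiagonal d (\<lambda>i j. (Qs * (A * Ps)) $$ (i, j))"
proof -
  let ?M = "\<lambda>i j. (Qs * (A * Ps)) $$ (i, j)"
  have injs': "inj_on (\<lambda>i. As $$ (i, i)) {..<d + 1}" using injs by (simp add: lessThan_Suc_atMost)
  note U = upper_bidiagonal_diagonalizes[OF As injs' Ds] and Ps = diagonalizesD[OF Ds]
  have AT: "transpose_mat A \<in> carrier_mat (d + 1) (d + 1)" using A by simp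
  have UT: "upper_bidiagonal (transpose_mat A)" using A by (simp add: upper_bidiagonal_def)
  note H = bidiagonal_Hessenberg[OF U(1,2,3) AT UT]
  have tr: "(transpose_mat Ps * (transpose_mat A * transpose_mat Qs)) $$ (i, j) = ?M j i" if "i \<le> d" "j \<le> d" for i j
    unfolding transpose_sandwich[OF Ps(1,2) A(1)] using Ps A that by (auto simp: less_Suc_eq_le)
  have up: "?M j i = 0" if "i + 1 < j" "j \<le> d" for i j
    using H(1)[of i j] tr[of i j] that by simp
  have sub: "?M (Suc i) i \<noteq> 0" if "i < d" for i
    using H(2)[of i] tr[of i "Suc i"] nz[OF that] A(1) that by simp
  obtain \<kappa> where \<kappa>: "\<And>i. i \<le> d \<Longrightarrow> \<kappa> i \<noteq> 0"
    "\<And>i j. i \<le> d \<Longrightarrow> j \<le> d \<Longrightarrow> \<kappa> i * ?M i j = ?M j i * \<kappa> j"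
    using dual_symmetrizable[OF D Ds injs T] by blast
  have sym: "?M i j = 0 \<longleftrightarrow> ?M j i = 0" if "i \<le> d" "j \<le> d" for i j
    using \<kappa>(1)[OF that(1)] \<kappa>(1)[OF that(2)] \<kappa>(2)[OF that] by auto
  show ?thesis
    unfolding irreducible_tridiagonal_def band_def
  proof (intro conjI allI impI)
    fix i j assume "i \<le> d" "j \<le> d" "i + 1 < j \<or> j + 1 < i"
    then show "?M i j = 0" using up[of i j] up[of j i] sym[of i j] by auto
  next
    fix n assume "n < d"
    then show "?M n (Suc n) \<noteq> 0" "?M (Suc n) n \<noteq> 0" using sub[of n] sym[of n "Suc n"] by auto
  qed
qed

section \<open>Leonard pairs in bidiagonal form\<close>

lemma parameter_array_cong:
  assumes "parameter_array d \<theta> \<theta>s \<phi> \<psi>"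
    and "\<And>i. i \<le> d \<Longrightarrow> \<theta> i = \<theta>' i" "\<And>i. i \<le> d \<Longrightarrow> \<theta>s i = \<theta>s' i" "\<And>i. i \<in> {1..d} \<Longrightarrow> \<phi> i = \<phi>' i"
  shows "parameter_array d \<theta>' \<theta>s' \<phi>' \<psi>"
proof -
  have th: "\<theta>' i = \<theta> i" "\<theta>s' i = \<theta>s i" if "i \<le> d" for i using assms(2,3)[OF that] by auto
  have ph: "\<phi>' i = \<phi> i" if "i \<in> {1..d}" for i using assms(4)[OF that] by auto
  have S: "(\<Sum>h = 0..i - 1. (\<theta>' h - \<theta>' (d - h)) / (\<theta>' 0 - \<theta>' d)) =
      (\<Sum>h = 0..i - 1. (\<theta> h - \<theta> (d - h)) / (\<theta> 0 - \<theta> d))" if "i \<in> {1..d}" for i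
    using th that by (intro sum.cong) auto
  note par = assms(1)[unfolded parameter_array_def]
  note par3 = par[THEN conjunct2, THEN conjunct2, THEN conjunct1]
    and par4 = par[THEN conjunct2, THEN conjunct2, THEN conjunct2, THEN conjunct1]
  have 3: "\<forall>i\<in>{1..d}. \<phi>' i = \<psi> 1 * (\<Sum>h = 0..i - 1. (\<theta>' h - \<theta>' (d - h)) / (\<theta>' 0 - \<theta>' d))
                        + (\<theta>s' i - \<theta>s' 0) * (\<theta>' (i - 1) - \<theta>' d)"
  proof
    fix i assume i: "i \<in> {1..d}"
    then have e: "\<theta>' (i - 1) = \<theta> (i - 1)" "\<theta>s' i = \<theta>s i" "\<theta>s' 0 = \<theta>s 0" "\<theta>' d = \<theta> d" using th by auto
    show "\<phi>' i = \<psi> 1 * (\<Sum>h = 0..i - 1. (\<theta>' h - \<theta>' (d - h)) / (\<theta>' 0 - \<theta>' d))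
                        + (\<theta>s' i - \<theta>s' 0) * (\<theta>' (i - 1) - \<theta>' d)"
      unfolding S[OF i] unfolding ph[OF i] e by (rule bspec[OF par3 i])
  qed
  have 4: "\<forall>i\<in>{1..d}. \<psi> i = \<phi>' 1 * (\<Sum>h = 0..i - 1. (\<theta>' h - \<theta>' (d - h)) / (\<theta>' 0 - \<theta>' d))
                        + (\<theta>s' i - \<theta>s' 0) * (\<theta>' (d - i + 1) - \<theta>' 0)"
  proof
    fix i assume i: "i \<in> {1..d}"
    then have e: "\<theta>' (d - i + 1) = \<theta> (d - i + 1)" "\<theta>s' i = \<theta>s i" "\<theta>s' 0 = \<theta>s 0" "\<theta>' 0 = \<theta> 0" "\<phi>' 1 = \<phi> 1"
      using th ph by auto
    show "\<psi> i = \<phi>' 1 * (\<Sum>h = 0..i - 1. (\<theta>' h - \<theta>' (d - h)) / (\<theta>' 0 - \<theta>' d))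
                        + (\<theta>s' i - \<theta>s' 0) * (\<theta>' (d - i + 1) - \<theta>' 0)"
      unfolding S[OF i] unfolding e by (rule bspec[OF par4 i])
  qed
  have "\<exists>c. \<forall>i\<in>{2..d - 1}.
        (\<theta>' (i - 2) - \<theta>' (i + 1)) / (\<theta>' (i - 1) - \<theta>' i) = c \<and>
        (\<theta>s' (i - 2) - \<theta>s' (i + 1)) / (\<theta>s' (i - 1) - \<theta>s' i) = c"
  proof -
    have "\<theta>' (i - 2) = \<theta> (i - 2) \<and> \<theta>' (i + 1) = \<theta> (i + 1) \<and> \<theta>' (i - 1) = \<theta> (i - 1) \<and> \<theta>' i = \<theta> i \<and>
      \<theta>s' (i - 2) = \<theta>s (i - 2) \<and> \<theta>s' (i + 1) = \<theta>s (i + 1) \<and> \<theta>s' (i - 1) = \<theta>s (i - 1) \<and> \<theta>s' i = \<theta>s i"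
      if "i \<in> {2..d - 1}" for i
      using that by (intro conjI th) auto
    moreover obtain c where "\<forall>i\<in>{2..d - 1}.
        (\<theta> (i - 2) - \<theta> (i + 1)) / (\<theta> (i - 1) - \<theta> i) = c \<and>
        (\<theta>s (i - 2) - \<theta>s (i + 1)) / (\<theta>s (i - 1) - \<theta>s i) = c"
      using assms(1) unfolding parameter_array_def by blast
    ultimately show ?thesis by (intro exI[of _ c]) simp
  qed
  moreover have "\<forall>i\<le>d. \<forall>j\<le>d. i \<noteq> j \<longrightarrow> \<theta>' i \<noteq> \<theta>' j \<and> \<theta>s' i \<noteq> \<theta>s' j"
  proof -
    have "\<forall>i\<le>d. \<forall>j\<le>d. i \<noteq> j \<longrightarrow> \<theta> i \<noteq> \<theta> j \<and> \<theta>s i \<noteq> \<theta>s j"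
      using assms(1) unfolding parameter_array_def by blast
    then show ?thesis using th by simp
  qed
  moreover have "\<forall>i\<in>{1..d}. \<phi>' i \<noteq> 0 \<and> \<psi> i \<noteq> 0"
  proof -
    have "\<forall>i\<in>{1..d}. \<phi> i \<noteq> 0 \<and> \<psi> i \<noteq> 0" using assms(1) unfolding parameter_array_def by blast
    then show ?thesis using ph by simp
  qed
  ultimately show ?thesis unfolding parameter_array_def using 3 4 by blast
qed

lemma Leonard_pair_imp_parameter_array:
  fixes A As :: "'a::field mat"
  assumes A: "A \<in> carrier_mat (d + 1) (d + 1)" "lower_bidiagonal A"
    and As: "As \<in> carrier_mat (d + 1) (d + 1)" "upper_bidiagonal As"
    and LP: "Leonard_pair d A As"
  shows "\<exists>\<psi>. parameter_array d (\<lambda>i. A $$ (i, i)) (\<lambda>i. As $$ (i, i)) (\<lambda>i. A $$ (i, i - 1) * As $$ (i - 1, i)) \<psi>"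
proof -
  let ?n = "d + 1" and ?\<theta> = "\<lambda>i. A $$ (i, i)" and ?\<theta>s = "\<lambda>i. As $$ (i, i)"
  have n: "{..<?n} = {..d}" by auto
  obtain E Es where mf: "multiplicity_free d A" "multiplicity_free d As"
    and I: "idempotent_sequence d A As E" and Is: "idempotent_sequence d As A Es"
    using LP unfolding Leonard_pair_def by blast
  note inj = lower_bidiagonal_multiplicity_free(1)[OF mf(1) A(2)]
  have L': "lower_bidiagonal (transpose_mat As)" using As by (simp add: upper_bidiagonal_def)
  have mf': "multiplicity_free d (transpose_mat As)" by (rule multiplicity_free_transpose[OF mf(2)])
  have injs: "inj_on ?\<theta>s {..<?n}"
    using lower_bidiagonal_multiplicity_free(1)[OF mf' L'] As by (auto simp: inj_on_def)
  have evs: "eigenvalue As (?\<theta>s i)" if "i < ?n" for i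
    using lower_bidiagonal_multiplicity_free(2)[OF mf' L' that] eigenvalue_transpose[OF As(1)] As that by simp
  obtain Ps Qs where Ds: "diagonalizes ?n As ?\<theta>s Ps Qs"
    using distinct_eigenvalues_diagonalizes[OF As(1) injs evs] .
  note U = upper_bidiagonal_diagonalizes[OF As injs Ds] and Ps = diagonalizesD[OF Ds]
  have AT: "transpose_mat A \<in> carrier_mat ?n ?n" using A by simp
  have UT: "upper_bidiagonal (transpose_mat A)" using A by (simp add: upper_bidiagonal_def)
  have nzA: "A $$ (Suc i, i) \<noteq> 0" if "i < d" for i
  proof -
    obtain \<rho> where \<rho>: "bij_betw \<rho> {..d} {..d}"
      "irreducible_tridiagonal d (\<lambda>i j. (Qs * (A * Ps)) $$ (\<rho> i, \<rho> j))"
      using idempotent_sequence_pattern[OF Ds injs[unfolded n] A(1) Is] .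
    \<comment> \<open>Transposition exchanges upper and lower, so that
      \<open>bidiagonal_pattern\<close> applies with the transpose of As in the role of A.\<close>
    have "irreducible_tridiagonal d (\<lambda>i j. (transpose_mat Ps * (transpose_mat A * transpose_mat Qs)) $$ (\<rho> i, \<rho> j))"
    proof -
      have "(transpose_mat Ps * (transpose_mat A * transpose_mat Qs)) $$ (\<rho> i, \<rho> j) = (Qs * (A * Ps)) $$ (\<rho> j, \<rho> i)"
        if "i \<le> d" "j \<le> d" for i j
      proof -
        have "\<rho> i < ?n" "\<rho> j < ?n" using \<rho>(1) that by (auto simp: bij_betw_def less_Suc_eq_le)
        then show ?thesis unfolding transpose_sandwich[OF Ps(1,2) A(1)] using Ps A by auto
      qed
      then show ?thesis
        using irreducible_tridiagonal_flip[OF \<rho>(2)] unfolding irreducible_tridiagonal_altdef by simp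
    qed
    from bidiagonal_pattern(2)[OF U(1,2,3) AT UT \<rho>(1) this that] show ?thesis
      using A that by simp
  qed
  obtain P where D: "diagonalizes ?n A ?\<theta> P (newton_matrix ?n A)"
    using newton_matrix_diagonalizes[OF A inj[unfolded n] nzA] .
  obtain \<rho> where \<rho>: "bij_betw \<rho> {..d} {..d}"
    "irreducible_tridiagonal d (\<lambda>i j. (newton_matrix ?n A * (As * P)) $$ (\<rho> i, \<rho> j))"
    using idempotent_sequence_pattern[OF D inj[unfolded n] As(1) I] .
  have T: "irreducible_tridiagonal d (\<lambda>i j. (newton_matrix ?n A * (As * P)) $$ (i, j))"
    using bidiagonal_pattern(1)[OF A(2) inj D As \<rho>] .
  have "\<exists>\<psi>. parameter_array d ?\<theta> ?\<theta>s (\<lambda>n. if n \<in> {1..d} then A $$ (n, n - 1) * As $$ (n - 1, n) else 0) \<psi>"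
    using T unfolding irreducible_tridiagonal_def
    by (intro band_imp_parameter_array[OF inj[unfolded n] injs[unfolded n]
          newton_matrix_split_action[OF A(1) As nzA D]]) auto
  then obtain \<psi> where "parameter_array d ?\<theta> ?\<theta>s (\<lambda>n. if n \<in> {1..d} then A $$ (n, n - 1) * As $$ (n - 1, n) else 0) \<psi>" ..
  then have "parameter_array d ?\<theta> ?\<theta>s (\<lambda>i. A $$ (i, i - 1) * As $$ (i - 1, i)) \<psi>"
    by (rule parameter_array_cong) auto
  then show ?thesis by (rule exI[of _ \<psi>])
qed

section \<open>Split sequences\<close>

text \<open>In the coordinates \<open>Q *\<^sub>v v\<close> each E h is a coordinate projection, so
  the sum of the images is a coordinate subspace. The relabelling \<open>\<sigma>\<close> covers
  both the given order of the idempotents and the reversed one.\<close>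

lemma sum_of_images_iff:
  fixes P Q :: "'a::field mat"
  assumes P: "P \<in> carrier_mat (d + 1) (d + 1)" and Q: "Q \<in> carrier_mat (d + 1) (d + 1)"
    and PQ: "P * Q = 1\<^sub>m (d + 1)" and I: "finite I" and inj: "inj_on \<sigma> I" and sub: "\<sigma> ` I \<subseteq> {..d}"
    and E: "\<And>h. h \<in> I \<Longrightarrow> E h = P * (mat_diag (d + 1) (\<lambda>k. if k = \<sigma> h then 1 else 0) * Q)"
  shows "v \<in> sum_of_images d E I \<longleftrightarrow>
    v \<in> carrier_vec (d + 1) \<and> (\<forall>k\<le>d. k \<notin> \<sigma> ` I \<longrightarrow> (Q *\<^sub>v v) $ k = 0)"
proof -
  define n where "n = d + 1"
  note P = P[folded n_def] and Q = Q[folded n_def] and PQ = PQ[folded n_def] and E = E[folded n_def]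
  have QP: "Q * P = 1\<^sub>m n" by (rule mat_mult_left_right_inverse[OF P Q PQ])
  let ?D = "\<lambda>h. mat_diag n (\<lambda>k. if k = \<sigma> h then 1 else (0::'a))"
  have Ecar: "E h \<in> carrier_mat n n" if "h \<in> I" for h
    unfolding E[OF that] by (rule mult_carrier_mat[OF P mult_carrier_mat[OF mat_diag_dim Q]])
  have D_idx: "(?D h *\<^sub>v x) $ k = (if k = \<sigma> h then x $ k else 0)" if x: "x \<in> carrier_vec n" and k: "k < n" for h k x
    unfolding index_mult_mat_vec_sum[OF mat_diag_dim x k]
    using k by (subst sum_eq_single[where k = k]) (auto simp: mat_diag_def)
  have Ev: "E h *\<^sub>v x = P *\<^sub>v (?D h *\<^sub>v (Q *\<^sub>v x))" if "h \<in> I" "x \<in> carrier_vec n" for h x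
    unfolding E[OF that(1)] using P Q that(2) mult_carrier_mat[OF mat_diag_dim Q]
    by (simp add: assoc_mult_mat_vec[of _ n n _ n])
  have fin: "finsum_vec TYPE('a) n (\<lambda>h. E h *\<^sub>v w h) I \<in> carrier_vec n" 
      "a < n \<Longrightarrow> finsum_vec TYPE('a) n (\<lambda>h. E h *\<^sub>v w h) I $ a = (\<Sum>h\<in>I. (E h *\<^sub>v w h) $ a)"
    if "\<forall>h\<in>I. w h \<in> carrier_vec n" for w a
  proof -
    have "(\<lambda>h. E h *\<^sub>v w h) \<in> I \<rightarrow> carrier_vec n" using that Ecar by (auto intro!: mult_mat_vec_carrier)
    then show "finsum_vec TYPE('a) n (\<lambda>h. E h *\<^sub>v w h) I \<in> carrier_vec n"
      "a < n \<Longrightarrow> finsum_vec TYPE('a) n (\<lambda>h. E h *\<^sub>v w h) I $ a = (\<Sum>h\<in>I. (E h *\<^sub>v w h) $ a)"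
      by (auto intro: finsum_vec_closed index_finsum_vec[OF I])
  qed
  show ?thesis
  proof
    assume "v \<in> sum_of_images d E I"
    then obtain w where w: "\<forall>h\<in>I. w h \<in> carrier_vec n" and v: "v = finsum_vec TYPE('a) n (\<lambda>h. E h *\<^sub>v w h) I"
      unfolding sum_of_images_def n_def by auto
    have car: "v \<in> carrier_vec n" unfolding v by (rule fin(1)[OF w])
    have "(Q *\<^sub>v v) $ k = 0" if k: "k \<le> d" "k \<notin> \<sigma> ` I" for k
    proof -
      have kn: "k < n" using k by (simp add: n_def)
      have "(Q *\<^sub>v v) $ k = (\<Sum>a<n. Q $$ (k, a) * (\<Sum>h\<in>I. (E h *\<^sub>v w h) $ a))"
        unfolding index_mult_mat_vec_sum[OF Q car kn] using fin(2)[OF w] by (intro sum.cong) (auto simp: v)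
      also have "\<dots> = (\<Sum>h\<in>I. \<Sum>a<n. Q $$ (k, a) * (E h *\<^sub>v w h) $ a)"
        by (simp add: sum_distrib_left sum.swap[of _ I])
      also have "\<dots> = 0"
      proof (rule sum.neutral, intro ballI)
        fix h assume h: "h \<in> I"
        have wh: "w h \<in> carrier_vec n" using w h by blast
        have Qw: "Q *\<^sub>v w h \<in> carrier_vec n" using Q wh by simp
        have DQw: "?D h *\<^sub>v (Q *\<^sub>v w h) \<in> carrier_vec n" by (rule mult_mat_vec_carrier[OF mat_diag_dim Qw])
        have "(\<Sum>a<n. Q $$ (k, a) * (E h *\<^sub>v w h) $ a) = (Q *\<^sub>v (E h *\<^sub>v w h)) $ k"
          using Ecar[OF h] wh by (intro index_mult_mat_vec_sum[OF Q _ kn, symmetric]) simp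
        also have "Q *\<^sub>v (E h *\<^sub>v w h) = (Q * P) *\<^sub>v (?D h *\<^sub>v (Q *\<^sub>v w h))"
          unfolding Ev[OF h wh] by (rule assoc_mult_mat_vec[OF Q P DQw, symmetric])
        also have "\<dots> = ?D h *\<^sub>v (Q *\<^sub>v w h)" unfolding QP by (rule one_mult_mat_vec[OF DQw])
        also have "\<dots> $ k = 0" using D_idx[OF Qw kn] h k by auto
        finally show "(\<Sum>a<n. Q $$ (k, a) * (E h *\<^sub>v w h) $ a) = 0" .
      qed
      finally show ?thesis .
    qed
    with car show "v \<in> carrier_vec (d + 1) \<and> (\<forall>k\<le>d. k \<notin> \<sigma> ` I \<longrightarrow> (Q *\<^sub>v v) $ k = 0)"
      unfolding n_def by blast
  next
    assume "v \<in> carrier_vec (d + 1) \<and> (\<forall>k\<le>d. k \<notin> \<sigma> ` I \<longrightarrow> (Q *\<^sub>v v) $ k = 0)"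
    then have car: "v \<in> carrier_vec n" and zero: "\<And>k. k \<le> d \<Longrightarrow> k \<notin> \<sigma> ` I \<Longrightarrow> (Q *\<^sub>v v) $ k = 0"
      unfolding n_def by auto
    have Qv: "Q *\<^sub>v v \<in> carrier_vec n" using Q car by simp
    have w: "\<forall>h\<in>I. v \<in> carrier_vec n" using car by blast
    \<comment> \<open>All summands may use v itself: the projections for I add up to the identity on
      vectors whose coordinates vanish off the image of I.\<close>
    have "finsum_vec TYPE('a) n (\<lambda>h. E h *\<^sub>v v) I = v"
    proof (rule eq_vecI)
      fix a assume "a < dim_vec v"
      then have a: "a < n" using car by simp
      have "(E h *\<^sub>v v) $ a = P $$ (a, \<sigma> h) * (Q *\<^sub>v v) $ (\<sigma> h)" if h: "h \<in> I" for h
      proof -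
        have \<sigma>h: "\<sigma> h < n" using sub h by (auto simp: n_def less_Suc_eq_le)
        have DQv: "?D h *\<^sub>v (Q *\<^sub>v v) \<in> carrier_vec n" by (rule mult_mat_vec_carrier[OF mat_diag_dim Qv])
        show ?thesis
          unfolding Ev[OF h car] index_mult_mat_vec_sum[OF P DQv a]
          using D_idx[OF Qv] \<sigma>h by (subst sum_eq_single[where k = "\<sigma> h"]) auto
      qed
      then have "finsum_vec TYPE('a) n (\<lambda>h. E h *\<^sub>v v) I $ a = (\<Sum>h\<in>I. P $$ (a, \<sigma> h) * (Q *\<^sub>v v) $ (\<sigma> h))"
        unfolding fin(2)[OF w a] by (intro sum.cong) auto
      also have "\<dots> = (\<Sum>k\<in>\<sigma> ` I. P $$ (a, k) * (Q *\<^sub>v v) $ k)"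
        by (simp add: sum.reindex[OF inj])
      also have "\<dots> = (\<Sum>k<n. P $$ (a, k) * (Q *\<^sub>v v) $ k)"
        using sub zero by (intro sum.mono_neutral_left) (auto simp: n_def less_Suc_eq_le)
      also have "\<dots> = (P *\<^sub>v (Q *\<^sub>v v)) $ a" by (rule index_mult_mat_vec_sum[OF P Qv a, symmetric])
      also have "P *\<^sub>v (Q *\<^sub>v v) = v"
        unfolding assoc_mult_mat_vec[OF P Q car, symmetric] PQ by (rule one_mult_mat_vec[OF car])
      finally show "finsum_vec TYPE('a) n (\<lambda>h. E h *\<^sub>v v) I $ a = v $ a" .
    next
      show "dim_vec (finsum_vec TYPE('a) n (\<lambda>h. E h *\<^sub>v v) I) = dim_vec v"
        using carrier_vecD[OF fin(1)[OF w]] carrier_vecD[OF car] by simp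
    qed
    then have "v = finsum_vec TYPE('a) (d + 1) (\<lambda>h. E h *\<^sub>v v) I" unfolding n_def by simp
    then show "v \<in> sum_of_images d E I"
      unfolding sum_of_images_def using w[unfolded n_def] by (intro CollectI exI[of _ "\<lambda>_. v"]) simp
  qed
qed

lemma newton_expansion:
  fixes p :: "'a::field poly"
  shows "degree p \<le> n \<Longrightarrow> \<exists>c. p = (\<Sum>m\<le>n. Polynomial.smult (c m) (newton_poly \<theta> m))"
proof (induction n arbitrary: p)
  case 0
  then obtain a where "p = [:a:]" using degree_eq_zeroE by blast
  then show ?case by (intro exI[of _ "\<lambda>_. a"]) simp
next
  case (Suc n)
  let ?q = "p - Polynomial.smult (coeff p (Suc n)) (newton_poly \<theta> (Suc n))"
  have "degree ?q \<le> n" using Suc.prems by (intro degree_diff_top) auto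
  then obtain c where c: "?q = (\<Sum>m\<le>n. Polynomial.smult (c m) (newton_poly \<theta> m))" using Suc.IH by blast
  define c' where "c' = c(Suc n := coeff p (Suc n))"
  have "(\<Sum>m\<le>Suc n. Polynomial.smult (c' m) (newton_poly \<theta> m)) =
      (\<Sum>m\<le>n. Polynomial.smult (c m) (newton_poly \<theta> m)) + Polynomial.smult (coeff p (Suc n)) (newton_poly \<theta> (Suc n))"
    by (simp add: c'_def)
  then have "p = (\<Sum>m\<le>Suc n. Polynomial.smult (c' m) (newton_poly \<theta> m))" unfolding c[symmetric] by simp
  then show ?case by (rule exI[of _ c'])
qed

lemma index_minus_smult_carrier:
  "v \<in> carrier_vec n \<Longrightarrow> w \<in> carrier_vec n \<Longrightarrow> i < n \<Longrightarrow> (v - c \<cdot>\<^sub>v w) $ i = v $ i - c * w $ i"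
  unfolding carrier_vec_def by simp

lemma mult_inverse_cancel_vec:
  fixes P :: "'a::field mat"
  assumes "P \<in> carrier_mat n n" "Q \<in> carrier_mat n n" "P * Q = 1\<^sub>m n" "v \<in> carrier_vec n"
  shows "P *\<^sub>v (Q *\<^sub>v v) = v"
  unfolding assoc_mult_mat_vec[OF assms(1,2,4), symmetric] assms(3) by (rule one_mult_mat_vec[OF assms(4)])

lemma shifted_mult_vec:
  fixes M :: "'a::field mat"
  assumes "M \<in> carrier_mat n n" "v \<in> carrier_vec n"
  shows "(M - x \<cdot>\<^sub>m 1\<^sub>m n) *\<^sub>v v = M *\<^sub>v v - x \<cdot>\<^sub>v v"
proof -
  have "(x \<cdot>\<^sub>m 1\<^sub>m n) *\<^sub>v v = x \<cdot>\<^sub>v v"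
  proof (rule eq_vecI)
    fix i assume "i < dim_vec (x \<cdot>\<^sub>v v)"
    then have i: "i < n" using assms(2) by simp
    have x1: "x \<cdot>\<^sub>m 1\<^sub>m n \<in> carrier_mat n n" by simp
    have "((x \<cdot>\<^sub>m 1\<^sub>m n) *\<^sub>v v) $ i = (x \<cdot>\<^sub>m 1\<^sub>m n) $$ (i, i) * v $ i"
      unfolding index_mult_mat_vec_sum[OF x1 assms(2) i] using i by (intro sum_eq_single) auto
    then show "((x \<cdot>\<^sub>m 1\<^sub>m n) *\<^sub>v v) $ i = (x \<cdot>\<^sub>v v) $ i" using i assms(2) by simp
  qed (use assms(2) in auto)
  moreover have "(M - x \<cdot>\<^sub>m 1\<^sub>m n) *\<^sub>v v = M *\<^sub>v v - (x \<cdot>\<^sub>m 1\<^sub>m n) *\<^sub>v v"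
    using assms by (intro minus_mult_distrib_mat_vec) auto
  ultimately show ?thesis by simp
qed

lemma shifted_product_mult_vec:
  fixes M N :: "'a::field mat"
  assumes M: "M \<in> carrier_mat n n" and N: "N \<in> carrier_mat n n" and v: "v \<in> carrier_vec n"
  shows "((M - x \<cdot>\<^sub>m 1\<^sub>m n) * (N - y \<cdot>\<^sub>m 1\<^sub>m n)) *\<^sub>v v =
    M *\<^sub>v (N *\<^sub>v v - y \<cdot>\<^sub>v v) - x \<cdot>\<^sub>v (N *\<^sub>v v - y \<cdot>\<^sub>v v)"
proof -
  have w: "N *\<^sub>v v - y \<cdot>\<^sub>v v \<in> carrier_vec n" using N v by simp
  have "((M - x \<cdot>\<^sub>m 1\<^sub>m n) * (N - y \<cdot>\<^sub>m 1\<^sub>m n)) *\<^sub>v v = (M - x \<cdot>\<^sub>m 1\<^sub>m n) *\<^sub>v ((N - y \<cdot>\<^sub>m 1\<^sub>m n) *\<^sub>v v)"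
    using M N v by (intro assoc_mult_mat_vec[of _ n n _ n]) auto
  then show ?thesis unfolding shifted_mult_vec[OF N v] shifted_mult_vec[OF M w] .
qed

lemma eigenvalue_sequence_cong:
  fixes A :: "'a::field mat"
  assumes D: "diagonalizes (d + 1) A \<mu> P Q" and inj: "inj_on \<mu> {..d}"
    and eq: "\<And>i. i \<le> d \<Longrightarrow> \<mu> i = \<mu>' i"
  shows "eigenvalue_sequence d A (primitive_idempotent d A \<mu>) \<mu>'"
proof -
  have D': "diagonalizes (d + 1) A \<mu>' P Q" using eq by (intro diagonalizes_cong[OF D]) auto
  have inj': "inj_on \<mu>' {..d}" using inj eq by (auto simp: inj_on_def)
  have "primitive_idempotent d A \<mu> i = primitive_idempotent d A \<mu>' i" if "i \<le> d" for i
    unfolding diagonalizes_idempotent[OF D inj that] diagonalizes_idempotent[OF D' inj' that] ..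
  with diagonalizes_eigenvalue_sequence[OF D' inj'] show ?thesis
    unfolding eigenvalue_sequence_def by simp
qed

lemma eigenvalue_sequence_reverse:
  fixes A :: "'a::field mat"
  assumes D: "diagonalizes (d + 1) A \<mu> P Q" and inj: "inj_on \<mu> {..d}"
  shows "eigenvalue_sequence d A (\<lambda>i. primitive_idempotent d A \<mu> (d - i)) (\<lambda>i. \<mu> (d - i))"
proof -
  let ?r = "\<lambda>i. \<mu> (d - i)"
  note inj' = inj_on_reverse[OF inj]
  have im: "?r ` {..d} = \<mu> ` {..d}"
  proof -
    have "(\<lambda>i. d - i) ` {..d} = {..d}"
    proof (intro equalityI subsetI)
      fix k assume "k \<in> {..d}"
      then show "k \<in> (\<lambda>i. d - i) ` {..d}" by (intro image_eqI[of _ _ "d - k"]) auto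
    qed auto
    then show ?thesis by (metis image_image)
  qed
  have "primitive_idempotent d A \<mu> (d - i) = primitive_idempotent d A ?r i" if "i \<le> d" for i
    using primitive_idempotent_diagonalizes[OF D inj, of "d - i"]
      primitive_idempotent_diagonalizes[OF D inj', of i] that im by simp
  moreover have "bij_betw ?r {0..d} {x. eigenvalue A x}"
    using inj' im unfolding diagonalizes_eigenvalues[OF D]
    by (simp add: bij_betw_def atLeast0AtMost lessThan_Suc_atMost)
  ultimately show ?thesis unfolding eigenvalue_sequence_def by blast
qed

text \<open>P and Q are block triangular with respect to I, so both preserve the coordinate subspace
  of I, and eigenvector coordinates may be exchanged for standard ones. With \<open>{0..i}\<close>
  for As and \<open>{i..d}\<close> for A, the split space becomes the i-th coordinate axis.\<close>

lemma sum_of_images_triangular: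
  fixes A :: "'a::field mat"
  assumes D: "diagonalizes (d + 1) A \<mu> P Q" and inj: "inj_on \<mu> {..d}" and I: "I \<subseteq> {..d}"
    and zero: "\<And>k j. k \<le> d \<Longrightarrow> k \<notin> I \<Longrightarrow> j \<in> I \<Longrightarrow> P $$ (k, j) = 0 \<and> Q $$ (k, j) = 0"
  shows "u \<in> sum_of_images d (primitive_idempotent d A \<mu>) I \<longleftrightarrow>
    u \<in> carrier_vec (d + 1) \<and> (\<forall>k\<le>d. k \<notin> I \<longrightarrow> u $ k = 0)"
proof -
  note P = diagonalizesD[OF D]
  have "u \<in> sum_of_images d (primitive_idempotent d A \<mu>) I \<longleftrightarrow>
    u \<in> carrier_vec (d + 1) \<and> (\<forall>k\<le>d. k \<notin> id ` I \<longrightarrow> (Q *\<^sub>v u) $ k = 0)"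
    using I finite_subset[OF I] diagonalizes_idempotent[OF D inj]
    by (intro sum_of_images_iff[OF P(1,2,3)]) auto
  also have "\<dots> \<longleftrightarrow> u \<in> carrier_vec (d + 1) \<and> (\<forall>k\<le>d. k \<notin> I \<longrightarrow> u $ k = 0)"
  proof (intro conj_cong refl)
    assume u: "u \<in> carrier_vec (d + 1)"
    have Qu: "Q *\<^sub>v u \<in> carrier_vec (d + 1)" by (rule mult_mat_vec_carrier[OF P(2) u])
    have support: "(M *\<^sub>v v) $ k = 0"
      if "M \<in> carrier_mat (d + 1) (d + 1)" "v \<in> carrier_vec (d + 1)" "k \<le> d" "k \<notin> I"
        "\<And>j. j \<in> I \<Longrightarrow> M $$ (k, j) = 0" "\<forall>k\<le>d. k \<notin> I \<longrightarrow> v $ k = 0" for M :: "'a mat" and v k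
    proof -
      have "(M *\<^sub>v v) $ k = (\<Sum>j<d + 1. M $$ (k, j) * v $ j)"
        using that by (intro index_mult_mat_vec_sum) auto
      also have "\<dots> = 0" using that by (intro sum.neutral) (auto simp: less_Suc_eq_le)
      finally show ?thesis .
    qed
    show "(\<forall>k\<le>d. k \<notin> id ` I \<longrightarrow> (Q *\<^sub>v u) $ k = 0) \<longleftrightarrow> (\<forall>k\<le>d. k \<notin> I \<longrightarrow> u $ k = 0)"
      using support[OF P(2) u] support[OF P(1) Qu] zero
      unfolding mult_inverse_cancel_vec[OF P(1,2,3) u] image_id by auto
  qed
  finally show ?thesis .
qed

text \<open>On the i-th axis, the shifted As steps down to axis i - 1 with factor
  \<open>As $$ (i - 1, i)\<close>, and the shifted A steps back up with factor
  \<open>A $$ (i, i - 1)\<close>.\<close>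

lemma bidiagonal_first_split:
  fixes A As :: "'a::field mat"
  assumes A: "A \<in> carrier_mat n n" "lower_bidiagonal A"
    and As: "As \<in> carrier_mat n n" "upper_bidiagonal As"
    and i: "0 < i" "i < n" and u: "u \<in> carrier_vec n" "\<And>k. k < n \<Longrightarrow> k \<noteq> i \<Longrightarrow> u $ k = 0"
  shows "((A - A $$ (i - 1, i - 1) \<cdot>\<^sub>m 1\<^sub>m n) * (As - As $$ (i, i) \<cdot>\<^sub>m 1\<^sub>m n)) *\<^sub>v u =
    (A $$ (i, i - 1) * As $$ (i - 1, i)) \<cdot>\<^sub>v u"
proof -
  define w where "w = As *\<^sub>v u - As $$ (i, i) \<cdot>\<^sub>v u"
  have w: "w \<in> carrier_vec n" using As u by (simp add: w_def)
  have w_idx: "w $ h = (if h = i - 1 then As $$ (i - 1, i) * u $ i else 0)" if h: "h < n" for h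
  proof -
    have "(As *\<^sub>v u) $ h = As $$ (h, i) * u $ i"
      unfolding index_mult_mat_vec_sum[OF As(1) u(1) h] using i u(2) by (intro sum_eq_single) auto
    then have "w $ h = As $$ (h, i) * u $ i - As $$ (i, i) * u $ h" 
      using h As u by (simp add: w_def)
    then show ?thesis using upper_bidiagonal_entry[OF As(2,1) h i(2)] u(2)[OF h] i by (cases "h = i") auto
  qed
  have "A *\<^sub>v w - A $$ (i - 1, i - 1) \<cdot>\<^sub>v w = (A $$ (i, i - 1) * As $$ (i - 1, i)) \<cdot>\<^sub>v u"
  proof (rule eq_vecI)
    fix h assume "h < dim_vec ((A $$ (i, i - 1) * As $$ (i - 1, i)) \<cdot>\<^sub>v u)"
    then have h: "h < n" using u(1) by simp
    have i1: "i - 1 < n" using i by simp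
    have "(A *\<^sub>v w) $ h = A $$ (h, i - 1) * w $ (i - 1)"
      unfolding index_mult_mat_vec_sum[OF A(1) w h] using i w_idx by (intro sum_eq_single) auto
    then have "(A *\<^sub>v w - A $$ (i - 1, i - 1) \<cdot>\<^sub>v w) $ h =
        A $$ (h, i - 1) * w $ (i - 1) - A $$ (i - 1, i - 1) * w $ h"
      using h A w by simp
    also have "\<dots> = A $$ (i, i - 1) * As $$ (i - 1, i) * u $ h"
    proof (cases "h = i - 1")
      case True
      then show ?thesis using u(2)[OF h] i by simp
    next
      case False
      then show ?thesis
        using lower_bidiagonal_entry[OF A(2,1) h i1] w_idx[OF h] w_idx[OF i1] u(2)[OF h] i by (cases "h = i") auto
    qed
    finally show "(A *\<^sub>v w - A $$ (i - 1, i - 1) \<cdot>\<^sub>v w) $ h = ((A $$ (i, i - 1) * As $$ (i - 1, i)) \<cdot>\<^sub>v u) $ h"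
      using h u(1) by simp
  qed (use A w u in auto)
  then show ?thesis unfolding shifted_product_mult_vec[OF A(1) As(1) u(1)] w_def .
qed

text \<open>The reversed order does not fit the triangular shape, so the condition stays in the
  coordinates \<open>Q *\<^sub>v u\<close>. With Q the Newton matrix it will say that a polynomial
  vanishes at the last i points.\<close>

lemma sum_of_images_reverse:
  fixes A :: "'a::field mat"
  assumes inj: "inj_on (\<lambda>i. A $$ (i, i)) {..d}"
    and D: "diagonalizes (d + 1) A (\<lambda>i. A $$ (i, i)) P Q" and i: "i \<le> d"
  shows "u \<in> sum_of_images d (\<lambda>h. primitive_idempotent d A (\<lambda>i. A $$ (i, i)) (d - h)) {i..d} \<longleftrightarrow>
    u \<in> carrier_vec (d + 1) \<and> (\<forall>k\<le>d. d - i < k \<longrightarrow> (Q *\<^sub>v u) $ k = 0)"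
proof -
  note P = diagonalizesD[OF D]
  have im: "(\<lambda>h. d - h) ` {i..d} = {0..d - i}"
  proof (intro equalityI subsetI)
    fix k assume "k \<in> {0..d - i}"
    then show "k \<in> (\<lambda>h. d - h) ` {i..d}" using i by (intro image_eqI[of _ _ "d - k"]) auto
  qed auto
  have "u \<in> sum_of_images d (\<lambda>h. primitive_idempotent d A (\<lambda>i. A $$ (i, i)) (d - h)) {i..d} \<longleftrightarrow>
    u \<in> carrier_vec (d + 1) \<and> (\<forall>k\<le>d. k \<notin> (\<lambda>h. d - h) ` {i..d} \<longrightarrow> (Q *\<^sub>v u) $ k = 0)"
  proof (rule sum_of_images_iff[OF P(1,2,3)])
    show "inj_on (\<lambda>h. d - h) {i..d}" by (auto simp: inj_on_def)
    show "primitive_idempotent d A (\<lambda>i. A $$ (i, i)) (d - h) =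
        P * (mat_diag (d + 1) (\<lambda>k. if k = d - h then 1 else 0) * Q)" for h
      by (rule diagonalizes_idempotent[OF D inj]) simp
  qed auto
  then show ?thesis unfolding im by (simp add: not_le)
qed

lemma newton_matrix_mult_vec:
  fixes A :: "'a::field mat"
  assumes u: "u \<in> carrier_vec (d + 1)" "\<And>k. i < k \<Longrightarrow> k \<le> d \<Longrightarrow> u $ k = 0" and i: "i \<le> d" and j: "j \<le> d"
  shows "(newton_matrix (d + 1) A *\<^sub>v u) $ j = poly (\<Sum>k\<le>i. Polynomial.smult
    (u $ k / (\<Prod>l<k. A $$ (Suc l, l))) (newton_poly (\<lambda>i. A $$ (i, i)) k)) (A $$ (j, j))"
proof -
  let ?G = "newton_matrix (d + 1) A"
  have G: "?G \<in> carrier_mat (d + 1) (d + 1)" by (simp add: newton_matrix_def)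
  have jn: "j < d + 1" using j by simp
  have "(?G *\<^sub>v u) $ j = (\<Sum>k<d + 1. ?G $$ (j, k) * u $ k)" by (rule index_mult_mat_vec_sum[OF G u(1) jn])
  also have "\<dots> = (\<Sum>k\<le>i. ?G $$ (j, k) * u $ k)"
    using i u(2) by (intro sum.mono_neutral_right) (auto simp: not_le)
  also have "\<dots> = (\<Sum>k\<le>i. u $ k / (\<Prod>l<k. A $$ (Suc l, l)) * poly (newton_poly (\<lambda>i. A $$ (i, i)) k) (A $$ (j, j)))"
    using i j by (intro sum.cong) (auto simp: newton_matrix_def)
  finally show ?thesis by (simp add: poly_sum)
qed

text \<open>A vector of the i-th reversed split space is a polynomial of degree at most i that
  vanishes at the last i points, hence a multiple of the reversed Newton polynomial e_i. The shifted
  As sends e_i to \<psi>_i e_(i-1) by the second split form, and multiplication by x -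
  \<theta>_(d-i+1) restores e_i.\<close>

lemma bidiagonal_second_split:
  fixes A As :: "'a::field mat"
  assumes A: "A \<in> carrier_mat (d + 1) (d + 1)" and As: "As \<in> carrier_mat (d + 1) (d + 1)"
    and inj: "inj_on (\<lambda>i. A $$ (i, i)) {..d}"
    and D: "diagonalizes (d + 1) A (\<lambda>i. A $$ (i, i)) P (newton_matrix (d + 1) A)"
    and split: "split_action d (\<lambda>i. A $$ (d - i, d - i)) \<theta>s \<psi>
      (\<lambda>i j. (newton_matrix (d + 1) A * (As * P)) $$ (d - i, d - j))"
    and i: "0 < i" "i \<le> d"
    and u: "u \<in> carrier_vec (d + 1)" "\<And>k. i < k \<Longrightarrow> k \<le> d \<Longrightarrow> u $ k = 0"
      "\<And>k. d - i < k \<Longrightarrow> k \<le> d \<Longrightarrow> (newton_matrix (d + 1) A *\<^sub>v u) $ k = 0"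
  shows "((A - A $$ (d - (i - 1), d - (i - 1)) \<cdot>\<^sub>m 1\<^sub>m (d + 1)) * (As - \<theta>s i \<cdot>\<^sub>m 1\<^sub>m (d + 1))) *\<^sub>v u = \<psi> i \<cdot>\<^sub>v u"
proof -
  define n where "n = d + 1"
  let ?\<theta> = "\<lambda>i. A $$ (i, i)" and ?x = "A $$ (d - (i - 1), d - (i - 1))"
  define G where "G = newton_matrix n A"
  note A = A[folded n_def] and As = As[folded n_def] and u1 = u(1)[folded n_def]
  note P = diagonalizesD[OF D, folded n_def, folded G_def]
  define t where "t = G * (As * P)"
  let ?e = "newton_poly (\<lambda>k. A $$ (d - k, d - k))"
  have t: "t \<in> carrier_mat n n" unfolding t_def by (rule mult_carrier_mat[OF P(2) mult_carrier_mat[OF As P(1)]])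
  have Gu: "G *\<^sub>v u \<in> carrier_vec n" by (rule mult_mat_vec_carrier[OF P(2) u1])
  define p where "p = (\<Sum>k\<le>i. Polynomial.smult (u $ k / (\<Prod>l<k. A $$ (Suc l, l))) (newton_poly ?\<theta> k))"
  have deg: "degree p \<le> i"
    unfolding p_def by (intro degree_sum_le order.trans[OF degree_smult_le]) auto
  have z: "(G *\<^sub>v u) $ j = poly p (?\<theta> j)" if "j \<le> d" for j
    unfolding G_def n_def p_def by (rule newton_matrix_mult_vec[OF u(1,2) i(2) that])
  have "p = Polynomial.smult (coeff p i) (?e i)"
  proof (rule poly_eq_reverse_newton[OF inj i(2) deg])
    fix j assume "d - i < j" "j \<le> d"
    then show "poly p (?\<theta> j) = 0" using u(3) z unfolding G_def n_def by metis
  qed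
  then have p: "poly p x = coeff p i * poly (?e i) x" for x by (metis poly_smult)
  have act: "(\<Sum>k<n. t $$ (j, k) * poly (?e i) (?\<theta> k)) =
      \<theta>s i * poly (?e i) (?\<theta> j) + \<psi> i * poly (?e (i - 1)) (?\<theta> j)" if j: "j \<le> d" for j
  proof -
    have "act d (\<lambda>i. A $$ (d - i, d - i)) (\<lambda>i j. t $$ (d - i, d - j)) (?e i) (d - j) =
        \<theta>s i * poly (?e i) (A $$ (d - (d - j), d - (d - j))) + \<psi> i * poly (?e (i - 1)) (A $$ (d - (d - j), d - (d - j)))"
      using split i j unfolding split_action_def t_def G_def n_def by auto
    moreover have "act d (\<lambda>i. A $$ (d - i, d - i)) (\<lambda>i j. t $$ (d - i, d - j)) (?e i) (d - j) =
        act d ?\<theta> (\<lambda>i j. t $$ (i, j)) (?e i) j"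
      using act_reverse[of d ?\<theta> "\<lambda>i j. t $$ (i, j)" "?e i" "d - j"] j by simp
    moreover have "{..d} = {..<n}" by (auto simp: n_def)
    ultimately show ?thesis using j unfolding act_def by simp
  qed
  have e_Suc: "poly (?e i) x = (x - ?x) * poly (?e (i - 1)) x" for x
    using poly_newton_poly_Suc[of "\<lambda>k. A $$ (d - k, d - k)" "i - 1" x] i by simp
  define w where "w = As *\<^sub>v u - \<theta>s i \<cdot>\<^sub>v u"
  have w: "w \<in> carrier_vec n" using As u1 by (simp add: w_def)
  have Gw: "G *\<^sub>v w \<in> carrier_vec n" by (rule mult_mat_vec_carrier[OF P(2) w])
  have GAs: "G *\<^sub>v (As *\<^sub>v u) = t *\<^sub>v (G *\<^sub>v u)"
  proof -
    have "t *\<^sub>v (G *\<^sub>v u) = G *\<^sub>v (As *\<^sub>v (P *\<^sub>v (G *\<^sub>v u)))"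
      unfolding t_def using assoc_mult_mat_vec[OF P(2) mult_carrier_mat[OF As P(1)] Gu]
        assoc_mult_mat_vec[OF As P(1) Gu] by simp
    then show ?thesis unfolding mult_inverse_cancel_vec[OF P(1,2,3) u1] by simp
  qed
  have Gw_idx: "(G *\<^sub>v w) $ j = coeff p i * (\<psi> i * poly (?e (i - 1)) (?\<theta> j))" if j: "j \<le> d" for j
  proof -
    have jn: "j < n" using j by (simp add: n_def)
    have "G *\<^sub>v w = G *\<^sub>v (As *\<^sub>v u) - G *\<^sub>v (\<theta>s i \<cdot>\<^sub>v u)"
      unfolding w_def using As u1 by (intro mult_minus_distrib_mat_vec[OF P(2)]) auto
    also have "G *\<^sub>v (\<theta>s i \<cdot>\<^sub>v u) = \<theta>s i \<cdot>\<^sub>v (G *\<^sub>v u)" by (rule mult_mat_vec[OF P(2) u1])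
    finally have "(G *\<^sub>v w) $ j = (t *\<^sub>v (G *\<^sub>v u)) $ j - \<theta>s i * (G *\<^sub>v u) $ j"
      unfolding GAs using index_minus_smult_carrier[OF mult_mat_vec_carrier[OF t Gu] Gu jn] by simp
    also have "(t *\<^sub>v (G *\<^sub>v u)) $ j = (\<Sum>k<n. t $$ (j, k) * (G *\<^sub>v u) $ k)"
      by (rule index_mult_mat_vec_sum[OF t Gu jn])
    also have "\<dots> = (\<Sum>k<n. coeff p i * (t $$ (j, k) * poly (?e i) (?\<theta> k)))"
      using z p by (intro sum.cong) (auto simp: n_def)
    also have "\<dots> = coeff p i * (\<theta>s i * poly (?e i) (?\<theta> j) + \<psi> i * poly (?e (i - 1)) (?\<theta> j))"
      unfolding sum_distrib_left[symmetric] act[OF j] ..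
    finally show ?thesis unfolding z[OF j] p by (simp only: algebra_simps) simp
  qed
  define v where "v = A *\<^sub>v w - ?x \<cdot>\<^sub>v w"
  have v: "v \<in> carrier_vec n" using A w by (simp add: v_def)
  have "G *\<^sub>v v = \<psi> i \<cdot>\<^sub>v (G *\<^sub>v u)"
  proof (rule eq_vecI)
    fix j assume "j < dim_vec (\<psi> i \<cdot>\<^sub>v (G *\<^sub>v u))"
    then have jn: "j < n" using Gu P(2) by simp
    then have j: "j \<le> d" by (simp add: n_def)
    have "G *\<^sub>v v = G *\<^sub>v (A *\<^sub>v w) - G *\<^sub>v (?x \<cdot>\<^sub>v w)"
      unfolding v_def using A w by (intro mult_minus_distrib_mat_vec[OF P(2)]) auto
    also have "G *\<^sub>v (?x \<cdot>\<^sub>v w) = ?x \<cdot>\<^sub>v (G *\<^sub>v w)" by (rule mult_mat_vec[OF P(2) w])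
    also have "G *\<^sub>v (A *\<^sub>v w) = mat_diag n ?\<theta> *\<^sub>v (G *\<^sub>v w)"
      unfolding assoc_mult_mat_vec[OF P(2) A w, symmetric] assoc_mult_mat_vec[OF mat_diag_dim P(2) w, symmetric]
        diagonalizes_left[OF D, folded n_def, folded G_def] ..
    finally have "(G *\<^sub>v v) $ j = (mat_diag n ?\<theta> *\<^sub>v (G *\<^sub>v w)) $ j - ?x * (G *\<^sub>v w) $ j"
      using index_minus_smult_carrier[OF mult_mat_vec_carrier[OF mat_diag_dim Gw] Gw jn] by simp
    also have "(mat_diag n ?\<theta> *\<^sub>v (G *\<^sub>v w)) $ j = ?\<theta> j * (G *\<^sub>v w) $ j"
      unfolding index_mult_mat_vec_sum[OF mat_diag_dim Gw jn]
      using jn by (subst sum_eq_single[where k = j]) (auto simp: mat_diag_def)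
    also have "?\<theta> j * (G *\<^sub>v w) $ j - ?x * (G *\<^sub>v w) $ j = \<psi> i * (G *\<^sub>v u) $ j"
      unfolding Gw_idx[OF j] z[OF j] p e_Suc by (simp add: algebra_simps)
    finally show "(G *\<^sub>v v) $ j = (\<psi> i \<cdot>\<^sub>v (G *\<^sub>v u)) $ j" using index_smult_carrier[OF Gu jn] by simp
  qed (use P(2) in auto)
  then have "P *\<^sub>v (G *\<^sub>v v) = \<psi> i \<cdot>\<^sub>v (P *\<^sub>v (G *\<^sub>v u))"
    using mult_mat_vec[OF P(1) Gu] by simp
  then have "v = \<psi> i \<cdot>\<^sub>v u"
    unfolding mult_inverse_cancel_vec[OF P(1,2,3) u1] mult_inverse_cancel_vec[OF P(1,2,3) v] .
  then show ?thesis
    unfolding n_def[symmetric] shifted_product_mult_vec[OF A As u1] v_def w_def .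
qed

section \<open>From parameter arrays to designated Leonard systems, and uniqueness\<close>

text \<open>The Leonard property is obtained for the diagonal order of both spectra, so the system
  constructed is the designated one, and it remains to compute its two split sequences.\<close>

lemma parameter_array_imp_Leonard_pair:
  fixes A As :: "'a::field mat"
  assumes A: "A \<in> carrier_mat (d + 1) (d + 1)" "lower_bidiagonal A"
    and As: "As \<in> carrier_mat (d + 1) (d + 1)" "upper_bidiagonal As"
    and par: "parameter_array d \<theta> \<theta>s \<phi> \<psi>" and matches: "matches_entries d A As \<theta> \<theta>s \<phi>"
  shows "Leonard_pair d A As \<and> designated_parameter_array d A As \<theta> \<theta>s \<phi> \<psi>"
proof -
  let ?n = "d + 1" and ?th = "\<lambda>i. A $$ (i, i)" and ?ths = "\<lambda>i. As $$ (i, i)"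
  let ?G = "newton_matrix ?n A"
  have n: "{..<?n} = {..d}" by auto
  have th: "\<theta> i = ?th i" "\<theta>s i = ?ths i" if "i \<le> d" for i
    using matches that unfolding matches_entries_def by auto
  have ph: "\<phi> i = A $$ (i, i - 1) * As $$ (i - 1, i)" if "i \<in> {1..d}" for i
    using matches that unfolding matches_entries_def by simp
  have par': "parameter_array d ?th ?ths (\<lambda>i. A $$ (i, i - 1) * As $$ (i - 1, i)) \<psi>"
    using th ph by (intro parameter_array_cong[OF par]) auto
  have inj: "inj_on ?th {..d}" and injs: "inj_on ?ths {..d}"
    using par' unfolding parameter_array_def inj_on_def by auto
  have nzA: "A $$ (Suc i, i) \<noteq> 0" if "i < d" for i
  proof -
    have "Suc i \<in> {1..d}" using that by simp
    then have "A $$ (Suc i, Suc i - 1) * As $$ (Suc i - 1, Suc i) \<noteq> 0"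
      using par' unfolding parameter_array_def by blast
    then show ?thesis by auto
  qed
  obtain P where D: "diagonalizes ?n A ?th P ?G"
    using newton_matrix_diagonalizes[OF A inj nzA] .
  note split = newton_matrix_split_action[OF A(1) As nzA D]
  note band = parameter_array_imp_band[OF par' split]
  have T: "irreducible_tridiagonal d (\<lambda>i j. (?G * (As * P)) $$ (i, j))"
    using band(1,2) unfolding irreducible_tridiagonal_def by blast
  have evs: "eigenvalue As (?ths i)" if i: "i < ?n" for i
  proof -
    have "upper_triangular As"
      using upper_bidiagonal_entry[OF As(2,1)] As(1) by (auto simp: upper_triangular_def)
    then have "char_poly As = (\<Prod>a\<leftarrow>diag_mat As. [:- a, 1:])" by (rule char_poly_upper_triangular[OF As(1)])
    moreover have "?ths i \<in> set (diag_mat As)" using As(1) i by (auto simp: diag_mat_def simp del: upt_Suc)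
    ultimately have "poly (char_poly As) (?ths i) = 0" by (force simp: poly_prod_list prod_list_zero_iff)
    then show ?thesis using eigenvalue_root_char_poly[OF As(1)] by blast
  qed
  obtain Ps Qs where Ds: "diagonalizes ?n As ?ths Ps Qs"
    using distinct_eigenvalues_diagonalizes[OF As(1) injs[folded n] evs] .
  have Ts: "irreducible_tridiagonal d (\<lambda>i j. (Qs * (A * Ps)) $$ (i, j))"
    by (rule dual_irreducible_tridiagonal[OF A As nzA D injs Ds T])
  define E where "E = primitive_idempotent d A ?th"
  define Es where "Es = primitive_idempotent d As ?ths"
  have mf: "multiplicity_free d A" "multiplicity_free d As"
    unfolding multiplicity_free_def diagonalizes_eigenvalues[OF D] diagonalizes_eigenvalues[OF Ds]
    using A(1) As(1) inj injs by (auto simp only: n card_image) auto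
  have I: "idempotent_sequence d A As E" "idempotent_sequence d As A Es"
    unfolding E_def Es_def
    using pattern_imp_idempotent_sequence[OF D inj As(1) T] pattern_imp_idempotent_sequence[OF Ds injs A(1) Ts]
    by auto
  have ES: "eigenvalue_sequence d A E ?th" "eigenvalue_sequence d As Es ?ths"
    "eigenvalue_sequence d A (\<lambda>i. E (d - i)) (\<lambda>i. ?th (d - i))"
    unfolding E_def Es_def
    using diagonalizes_eigenvalue_sequence[OF D inj] diagonalizes_eigenvalue_sequence[OF Ds injs]
      eigenvalue_sequence_reverse[OF D inj] by auto
  have ES': "eigenvalue_sequence d A E \<theta>" "eigenvalue_sequence d As Es \<theta>s"
    unfolding E_def Es_def
    using th by (auto intro: eigenvalue_sequence_cong[OF D inj] eigenvalue_sequence_cong[OF Ds injs])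
  note L = lower_bidiagonal_diagonalizes(1,2)[OF A(2) inj[folded n] D]
    and U = upper_bidiagonal_diagonalizes(4,5)[OF As injs[folded n] Ds]
  have image_Es: "u \<in> sum_of_images d Es {0..i} \<longleftrightarrow>
      u \<in> carrier_vec ?n \<and> (\<forall>k\<le>d. i < k \<longrightarrow> u $ k = 0)" if "i \<le> d" for i u
  proof -
    have "u \<in> sum_of_images d Es {0..i} \<longleftrightarrow> u \<in> carrier_vec ?n \<and> (\<forall>k\<le>d. k \<notin> {0..i} \<longrightarrow> u $ k = 0)"
      unfolding Es_def using U that by (intro sum_of_images_triangular[OF Ds injs]) auto
    then show ?thesis by (simp add: not_le)
  qed
  have first: "first_split_sequence d A As E Es \<phi>"
    unfolding first_split_sequence_def
  proof (rule exI[of _ ?th], rule exI[of _ ?ths], intro conjI ES(1,2) ballI)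
    fix i assume i: "i \<in> {1..d}"
    have mem: "u \<in> split_space d E Es i \<longleftrightarrow> u \<in> carrier_vec ?n \<and> (\<forall>k\<le>d. k \<noteq> i \<longrightarrow> u $ k = 0)" for u
    proof -
      have "u \<in> sum_of_images d E {i..d} \<longleftrightarrow> u \<in> carrier_vec ?n \<and> (\<forall>k\<le>d. k \<notin> {i..d} \<longrightarrow> u $ k = 0)"
        unfolding E_def using L by (intro sum_of_images_triangular[OF D inj]) auto
      then show ?thesis
        unfolding split_space_def Int_iff using image_Es[of i u] i by (auto simp: nat_neq_iff)
    qed
    show "\<exists>u\<in>split_space d E Es i. u \<noteq> 0\<^sub>v (d + 1)"
    proof (rule bexI)
      show "unit_vec ?n i \<in> split_space d E Es i" unfolding mem using i by auto
      show "unit_vec ?n i \<noteq> (0\<^sub>v ?n :: 'a vec)" using i by (intro unit_vec_nonzero) simp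
    qed
    fix u assume "u \<in> split_space d E Es i"
    then have u: "u \<in> carrier_vec ?n" "\<And>k. k < ?n \<Longrightarrow> k \<noteq> i \<Longrightarrow> u $ k = 0" unfolding mem by auto
    show "((A - ?th (i - 1) \<cdot>\<^sub>m 1\<^sub>m (d + 1)) * (As - ?ths i \<cdot>\<^sub>m 1\<^sub>m (d + 1))) *\<^sub>v u = \<phi> i \<cdot>\<^sub>v u"
      unfolding ph[OF i] using i by (intro bidiagonal_first_split[OF A As _ _ u]) auto
  qed
  have second: "second_split_sequence d A As E Es \<psi>"
    unfolding second_split_sequence_def first_split_sequence_def
  proof (rule exI[of _ "\<lambda>i. ?th (d - i)"], rule exI[of _ ?ths], intro conjI ES(2,3) ballI)
    fix i assume i: "i \<in> {1..d}"
    then have i': "0 < i" "i \<le> d" by auto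
    have mem: "u \<in> split_space d (\<lambda>i. E (d - i)) Es i \<longleftrightarrow> u \<in> carrier_vec ?n \<and>
        (\<forall>k\<le>d. i < k \<longrightarrow> u $ k = 0) \<and> (\<forall>k\<le>d. d - i < k \<longrightarrow> (?G *\<^sub>v u) $ k = 0)" for u
      unfolding split_space_def Int_iff image_Es[OF i'(2)]
      unfolding E_def sum_of_images_reverse[OF inj D i'(2)] by auto
    show "\<exists>u\<in>split_space d (\<lambda>i. E (d - i)) Es i. u \<noteq> 0\<^sub>v (d + 1)"
    proof -
      \<comment> \<open>A nonzero member: the reversed Newton polynomial of degree i, expanded in
        the Newton basis and rescaled by the denominators of \<open>newton_matrix\<close>. It is
        nonzero because its value at the 0-th point is.\<close>
      let ?e = "newton_poly (\<lambda>k. ?th (d - k)) i"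
      obtain c where c: "?e = (\<Sum>k\<le>i. Polynomial.smult (c k) (newton_poly ?th k))"
        using newton_expansion[of ?e i ?th] by auto
      define u where "u = vec ?n (\<lambda>k. if k \<le> i then c k * (\<Prod>l<k. A $$ (Suc l, l)) else 0)"
      have u: "u \<in> carrier_vec ?n" "\<And>k. i < k \<Longrightarrow> k \<le> d \<Longrightarrow> u $ k = 0" by (auto simp: u_def)
      have Gu: "(?G *\<^sub>v u) $ j = poly ?e (?th j)" if "j \<le> d" for j
      proof -
        have uk: "u $ k / (\<Prod>l<k. A $$ (Suc l, l)) = c k" if "k \<le> i" for k
        proof -
          have "(\<Prod>l<k. A $$ (Suc l, l)) \<noteq> 0" using nzA that i'(2) by auto
          then show ?thesis using that i'(2) by (simp add: u_def)
        qed
        have "(?G *\<^sub>v u) $ j = poly (\<Sum>k\<le>i. Polynomial.smult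
            (u $ k / (\<Prod>l<k. A $$ (Suc l, l))) (newton_poly ?th k)) (?th j)"
          by (rule newton_matrix_mult_vec[OF u i'(2) that])
        also have "(\<Sum>k\<le>i. Polynomial.smult (u $ k / (\<Prod>l<k. A $$ (Suc l, l))) (newton_poly ?th k)) = ?e"
          unfolding c by (intro sum.cong refl) (simp add: uk)
        finally show ?thesis .
      qed
      have "u \<in> split_space d (\<lambda>i. E (d - i)) Es i"
        unfolding mem
      proof (intro conjI allI impI)
        fix k assume k: "k \<le> d" "d - i < k"
        then show "(?G *\<^sub>v u) $ k = 0"
          unfolding Gu[OF k(1)] using newton_poly_root[of "d - k" i "\<lambda>k. ?th (d - k)"] i' by simp
      qed (use u in auto)
      moreover have "u \<noteq> 0\<^sub>v ?n"
      proof
        assume "u = 0\<^sub>v ?n"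
        then have "(?G *\<^sub>v u) $ 0 = 0" by (simp add: newton_matrix_def scalar_prod_def)
        then have "poly ?e (?th (d - d)) = 0" using Gu[of 0] by simp
        then show False using newton_poly_nonroot[OF inj_on_reverse[OF inj] i'(2) order.refl] by simp
      qed
      ultimately show ?thesis by blast
    qed
    fix u assume "u \<in> split_space d (\<lambda>i. E (d - i)) Es i"
    then have u: "u \<in> carrier_vec ?n" "\<And>k. i < k \<Longrightarrow> k \<le> d \<Longrightarrow> u $ k = 0"
      "\<And>k. d - i < k \<Longrightarrow> k \<le> d \<Longrightarrow> (?G *\<^sub>v u) $ k = 0" unfolding mem by auto
    show "((A - ?th (d - (i - 1)) \<cdot>\<^sub>m 1\<^sub>m (d + 1)) * (As - ?ths i \<cdot>\<^sub>m 1\<^sub>m (d + 1))) *\<^sub>v u = \<psi> i \<cdot>\<^sub>v u"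
      using bidiagonal_second_split[OF A(1) As(1) inj D band(3) i' u] i by simp
  qed
  have "Leonard_pair d A As" unfolding Leonard_pair_def using mf I by blast
  moreover have "designated_Leonard_system d A As E Es"
    unfolding designated_Leonard_system_def Leonard_system_def using mf I ES by blast
  ultimately show ?thesis
    unfolding designated_parameter_array_def parameter_array_of_def using ES' first second by blast
qed

text \<open>The matrix entries fix \<open>\<theta>\<close>, \<open>\<theta>s\<close> and
  \<open>\<phi>\<close>, and (4) expresses \<open>\<psi>\<close> through these.\<close>

lemma parameter_array_unique:
  assumes "parameter_array d \<theta> \<theta>s \<phi> \<psi>" "matches_entries d A As \<theta> \<theta>s \<phi>"
    and "parameter_array d \<theta>' \<theta>s' \<phi>' \<psi>'" "matches_entries d A As \<theta>' \<theta>s' \<phi>'"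
  shows "(\<forall>i\<le>d. \<theta> i = \<theta>' i \<and> \<theta>s i = \<theta>s' i) \<and> (\<forall>i\<in>{1..d}. \<phi> i = \<phi>' i \<and> \<psi> i = \<psi>' i)"
proof -
  have eq: "\<And>i. i \<le> d \<Longrightarrow> \<theta> i = \<theta>' i" "\<And>i. i \<le> d \<Longrightarrow> \<theta>s i = \<theta>s' i" "\<And>i. i \<in> {1..d} \<Longrightarrow> \<phi> i = \<phi>' i"
    using assms(2,4) unfolding matches_entries_def by auto
  have par: "parameter_array d \<theta>' \<theta>s' \<phi>' \<psi>"
    using assms(1) eq by (rule parameter_array_cong)
  have "\<psi> i = \<psi>' i" if i: "i \<in> {1..d}" for i
    using bspec[OF par[unfolded parameter_array_def, THEN conjunct2, THEN conjunct2, THEN conjunct2, THEN conjunct1] i]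
      bspec[OF assms(3)[unfolded parameter_array_def, THEN conjunct2, THEN conjunct2, THEN conjunct2, THEN conjunct1] i]
    by (rule trans[OF _ sym])
  with eq show ?thesis by blast
qed

theorem theorem17p1:
  fixes d :: nat and A As :: "'a::field mat"
  assumes "A \<in> carrier_mat (d + 1) (d + 1)" and "As \<in> carrier_mat (d + 1) (d + 1)"
    and "lower_bidiagonal A" and "upper_bidiagonal As"
  shows "(Leonard_pair d A As \<longleftrightarrow>
            (\<exists>\<theta> \<theta>s \<phi> \<psi>. parameter_array d \<theta> \<theta>s \<phi> \<psi> \<and> matches_entries d A As \<theta> \<theta>s \<phi>)) \<and>
         (Leonard_pair d A As \<longrightarrow>
            (\<forall>\<theta> \<theta>s \<phi> \<psi> \<theta>' \<theta>s' \<phi>' \<psi>'.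
               parameter_array d \<theta> \<theta>s \<phi> \<psi> \<and> matches_entries d A As \<theta> \<theta>s \<phi> \<and>
               parameter_array d \<theta>' \<theta>s' \<phi>' \<psi>' \<and> matches_entries d A As \<theta>' \<theta>s' \<phi>' \<longrightarrow>
                 (\<forall>i\<le>d. \<theta> i = \<theta>' i \<and> \<theta>s i = \<theta>s' i) \<and>
                 (\<forall>i\<in>{1..d}. \<phi> i = \<phi>' i \<and> \<psi> i = \<psi>' i)) \<and>
            (\<forall>\<theta> \<theta>s \<phi> \<psi>.
               parameter_array d \<theta> \<theta>s \<phi> \<psi> \<and> matches_entries d A As \<theta> \<theta>s \<phi> \<longrightarrow>
                 designated_parameter_array d A As \<theta> \<theta>s \<phi> \<psi>))"
proof (intro conjI impI allI iffI)
  assume "Leonard_pair d A As"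
  then obtain \<psi> where
    "parameter_array d (\<lambda>i. A $$ (i, i)) (\<lambda>i. As $$ (i, i)) (\<lambda>i. A $$ (i, i - 1) * As $$ (i - 1, i)) \<psi>"
    using Leonard_pair_imp_parameter_array[OF assms(1,3,2,4)] by blast
  moreover have "matches_entries d A As (\<lambda>i. A $$ (i, i)) (\<lambda>i. As $$ (i, i)) (\<lambda>i. A $$ (i, i - 1) * As $$ (i - 1, i))"
    by (simp add: matches_entries_def)
  ultimately show "\<exists>\<theta> \<theta>s \<phi> \<psi>. parameter_array d \<theta> \<theta>s \<phi> \<psi> \<and> matches_entries d A As \<theta> \<theta>s \<phi>"
    by blast
next
  assume "\<exists>\<theta> \<theta>s \<phi> \<psi>. parameter_array d \<theta> \<theta>s \<phi> \<psi> \<and> matches_entries d A As \<theta> \<theta>s \<phi>"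
  then show "Leonard_pair d A As"
    using parameter_array_imp_Leonard_pair[OF assms(1,3,2,4)] by blast
next
  fix \<theta> \<theta>s \<phi> \<psi>
  assume "parameter_array d \<theta> \<theta>s \<phi> \<psi> \<and> matches_entries d A As \<theta> \<theta>s \<phi>"
  then show "designated_parameter_array d A As \<theta> \<theta>s \<phi> \<psi>"
    using parameter_array_imp_Leonard_pair[OF assms(1,3,2,4)] by blast
qed (use parameter_array_unique in blast)+

end
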